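(* Let $\mathcal{R}$ be a finite von Neumann algebra of type $\mathrm{I}$ with center $\mathcal{Z}$, and let $LS(\mathcal{R})$ be the algebra of locally measurable operators affiliated with $\mathcal{R}$. If the lattice $\mathcal{Z}_{\mathcal{P}}$ of all projections in $\mathcal{Z}$ is atomic, then every derivation $D:\mathcal{R}\rightarrow LS(\mathcal{R})$ is an inner derivation.
   Context: Let $\mathcal{R}$ act on a Hilbert space $H$. A closed densely defined operator $x$ affiliated with $\mathcal{R}$ is measurable if there are projections $p_k\in\mathcal{R}$, $p_k\uparrow 1$, with $p_k(H)\subseteq \mathrm{dom}(x)$ and $1-p_k$ finite in $\mathcal{R}$ for all $k$; $S(\mathcal{R})$ is the set of these. A closed densely defined operator $x$ affiliated with $\mathcal{R}$ is locally measurable if there are central projections $z_k\uparrow 1$ of $\mathcal{R}$ with $z_kx\in S(\mathcal{R})$ for all $k$; $LS(\mathcal{R})$ is the set of these. $LS(\mathcal{R})$ is a unital $*$-algebra under strong addition, strong multiplication (closures of the algebraic sum and product) and adjoint; it contains $\mathcal{R}$ as a subalgebra and so is an $\mathcal{R}$-bimodule. (When $\mathcal{R}$ is finite, $LS(\mathcal{R})=S(\mathcal{R})$.) A derivation from an algebra $\mathcal{B}$ over $\mathbb{C}$ into a $\mathcal{B}$-bimodule $\mathcal{N}$ is a linear map $\delta$ with $\delta(ab)=\delta(a)b+a\delta(b)$ for all $a,b\in\mathcal{B}$ (no continuity is assumed); it is inner if there is $m\in\mathcal{N}$ with $\delta(a)=ma-am$ for all $a\in\mathcal{B}$. A Boolean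 algebra is atomic if every nonzero element majorizes an atom, where an atom is a nonzero element $q$ such that $0\neq e\leq q$ implies $e=q$. *)

theory Defs
  imports "HOL-Analysis.Analysis"
begin

section \<open>Complex Hilbert spaces and bounded operators\<close>

class complex_inner = real_normed_vector +
  fixes scaleC :: "complex \<Rightarrow> 'a \<Rightarrow> 'a"  (infixr \<open>*\<^sub>C\<close> 75)
    and cinner :: "'a \<Rightarrow> 'a \<Rightarrow> complex"
  assumes scaleC_add_right: "c *\<^sub>C (x + y) = c *\<^sub>C x + c *\<^sub>C y"
    and scaleC_add_left: "(c + d) *\<^sub>C x = c *\<^sub>C x + d *\<^sub>C x"
    and scaleC_scaleC: "c *\<^sub>C (d *\<^sub>C x) = (c * d) *\<^sub>C x"
    and scaleC_one: "1 *\<^sub>C x = x"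
    and scaleR_scaleC: "r *\<^sub>R x = complex_of_real r *\<^sub>C x"
    and cinner_commute: "cinner x y = cnj (cinner y x)"
    and cinner_add_left: "cinner (x + y) z = cinner x z + cinner y z"
    and cinner_scaleC_left: "cinner (c *\<^sub>C x) y = c * cinner x y"
    and cinner_ge_zero: "0 \<le> Re (cinner x x)"
    and cinner_eq_zero_iff: "cinner x x = 0 \<longleftrightarrow> x = 0"
    and norm_eq_sqrt_cinner: "norm x = sqrt (Re (cinner x x))"

class chilbert_space = complex_inner + complete_space

definition bounded_clinear :: "('h::chilbert_space \<Rightarrow> 'h) \<Rightarrow> bool" where
  "bounded_clinear a \<longleftrightarrow> bounded_linear a \<and> (\<forall>c x. a (c *\<^sub>C x) = c *\<^sub>C a x)"

text \<open>For bounded \<open>a\<close> the adjoint exists by the Riesz representation theorem and is unique; for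
  other \<open>a\<close> the value may be unspecified.\<close>

definition hadj :: "('h::chilbert_space \<Rightarrow> 'h) \<Rightarrow> ('h \<Rightarrow> 'h)" where
  "hadj a = (THE b. \<forall>x y. cinner (a x) y = cinner x (b y))"

definition projection :: "('h::chilbert_space \<Rightarrow> 'h) \<Rightarrow> bool" where
  "projection p \<longleftrightarrow> bounded_clinear p \<and> p \<circ> p = p \<and> hadj p = p"

definition proj_le :: "('h::chilbert_space \<Rightarrow> 'h) \<Rightarrow> ('h \<Rightarrow> 'h) \<Rightarrow> bool" where
  "proj_le p q \<longleftrightarrow> range p \<subseteq> range q"

text \<open>\<open>p\<^sub>k \<up> 1\<close>: an increasing sequence whose supremum in the projection lattice of the Hilbert
  space is the identity.\<close>

definition increases_to_one :: "(nat \<Rightarrow> 'h::chilbert_space \<Rightarrow> 'h) \<Rightarrow> bool" where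
  "increases_to_one p \<longleftrightarrow>
     (\<forall>k. projection (p k)) \<and> (\<forall>k. proj_le (p k) (p (Suc k))) \<and>
     (\<forall>q. projection q \<longrightarrow> (\<forall>k. proj_le (p k) q) \<longrightarrow> q = id)"


section \<open>Von Neumann algebras\<close>

definition commutant :: "('h::chilbert_space \<Rightarrow> 'h) set \<Rightarrow> ('h \<Rightarrow> 'h) set" where
  "commutant A = {b. bounded_clinear b \<and> (\<forall>a\<in>A. a \<circ> b = b \<circ> a)}"

text \<open>Being a unital subalgebra, closed in the weak operator topology, is implied by
  equality with the bicommutant.\<close>

definition von_neumann_algebra :: "('h::chilbert_space \<Rightarrow> 'h) set \<Rightarrow> bool" where
  "von_neumann_algebra R \<longleftrightarrow>
     (\<forall>a\<in>R. bounded_clinear a \<and> hadj a \<in> R) \<and> commutant (commutant R) = R"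

definition center :: "('h::chilbert_space \<Rightarrow> 'h) set \<Rightarrow> ('h \<Rightarrow> 'h) set" where
  "center R = R \<inter> commutant R"

definition projections :: "('h::chilbert_space \<Rightarrow> 'h) set \<Rightarrow> ('h \<Rightarrow> 'h) set" where
  "projections A = {p \<in> A. projection p}"

definition mvn_equiv ::
    "('h::chilbert_space \<Rightarrow> 'h) set \<Rightarrow> ('h \<Rightarrow> 'h) \<Rightarrow> ('h \<Rightarrow> 'h) \<Rightarrow> bool" where
  "mvn_equiv R p q \<longleftrightarrow> (\<exists>v\<in>R. hadj v \<circ> v = p \<and> v \<circ> hadj v = q)"

definition finite_projection ::
    "('h::chilbert_space \<Rightarrow> 'h) set \<Rightarrow> ('h \<Rightarrow> 'h) \<Rightarrow> bool" where
  "finite_projection R p \<longleftrightarrow> p \<in> projections R \<and>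
     (\<forall>q\<in>projections R. proj_le q p \<longrightarrow> mvn_equiv R q p \<longrightarrow> q = p)"

definition finite_algebra :: "('h::chilbert_space \<Rightarrow> 'h) set \<Rightarrow> bool" where
  "finite_algebra R \<longleftrightarrow> finite_projection R id"

definition abelian_projection ::
    "('h::chilbert_space \<Rightarrow> 'h) set \<Rightarrow> ('h \<Rightarrow> 'h) \<Rightarrow> bool" where
  "abelian_projection R p \<longleftrightarrow> p \<in> projections R \<and>
     (\<forall>a\<in>R. \<forall>b\<in>R. (p \<circ> a \<circ> p) \<circ> (p \<circ> b \<circ> p) = (p \<circ> b \<circ> p) \<circ> (p \<circ> a \<circ> p))"

definition type_I :: "('h::chilbert_space \<Rightarrow> 'h) set \<Rightarrow> bool" where
  "type_I R \<longleftrightarrow> (\<forall>z\<in>projections (center R). z \<noteq> (\<lambda>_. 0) \<longrightarrow>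
     (\<exists>p. abelian_projection R p \<and> p \<noteq> (\<lambda>_. 0) \<and> proj_le p z))"


section \<open>Atomic lattices\<close>

definition is_atom :: "'a set \<Rightarrow> ('a \<Rightarrow> 'a \<Rightarrow> bool) \<Rightarrow> 'a \<Rightarrow> 'a \<Rightarrow> bool" where
  "is_atom L le zero q \<longleftrightarrow> q \<in> L \<and> q \<noteq> zero \<and> (\<forall>e\<in>L. e \<noteq> zero \<longrightarrow> le e q \<longrightarrow> e = q)"

definition atomic :: "'a set \<Rightarrow> ('a \<Rightarrow> 'a \<Rightarrow> bool) \<Rightarrow> 'a \<Rightarrow> bool" where
  "atomic L le zero \<longleftrightarrow> (\<forall>e\<in>L. e \<noteq> zero \<longrightarrow> (\<exists>q. is_atom L le zero q \<and> le q e))"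


section \<open>Unbounded operators\<close>

text \<open>A partially defined operator is identified with its graph. Its domain is the library's
  \<^const>\<open>Domain\<close>, and the closure of an operator is the topological closure of its graph.\<close>

type_synonym 'h operator = "('h \<times> 'h) set"

definition op_of :: "('h::chilbert_space \<Rightarrow> 'h) \<Rightarrow> 'h operator" where
  "op_of a = {(\<xi>, a \<xi>) | \<xi>. True}"

definition linear_operator :: "'h::chilbert_space operator \<Rightarrow> bool" where
  "linear_operator x \<longleftrightarrow> single_valued x \<and> (0, 0) \<in> x \<and>
     (\<forall>\<xi> \<eta> \<xi>' \<eta>'. (\<xi>, \<eta>) \<in> x \<longrightarrow> (\<xi>', \<eta>') \<in> x \<longrightarrow> (\<xi> + \<xi>', \<eta> + \<eta>') \<in> x) \<and>
     (\<forall>c \<xi> \<eta>. (\<xi>, \<eta>) \<in> x \<longrightarrow> (c *\<^sub>C \<xi>, c *\<^sub>C \<eta>) \<in> x)"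

definition closed_densely_defined :: "'h::chilbert_space operator \<Rightarrow> bool" where
  "closed_densely_defined x \<longleftrightarrow> linear_operator x \<and> closed x \<and> closure (Domain x) = UNIV"

text \<open>In operator notation: \<open>b x \<subseteq> x b\<close> for every \<open>b\<close> in the commutant.\<close>

definition affiliated :: "('h::chilbert_space \<Rightarrow> 'h) set \<Rightarrow> 'h operator \<Rightarrow> bool" where
  "affiliated R x \<longleftrightarrow> (\<forall>b\<in>commutant R. \<forall>\<xi> \<eta>. (\<xi>, \<eta>) \<in> x \<longrightarrow> (b \<xi>, b \<eta>) \<in> x)"

definition strong_add :: "'h::chilbert_space operator \<Rightarrow> 'h operator \<Rightarrow> 'h operator"
    (infixl \<open>+\<^sub>s\<close> 65) where
  "x +\<^sub>s y = closure {(\<xi>, \<eta> + \<zeta>) | \<xi> \<eta> \<zeta>. (\<xi>, \<eta>) \<in> x \<and> (\<xi>, \<zeta>) \<in> y}"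

definition strong_diff :: "'h::chilbert_space operator \<Rightarrow> 'h operator \<Rightarrow> 'h operator"
    (infixl \<open>-\<^sub>s\<close> 65) where
  "x -\<^sub>s y = closure {(\<xi>, \<eta> - \<zeta>) | \<xi> \<eta> \<zeta>. (\<xi>, \<eta>) \<in> x \<and> (\<xi>, \<zeta>) \<in> y}"

definition strong_mult :: "'h::chilbert_space operator \<Rightarrow> 'h operator \<Rightarrow> 'h operator"
    (infixl \<open>\<cdot>\<^sub>s\<close> 70) where
  "x \<cdot>\<^sub>s y = closure {(\<xi>, \<zeta>) | \<xi> \<eta> \<zeta>. (\<xi>, \<eta>) \<in> y \<and> (\<eta>, \<zeta>) \<in> x}"

text \<open>The closure matters only for the scalar 0, where it yields the everywhere defined
  zero operator.\<close>

definition strong_scale :: "complex \<Rightarrow> 'h::chilbert_space operator \<Rightarrow> 'h operator"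
    (infixr \<open>*\<^sub>s\<close> 75) where
  "c *\<^sub>s x = closure {(\<xi>, c *\<^sub>C \<eta>) | \<xi> \<eta>. (\<xi>, \<eta>) \<in> x}"

definition measurable_ops :: "('h::chilbert_space \<Rightarrow> 'h) set \<Rightarrow> 'h operator set" where
  "measurable_ops R = {x. closed_densely_defined x \<and> affiliated R x \<and>
     (\<exists>p. (\<forall>k. p k \<in> projections R) \<and> increases_to_one p \<and>
          (\<forall>k. range (p k) \<subseteq> Domain x \<and> finite_projection R (\<lambda>\<xi>. \<xi> - p k \<xi>)))}"

text \<open>The algebraic product of a central projection and a closed operator need not be closed, so
  the product with \<open>z k\<close> below is the strong one.\<close>

definition locally_measurable_ops :: "('h::chilbert_space \<Rightarrow> 'h) set \<Rightarrow> 'h operator set" where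
  "locally_measurable_ops R = {x. closed_densely_defined x \<and> affiliated R x \<and>
     (\<exists>z. (\<forall>k. z k \<in> projections (center R)) \<and> increases_to_one z \<and>
          (\<forall>k. op_of (z k) \<cdot>\<^sub>s x \<in> measurable_ops R))}"


section \<open>Derivations into the locally measurable operators\<close>

definition derivation_LS ::
    "('h::chilbert_space \<Rightarrow> 'h) set \<Rightarrow> (('h \<Rightarrow> 'h) \<Rightarrow> 'h operator) \<Rightarrow> bool" where
  "derivation_LS R D \<longleftrightarrow>
     (\<forall>a\<in>R. D a \<in> locally_measurable_ops R) \<and>
     (\<forall>a\<in>R. \<forall>b\<in>R. D (\<lambda>\<xi>. a \<xi> + b \<xi>) = D a +\<^sub>s D b) \<and>
     (\<forall>c. \<forall>a\<in>R. D (\<lambda>\<xi>. c *\<^sub>C a \<xi>) = c *\<^sub>s D a) \<and>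
     (\<forall>a\<in>R. \<forall>b\<in>R. D (a \<circ> b) = (D a \<cdot>\<^sub>s op_of b) +\<^sub>s (op_of a \<cdot>\<^sub>s D b))"

definition inner_LS ::
    "('h::chilbert_space \<Rightarrow> 'h) set \<Rightarrow> (('h \<Rightarrow> 'h) \<Rightarrow> 'h operator) \<Rightarrow> bool" where
  "inner_LS R D \<longleftrightarrow> (\<exists>m\<in>locally_measurable_ops R.
     \<forall>a\<in>R. D a = (m \<cdot>\<^sub>s op_of a) -\<^sub>s (op_of a \<cdot>\<^sub>s m))"

end

theory Submission
  imports Defs
begin

text \<open>The atoms \<open>q\<close> of the center decompose everything. A closed densely defined operator affiliated
  with \<open>R\<close> commutes with each \<open>q\<close>, and since the atoms sum to 1 it is the closure of the algebraic
  direct sum of its blocks below the atoms; conversely every family of blocks \<open>t q \<in> q R\<close> defines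
  an operator in \<open>LS(R)\<close>. Below an atom, an abelian projection \<open>p\<close> satisfies \<open>p R p = \<complex> p\<close>, and
  finiteness makes \<open>q\<close> a finite sum of projections \<open>u\<^sub>i u\<^sub>i\<^sup>*\<close> with \<open>u\<^sub>i\<^sup>* u\<^sub>i = p\<close>. So the blocks of affiliated
  operators are bounded, and \<open>D\<close> induces derivations \<open>\<delta> : R \<rightarrow> q R\<close>, implemented by
  \<open>m\<^sub>q = \<Sum> \<delta>(u\<^sub>i) u\<^sub>i\<^sup>*\<close>. The operator with blocks \<open>m\<^sub>q\<close> implements \<open>D\<close>.\<close>

section \<open>Complex Hilbert spaces\<close>

text \<open>Why atoms: for partial isometries u, v with initial projection \<open>p\<close>, the
  products \<open>hadj u \<circ> v\<close> lie in the corner of \<open>p\<close>. In general such a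
  corner is a copy of a piece of the center, and nothing forces \<open>D\<close> to vanish there.
  Below an atom the products are complex multiples of \<open>p\<close>, and complex linearity alone
  carries them through \<delta>. The rest below the atom is finite algebra, which is why continuity
  of \<open>D\<close> is never at stake. The blocks \<open>m q\<close> are chosen atom by atom with
  no common bound on their norms, so the implementing operator may be unbounded. It is locally
  measurable because the central projection onto the atoms whose block has norm at most k turns it
  into a bounded element of \<open>R\<close>. Functional calculus is avoided throughout. That a
  corner is scalar rests on absolute values obtained by iteration, and boundedness of a block rests
  on the orthogonal projection onto the graph.\<close>

lemma cinner_add_right: "cinner x (y + z) = cinner x y + cinner x z"
  by (metis cinner_add_left cinner_commute complex_cnj_add)

lemma cinner_scaleC_right: "cinner x (c *\<^sub>C y) = cnj c * cinner x y"
  by (metis cinner_scaleC_left cinner_commute complex_cnj_mult)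

lemma scaleC_minus_one: "(- 1) *\<^sub>C x = - (x::'a::complex_inner)"
  using scaleR_scaleC[of "- 1" x] by simp

lemma scaleC_zero_left [simp]: "0 *\<^sub>C x = (0::'a::complex_inner)"
  using scaleR_scaleC[of 0 x] by simp

lemma scaleC_zero_right [simp]: "c *\<^sub>C (0::'a::complex_inner) = 0"
  by (metis mult_zero_right scaleC_scaleC scaleC_zero_left)

lemma scaleC_minus_right: "c *\<^sub>C (- x) = - (c *\<^sub>C (x::'a::complex_inner))"
  by (metis mult.commute scaleC_minus_one scaleC_scaleC)

lemma scaleC_minus_left: "(- c) *\<^sub>C x = - (c *\<^sub>C (x::'a::complex_inner))"
  using scaleC_scaleC[of "- 1" c x] by (simp add: scaleC_minus_one)

lemma scaleC_diff_right: "c *\<^sub>C (x - y) = c *\<^sub>C x - c *\<^sub>C (y::'a::complex_inner)"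
  by (metis diff_conv_add_uminus scaleC_add_right scaleC_minus_right)

lemma scaleC_left_commute: "a *\<^sub>C b *\<^sub>C x = b *\<^sub>C a *\<^sub>C (x::'a::complex_inner)"
  by (simp add: scaleC_scaleC mult.commute)

lemma cinner_minus_left: "cinner (- x) y = - cinner x y"
  by (metis cinner_scaleC_left mult_minus1 scaleC_minus_one)

lemma cinner_minus_right: "cinner x (- y) = - cinner x y"
  by (metis cinner_commute cinner_minus_left complex_cnj_minus)

lemma cinner_diff_left: "cinner (x - y) z = cinner x z - cinner y z"
  by (metis cinner_add_left cinner_minus_left diff_conv_add_uminus)

lemma cinner_diff_right: "cinner x (y - z) = cinner x y - cinner x z"
  by (metis cinner_add_right cinner_minus_right diff_conv_add_uminus)

lemma cinner_zero_left [simp]: "cinner 0 x = 0"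
  using cinner_diff_left[of x x x] by simp

lemma cinner_zero_right [simp]: "cinner x 0 = 0"
  using cinner_diff_right[of x x x] by simp

lemmas cinner_simps = cinner_add_left cinner_add_right cinner_diff_left cinner_diff_right
  cinner_scaleC_left cinner_scaleC_right cinner_minus_left cinner_minus_right

lemma Re_cinner_self: "Re (cinner x x) = (norm x)\<^sup>2"
  using cinner_ge_zero[of x] norm_eq_sqrt_cinner[of x] by simp

lemma cinner_self: "cinner x x = complex_of_real ((norm x)\<^sup>2)"
proof -
  have "Im (cinner x x) = 0"
    using cinner_commute[of x x] by (metis cnj.sel(2) equal_neg_zero)
  then show ?thesis
    by (simp add: complex_eq_iff Re_cinner_self)
qed

lemma cinner_eqI: "(\<And>z. cinner x z = cinner y z) \<Longrightarrow> x = y"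
  by (metis cinner_diff_left cinner_eq_zero_iff eq_iff_diff_eq_0)

lemma cinner_eqI_right: "(\<And>z. cinner z x = cinner z y) \<Longrightarrow> x = y"
  by (metis cinner_diff_right cinner_eq_zero_iff eq_iff_diff_eq_0)

lemma norm_scaleC: "norm (c *\<^sub>C x) = cmod c * norm (x::'a::complex_inner)"
proof -
  have "cinner (c *\<^sub>C x) (c *\<^sub>C x) = (c * cnj c) * cinner x x"
    by (simp add: cinner_scaleC_left cinner_scaleC_right)
  then have "complex_of_real ((norm (c *\<^sub>C x))\<^sup>2) = complex_of_real ((cmod c * norm x)\<^sup>2)"
    by (simp add: cinner_self complex_norm_square[symmetric] power_mult_distrib)
  then have "(norm (c *\<^sub>C x))\<^sup>2 = (cmod c * norm x)\<^sup>2"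
    by (simp only: of_real_eq_iff)
  then show ?thesis
    by (simp add: power2_eq_iff_nonneg)
qed

lemma cinner_Cauchy_Schwarz: "cmod (cinner x y) \<le> norm x * norm y"
proof (cases "y = 0")
  case False
  define a where "a = cinner x y"
  define N where "N = (norm y)\<^sup>2"
  \<comment> \<open>\<open>w\<close> is \<open>N\<close> times the component of \<open>x\<close>
    orthogonal to \<open>y\<close>; expanding its square gives the inequality.\<close>
  define w where "w = complex_of_real N *\<^sub>C x - a *\<^sub>C y"
  have N: "N > 0"
    using False by (simp add: N_def)
  have ca: "cinner y x = cnj a"
    using cinner_commute[of y x] by (simp add: a_def)
  have "cinner w w = complex_of_real N * (complex_of_real N * cinner x x - a * cnj a)"
    using cinner_self[of y]
    by (simp add: w_def cinner_simps ca N_def[symmetric] flip: a_def)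
  also have "\<dots> = complex_of_real (N * (N * (norm x)\<^sup>2 - (cmod a)\<^sup>2))"
    by (simp add: cinner_self complex_norm_square[symmetric])
  finally have "N * (N * (norm x)\<^sup>2 - (cmod a)\<^sup>2) \<ge> 0"
    using cinner_ge_zero[of w] by simp
  then have "(cmod a)\<^sup>2 \<le> (norm x * norm y)\<^sup>2"
    using N by (simp add: zero_le_mult_iff N_def power_mult_distrib mult.commute)
  then show ?thesis
    unfolding a_def by (rule power2_le_imp_le) simp
qed simp

lemma bounded_bilinear_cinner: "bounded_bilinear cinner"
proof
  show "\<exists>K. \<forall>a b. cmod (cinner a b) \<le> norm a * norm b * K"
    by (rule exI[of _ 1]) (simp add: cinner_Cauchy_Schwarz)
qed (simp_all add: cinner_simps scaleR_scaleC scaleR_conv_of_real)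

interpretation cinner: bounded_bilinear cinner
  by (rule bounded_bilinear_cinner)

lemma norm_diff_sq:
  "(norm (x - y))\<^sup>2 = (norm x)\<^sup>2 + (norm y)\<^sup>2 - 2 * Re (cinner x y)"
proof -
  have "Re (cinner y x) = Re (cinner x y)"
    using cinner_commute[of y x] by simp
  then show ?thesis
    by (simp add: cinner_simps flip: Re_cinner_self)
qed

lemma norm_add_sq:
  "(norm (x + y))\<^sup>2 = (norm x)\<^sup>2 + (norm y)\<^sup>2 + 2 * Re (cinner x y)"
  using norm_diff_sq[of x "- y"] by (simp add: cinner_simps)

lemma bounded_clinearD:
  assumes "bounded_clinear a"
  shows "bounded_linear a" "a (c *\<^sub>C x) = c *\<^sub>C a x" "a (x + y) = a x + a y" "a (x - y) = a x - a y"
    "a 0 = 0" "a (- x) = - a x" "a (sum f A) = (\<Sum>i\<in>A. a (f i))"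
proof -
  show bl: "bounded_linear a" and "a (c *\<^sub>C x) = c *\<^sub>C a x"
    using assms by (auto simp: bounded_clinear_def)
  then have l: "linear a"
    by (simp add: bounded_linear.linear)
  show "a (x + y) = a x + a y" "a (x - y) = a x - a y"
    "a 0 = 0" "a (- x) = - a x" "a (sum f A) = (\<Sum>i\<in>A. a (f i))"
    using l by (simp_all add: linear_add linear_diff linear_0 linear_neg linear_sum)
qed

lemma bounded_clinearI:
  assumes "\<And>x y. a (x + y) = a x + a y" "\<And>c x. a (c *\<^sub>C x) = c *\<^sub>C a x"
    "\<And>x. norm (a x) \<le> norm x * K"
  shows "bounded_clinear a"
  unfolding bounded_clinear_def
proof
  show "bounded_linear a"
    by (rule bounded_linear_intro[of _ K]) (use assms in \<open>simp_all add: scaleR_scaleC\<close>)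
qed (use assms in simp)

lemma bounded_clinear_ident: "bounded_clinear (\<lambda>x. x)"
  and bounded_clinear_zero: "bounded_clinear (\<lambda>x. 0)"
  by (rule bounded_clinearI[of _ 1]; simp)+

lemma bounded_clinear_compose:
  "bounded_clinear a \<Longrightarrow> bounded_clinear b \<Longrightarrow> bounded_clinear (\<lambda>x. a (b x))"
  unfolding bounded_clinear_def by (auto intro: bounded_linear_compose)

lemma bounded_clinear_add:
  "bounded_clinear a \<Longrightarrow> bounded_clinear b \<Longrightarrow> bounded_clinear (\<lambda>x. a x + b x)"
  unfolding bounded_clinear_def by (auto intro: bounded_linear_add simp: scaleC_add_right)

lemma bounded_linear_scaleC_right: "bounded_linear (\<lambda>x. c *\<^sub>C (x::'a::complex_inner))"
  by (rule bounded_linear_intro[of _ "cmod c"])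
    (auto simp: scaleC_add_right scaleR_scaleC scaleC_left_commute norm_scaleC mult.commute)

lemma bounded_clinear_scaleC:
  "bounded_clinear a \<Longrightarrow> bounded_clinear (\<lambda>x. c *\<^sub>C a x)"
  unfolding bounded_clinear_def
  by (auto intro: bounded_linear_compose[OF bounded_linear_scaleC_right] simp: scaleC_left_commute)

section \<open>Orthogonal projections onto closed subspaces\<close>

definition closed_csubspace :: "'a::complex_inner set \<Rightarrow> bool" where
  "closed_csubspace K \<longleftrightarrow> closed K \<and> 0 \<in> K \<and>
     (\<forall>x\<in>K. \<forall>y\<in>K. x + y \<in> K) \<and> (\<forall>c. \<forall>x\<in>K. c *\<^sub>C x \<in> K)"

lemma closed_csubspace_diff:
  "closed_csubspace K \<Longrightarrow> x \<in> K \<Longrightarrow> y \<in> K \<Longrightarrow> x - y \<in> K"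
  unfolding closed_csubspace_def by (metis diff_conv_add_uminus scaleC_minus_one)

text \<open>A minimizing sequence for the distance to \<open>K\<close> is Cauchy by the
  parallelogram law, and minimality of its limit forces orthogonality.\<close>

lemma exists_orthogonal_projection:
  fixes x :: "'h::chilbert_space"
  assumes K: "closed_csubspace K"
  shows "\<exists>k\<in>K. \<forall>y\<in>K. cinner (x - k) y = 0"
proof -
  define S where "S = (\<lambda>k. (norm (x - k))\<^sup>2) ` K"
  define d where "d = Inf S"
  have ne: "S \<noteq> {}" and bdd: "bdd_below S"
    using K by (auto simp: S_def closed_csubspace_def intro!: bdd_belowI[of _ 0])
  have lower: "d \<le> (norm (x - k))\<^sup>2" if "k \<in> K" for k
    unfolding d_def by (rule cInf_lower) (use bdd that in \<open>auto simp: S_def\<close>)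
  have "\<exists>k\<in>K. (norm (x - k))\<^sup>2 < d + 1 / real (Suc n)" for n
    using cInf_lessD[OF ne, of "d + 1 / real (Suc n)"] by (auto simp: S_def d_def)
  then obtain k where k: "\<And>n. k n \<in> K" "\<And>n. (norm (x - k n))\<^sup>2 < d + 1 / real (Suc n)"
    by metis
  \<comment> \<open>The midpoint of \<open>k n\<close> and \<open>k m\<close> is in
    \<open>K\<close>, so its squared distance to \<open>x\<close> is at least \<open>d\<close>; the
    parallelogram law turns this into a bound on their difference.\<close>
  have gap: "(norm (k n - k m))\<^sup>2 \<le> 2 / real (Suc n) + 2 / real (Suc m)" for n m
  proof -
    have "(1 / 2) *\<^sub>R (k n + k m) \<in> K"
      using K k unfolding closed_csubspace_def scaleR_scaleC by blast
    then have "d \<le> (norm (x - (1 / 2) *\<^sub>R (k n + k m)))\<^sup>2"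
      by (rule lower)
    also have "x - (1 / 2) *\<^sub>R (k n + k m) = (1 / 2) *\<^sub>R ((x - k n) + (x - k m))"
      by (simp add: algebra_simps flip: scaleR_2)
    finally have "4 * d \<le> (norm ((x - k n) + (x - k m)))\<^sup>2"
      by (simp add: power_divide)
    moreover have "(norm ((x - k n) + (x - k m)))\<^sup>2 + (norm (k n - k m))\<^sup>2
        = 2 * (norm (x - k n))\<^sup>2 + 2 * (norm (x - k m))\<^sup>2"
      using norm_add_sq[of "x - k n" "x - k m"] norm_diff_sq[of "x - k m" "x - k n"]
        cinner_commute[of "x - k n" "x - k m"] by simp
    ultimately show ?thesis
      using k(2)[of n] k(2)[of m] by simp
  qed
  have "Cauchy k"
  proof (rule metric_CauchyI)
    fix e :: real
    assume e: "e > 0"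
    obtain N where N: "4 / real (Suc N) < e\<^sup>2"
      using reals_Archimedean[of "e\<^sup>2 / 4"] e by (auto simp: field_simps)
    have "dist (k m) (k n) < e" if "m \<ge> N" "n \<ge> N" for m n
    proof -
      have "2 / real (Suc m) \<le> 2 / real (Suc N)" "2 / real (Suc n) \<le> 2 / real (Suc N)"
        using that by (simp_all add: frac_le)
      then have "(norm (k m - k n))\<^sup>2 < e\<^sup>2"
        using gap[of m n] N by simp
      then show ?thesis
        using e by (simp add: dist_norm power_less_imp_less_base)
    qed
    then show "\<exists>M. \<forall>m\<ge>M. \<forall>n\<ge>M. dist (k m) (k n) < e"
      by blast
  qed
  then obtain l where l: "k \<longlonglongrightarrow> l"
    using Cauchy_convergent convergent_def by blast
  have lK: "l \<in> K"
    using K k(1) l closed_sequentially unfolding closed_csubspace_def by blast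
  have "(\<lambda>n. (norm (x - k n))\<^sup>2) \<longlonglongrightarrow> (norm (x - l))\<^sup>2"
    by (intro tendsto_intros l)
  moreover have "(\<lambda>n. d + 1 / real (Suc n)) \<longlonglongrightarrow> d + 0"
    by (intro tendsto_intros LIMSEQ_inverse_real_of_nat[unfolded inverse_eq_divide])
  ultimately have "(norm (x - l))\<^sup>2 \<le> d + 0"
    by (rule LIMSEQ_le) (use k(2) in \<open>blast intro: less_imp_le\<close>)
  then have min: "(norm (x - l))\<^sup>2 \<le> d"
    by simp
  have "cinner (x - l) y = 0" if y: "y \<in> K" for y
  proof (cases "y = 0")
    case False
    define a where "a = cinner (x - l) y"
    define N where "N = (norm y)\<^sup>2"
    have N: "N > 0"
      using False by (simp add: N_def)
    \<comment> \<open>The optimal coefficient: moving \<open>l\<close> by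
      \<open>t *\<^sub>C y\<close> lowers the squared distance by
      \<open>(cmod a)\<^sup>2 / N\<close>, which minimality only permits if \<open>a\<close> is
      0.\<close>
    define t where "t = a / complex_of_real N"
    have "l + t *\<^sub>C y \<in> K"
      using K lK y by (simp add: closed_csubspace_def)
    then have "(norm (x - l))\<^sup>2 \<le> (norm (x - (l + t *\<^sub>C y)))\<^sup>2"
      using lower[of "l + t *\<^sub>C y"] min by linarith
    also have "x - (l + t *\<^sub>C y) = (x - l) - t *\<^sub>C y"
      by simp
    also have "(norm \<dots>)\<^sup>2 = (norm (x - l))\<^sup>2 + (cmod t)\<^sup>2 * N - 2 * Re (cnj t * a)"
      by (simp add: norm_diff_sq norm_scaleC power_mult_distrib N_def cinner_scaleC_right a_def)
    also have "cnj t * a = complex_of_real ((cmod a)\<^sup>2 / N)"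
      by (simp add: t_def complex_norm_square[symmetric] mult.commute[of _ a])
    also have "(cmod t)\<^sup>2 * N = (cmod a)\<^sup>2 / N"
      using N by (simp add: t_def norm_divide power_divide power2_eq_square)
    finally have "(cmod a)\<^sup>2 / N \<le> 0"
      by simp
    then show ?thesis
      using N by (simp add: a_def divide_le_0_iff)
  qed simp
  then show ?thesis
    using lK by blast
qed

definition orth_proj :: "'h::chilbert_space set \<Rightarrow> 'h \<Rightarrow> 'h" where
  "orth_proj K x = (THE k. k \<in> K \<and> (\<forall>y\<in>K. cinner (x - k) y = 0))"

lemma orth_proj_eq:
  assumes "closed_csubspace K" "k \<in> K" "\<And>y. y \<in> K \<Longrightarrow> cinner (x - k) y = 0"
  shows "orth_proj K x = k"
  unfolding orth_proj_def
proof (rule the_equality)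
  fix l
  assume l: "l \<in> K \<and> (\<forall>y\<in>K. cinner (x - l) y = 0)"
  have "k - l \<in> K"
    using assms l closed_csubspace_diff by blast
  then have "cinner (x - l) (k - l) - cinner (x - k) (k - l) = 0"
    using assms l by simp
  moreover have "cinner (x - l) (k - l) - cinner (x - k) (k - l) = cinner (k - l) (k - l)"
    by (simp add: cinner_simps)
  ultimately show "l = k"
    using cinner_eq_zero_iff[of "k - l"] by simp
qed (use assms in auto)

context
  fixes K :: "'h::chilbert_space set"
  assumes K: "closed_csubspace K"
begin

lemma orth_proj_mem: "orth_proj K x \<in> K"
  and orth_proj_orth: "y \<in> K \<Longrightarrow> cinner (x - orth_proj K x) y = 0"
  using exists_orthogonal_projection[OF K, of x] orth_proj_eq[OF K] by auto

lemma orth_proj_fixes: "x \<in> K \<Longrightarrow> orth_proj K x = x"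
  by (rule orth_proj_eq[OF K]) auto

lemma range_orth_proj: "range (orth_proj K) = K"
  using orth_proj_mem orth_proj_fixes by (metis image_subset_iff rangeI subset_antisym subset_iff)

lemma orth_proj_add: "orth_proj K (x + y) = orth_proj K x + orth_proj K y"
proof (rule orth_proj_eq[OF K])
  show "orth_proj K x + orth_proj K y \<in> K"
    using K orth_proj_mem by (auto simp: closed_csubspace_def)
  fix z
  assume "z \<in> K"
  then show "cinner (x + y - (orth_proj K x + orth_proj K y)) z = 0"
    using orth_proj_orth[of z x] orth_proj_orth[of z y] by (simp add: cinner_simps)
qed

lemma orth_proj_scaleC: "orth_proj K (c *\<^sub>C x) = c *\<^sub>C orth_proj K x"
proof (rule orth_proj_eq[OF K])
  show "c *\<^sub>C orth_proj K x \<in> K"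
    using K orth_proj_mem by (auto simp: closed_csubspace_def)
  fix z
  assume "z \<in> K"
  then show "cinner (c *\<^sub>C x - c *\<^sub>C orth_proj K x) z = 0"
    using orth_proj_orth[of z x] by (simp add: cinner_simps)
qed

lemma norm_orth_proj_le: "norm (orth_proj K x) \<le> norm x"
proof -
  have "(norm x)\<^sup>2 = (norm (x - orth_proj K x))\<^sup>2 + (norm (orth_proj K x))\<^sup>2"
    using norm_add_sq[of "x - orth_proj K x" "orth_proj K x"]
      orth_proj_orth[OF orth_proj_mem, of x] by simp
  then show ?thesis
    by (simp add: power2_le_imp_le)
qed

lemma bounded_clinear_orth_proj: "bounded_clinear (orth_proj K)"
  by (rule bounded_clinearI[of _ 1]) (auto simp: orth_proj_add orth_proj_scaleC norm_orth_proj_le)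

lemma orth_proj_selfadjoint: "cinner (orth_proj K x) y = cinner x (orth_proj K y)"
proof -
  have "cinner (orth_proj K x) (y - orth_proj K y) = 0"
    by (metis cinner_commute complex_cnj_zero orth_proj_mem orth_proj_orth)
  moreover have "cinner (x - orth_proj K x) (orth_proj K y) = 0"
    by (rule orth_proj_orth[OF orth_proj_mem])
  ultimately show ?thesis
    by (simp add: cinner_simps)
qed

text \<open>Invariance of \<open>K\<close> under the adjoint \<open>c\<close> means that
  \<open>b\<close> also preserves the orthogonal complement. The adjoint is a parameter so that on
  the product space it can be given componentwise.\<close>

lemma orth_proj_commute:
  assumes "bounded_clinear b" "\<And>x y. cinner (b x) y = cinner x (c y)"
    and "b ` K \<subseteq> K" "c ` K \<subseteq> K"
  shows "orth_proj K (b x) = b (orth_proj K x)"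
proof (rule orth_proj_eq[OF K])
  show "b (orth_proj K x) \<in> K"
    using assms orth_proj_mem by blast
  fix y
  assume "y \<in> K"
  then have "c y \<in> K"
    using assms by blast
  then show "cinner (b x - b (orth_proj K x)) y = 0"
    using orth_proj_orth[of "c y" x] assms(2) by (simp add: cinner_diff_left)
qed

end

section \<open>Riesz representation, adjoints and projections\<close>

lemma hadj_eqI:
  assumes "\<And>x y. cinner (a x) y = cinner x (b y)"
  shows "hadj a = b"
  unfolding hadj_def
proof (rule the_equality)
  fix c
  assume "\<forall>x y. cinner (a x) y = cinner x (c y)"
  then show "c = b"
    using assms by (metis cinner_eqI_right ext)
qed (use assms in blast)

text \<open>The kernel of a nonzero functional has codimension one. With \<open>z\<close> orthogonal
  to it, \<open>f z *\<^sub>C x - f x *\<^sub>C z\<close> lies in the kernel, and its inner product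
  with \<open>z\<close> yields the formula for \<open>f x\<close>.\<close>

lemma Riesz_representation:
  fixes f :: "'h::chilbert_space \<Rightarrow> complex"
  assumes f: "bounded_linear f" and fC: "\<And>c x. f (c *\<^sub>C x) = c * f x"
  shows "\<exists>y. \<forall>x. f x = cinner x y"
proof (cases "\<forall>x. f x = 0")
  case False
  then obtain x0 where x0: "f x0 \<noteq> 0"
    by blast
  define K where "K = {x. f x = 0}"
  have lin: "linear f"
    using f by (simp add: bounded_linear.linear)
  have "closed K"
    unfolding K_def using bounded_linear.continuous_on[OF f continuous_on_id]
    by (intro closed_Collect_eq) (auto intro: continuous_intros)
  then have K: "closed_csubspace K"
    using lin fC by (auto simp: closed_csubspace_def K_def linear_0 linear_add)
  define z where "z = x0 - orth_proj K x0"
  have fz: "f z \<noteq> 0"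
    using x0 orth_proj_mem[OF K, of x0] lin by (simp add: z_def K_def linear_diff)
  then have z0: "z \<noteq> 0"
    using lin linear_0 by blast
  have "f x = cinner x ((cnj (f z) / cinner z z) *\<^sub>C z)" for x
  proof -
    have "f z *\<^sub>C x - f x *\<^sub>C z \<in> K"
      using lin fC by (simp add: K_def linear_diff mult.commute)
    then have "cinner z (f z *\<^sub>C x - f x *\<^sub>C z) = 0"
      using orth_proj_orth[OF K] by (simp add: z_def)
    then have "cinner (f z *\<^sub>C x - f x *\<^sub>C z) z = 0"
      by (metis cinner_commute complex_cnj_zero)
    then have "f z * cinner x z = f x * cinner z z"
      by (simp add: cinner_simps)
    moreover have "cnj (cinner z z) = cinner z z" "cinner z z \<noteq> 0"
      using z0 cinner_eq_zero_iff by (auto simp flip: cinner_commute)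
    ultimately show ?thesis
      by (simp add: cinner_scaleC_right field_simps)
  qed
  then show ?thesis
    by blast
qed (auto intro: exI[of _ 0])

lemma cinner_hadj_right:
  fixes a :: "'h::chilbert_space \<Rightarrow> 'h"
  assumes "bounded_clinear a"
  shows "cinner (a x) y = cinner x (hadj a y)"
proof -
  have "\<exists>z. \<forall>x. cinner (a x) y = cinner x z" for y
  proof (rule Riesz_representation)
    show "bounded_linear (\<lambda>x. cinner (a x) y)"
      using bounded_linear_compose[OF cinner.bounded_linear_left bounded_clinearD(1)[OF assms]] .
  qed (simp add: bounded_clinearD(2)[OF assms] cinner_simps)
  then obtain b where "\<And>x y. cinner (a x) y = cinner x (b y)"
    by metis
  then show ?thesis
    using hadj_eqI by metis
qed

lemma cinner_hadj_left:
  fixes a :: "'h::chilbert_space \<Rightarrow> 'h"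
  assumes "bounded_clinear a"
  shows "cinner (hadj a x) y = cinner x (a y)"
  by (metis assms cinner_commute cinner_hadj_right)

lemma bounded_clinear_hadj:
  assumes a: "bounded_clinear a"
  shows "bounded_clinear (hadj a)"
proof -
  obtain K where K: "\<And>x. norm (a x) \<le> norm x * K"
    using bounded_linear.bounded[OF bounded_clinearD(1)[OF a]] by blast
  have "norm (hadj a y) \<le> norm y * K" for y
  proof -
    have "(norm (hadj a y))\<^sup>2 = Re (cinner (a (hadj a y)) y)"
      by (simp add: cinner_hadj_right[OF a] Re_cinner_self)
    also have "\<dots> \<le> norm (a (hadj a y)) * norm y"
      by (meson cinner_Cauchy_Schwarz complex_Re_le_cmod order_trans)
    also have "\<dots> \<le> norm (hadj a y) * K * norm y"
      by (simp add: K mult_right_mono)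
    finally have *: "norm (hadj a y) * norm (hadj a y) \<le> norm (hadj a y) * (norm y * K)"
      by (simp add: power2_eq_square ac_simps)
    show ?thesis
    proof (cases "norm (hadj a y) = 0")
      case True
      have "0 \<le> norm y * K"
        using K[of y] norm_ge_zero order_trans by blast
      then show ?thesis
        using True by simp
    qed (use * in simp)
  qed
  moreover have "hadj a (x + y) = hadj a x + hadj a y" for x y
    by (rule cinner_eqI) (simp add: cinner_hadj_left[OF a] cinner_simps)
  moreover have "hadj a (c *\<^sub>C x) = c *\<^sub>C hadj a x" for c x
    by (rule cinner_eqI) (simp add: cinner_hadj_left[OF a] cinner_simps)
  ultimately show ?thesis
    by (intro bounded_clinearI)
qed

lemma hadj_hadj: "bounded_clinear a \<Longrightarrow> hadj (hadj a) = a"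
  by (rule hadj_eqI) (rule cinner_hadj_left)

lemma projection_iff:
  "projection p \<longleftrightarrow> bounded_clinear p \<and> (\<forall>x. p (p x) = p x) \<and>
     (\<forall>x y. cinner (p x) y = cinner x (p y))"
proof
  assume p: "projection p"
  then have "bounded_clinear p" "hadj p = p" "p \<circ> p = p"
    by (simp_all add: projection_def)
  then show "bounded_clinear p \<and> (\<forall>x. p (p x) = p x) \<and> (\<forall>x y. cinner (p x) y = cinner x (p y))"
    using cinner_hadj_right[of p] by (simp add: fun_eq_iff)
next
  assume "bounded_clinear p \<and> (\<forall>x. p (p x) = p x) \<and> (\<forall>x y. cinner (p x) y = cinner x (p y))"
  then show "projection p"
    using hadj_eqI[of p p] by (simp add: projection_def fun_eq_iff)
qed

lemma projection_orth_proj: "closed_csubspace K \<Longrightarrow> projection (orth_proj K)"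
  by (simp add: projection_iff bounded_clinear_orth_proj orth_proj_fixes orth_proj_mem
      orth_proj_selfadjoint)

lemma projectionD:
  assumes "projection p"
  shows "bounded_clinear p" "p (p x) = p x" "cinner (p x) y = cinner x (p y)" "hadj p = p"
proof -
  show "bounded_clinear p" "p (p x) = p x" "cinner (p x) y = cinner x (p y)"
    using assms unfolding projection_iff by blast+
  show "hadj p = p"
    using assms unfolding projection_def by blast
qed

lemma proj_le_iff:
  assumes "projection q"
  shows "proj_le p q \<longleftrightarrow> (\<forall>x. q (p x) = p x)"
proof
  assume le: "proj_le p q"
  show "\<forall>x. q (p x) = p x"
  proof
    fix x
    obtain y where "p x = q y"
      using le unfolding proj_le_def by blast
    then show "q (p x) = p x"
      using projectionD(2)[OF assms] by simp
  qed
next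
  assume "\<forall>x. q (p x) = p x"
  then show "proj_le p q"
    unfolding proj_le_def by (metis image_subsetI rangeI)
qed

lemma projection_norm_le:
  assumes "projection p"
  shows "norm (p x) \<le> norm x"
proof -
  have "(norm (p x))\<^sup>2 = Re (cinner (p x) x)"
    using projectionD(3)[OF assms, of "p x" x] projectionD(2)[OF assms, of x]
    by (simp add: Re_cinner_self)
  also have "\<dots> \<le> norm (p x) * norm x"
    by (meson cinner_Cauchy_Schwarz complex_Re_le_cmod order_trans)
  finally have "norm (p x) * norm (p x) \<le> norm (p x) * norm x"
    by (simp add: power2_eq_square)
  then show ?thesis
    by (cases "norm (p x) = 0") auto
qed

section \<open>The Hilbert space of pairs, in which graphs of operators live\<close>

instantiation prod :: (complex_inner, complex_inner) complex_inner
begin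

definition scaleC_prod_def: "c *\<^sub>C z = (c *\<^sub>C fst z, c *\<^sub>C snd z)"
definition cinner_prod_def: "cinner z w = cinner (fst z) (fst w) + cinner (snd z) (snd w)"

instance
proof
  fix x :: "'a \<times> 'b"
  show "cinner x x = 0 \<longleftrightarrow> x = 0"
    by (simp add: cinner_prod_def cinner_self prod_eq_iff sum_power2_eq_zero_iff
        flip: of_real_add of_real_power)
  show "norm x = sqrt (Re (cinner x x))"
    by (simp add: norm_prod_def cinner_prod_def Re_cinner_self)
  show "cinner x y = cnj (cinner y x)" for y
    using cinner_commute[of "fst x" "fst y"] cinner_commute[of "snd x" "snd y"]
    by (simp add: cinner_prod_def)
  show "0 \<le> Re (cinner x x)"
    by (simp add: cinner_prod_def cinner_ge_zero)
  show "r *\<^sub>R x = complex_of_real r *\<^sub>C x" for r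
    by (simp add: scaleC_prod_def prod_eq_iff flip: scaleR_scaleC)
  show "cinner (c *\<^sub>C x) y = c * cinner x y" for c y
    by (simp add: scaleC_prod_def cinner_prod_def cinner_scaleC_left distrib_left)
  show "cinner (x + y) z = cinner x z + cinner y z" for y z
    by (simp add: cinner_prod_def cinner_add_left)
  show "c *\<^sub>C (x + y) = c *\<^sub>C x + c *\<^sub>C y" for c y
    by (simp add: scaleC_prod_def scaleC_add_right)
  show "(c + d) *\<^sub>C x = c *\<^sub>C x + d *\<^sub>C x" for c d
    by (simp add: scaleC_prod_def scaleC_add_left)
  show "c *\<^sub>C d *\<^sub>C x = (c * d) *\<^sub>C x" for c d
    by (simp add: scaleC_prod_def scaleC_scaleC)
  show "1 *\<^sub>C x = x"
    by (simp add: scaleC_prod_def scaleC_one)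
qed

end

instance prod :: (chilbert_space, chilbert_space) chilbert_space ..

section \<open>Absolute values of self-adjoint operators\<close>

text \<open>The square root of \<open>1 - A\<close> is \<open>1 - Y\<close>, where \<open>Y\<close> is the norm limit of the iteration
  \<open>Y\<^sub>n\<^sub>+\<^sub>1 = (A + Y\<^sub>n\<^sup>2) / 2\<close>; its increments are dominated by those of the scalar
  iteration with \<open>A = 1\<close>.\<close>

lemma exists_abs_operator:
  fixes T :: "'h::chilbert_space \<Rightarrow> 'h"
  assumes T: "bounded_clinear T" and sa: "\<And>x y. cinner (T x) y = cinner x (T y)"
    and contr: "\<And>x. norm (T x) \<le> norm x"
  obtains X where "bounded_clinear X" "\<And>x. X (X x) = T (T x)" "\<And>x. 0 \<le> Re (cinner (X x) x)"
    "\<And>b x. bounded_clinear b \<Longrightarrow> (\<And>y. b (T y) = T (b y)) \<Longrightarrow> b (X x) = X (b x)"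
proof -
  \<comment> \<open>The root of 1 - A is then the absolute value of \<open>T\<close>. As
    \<open>T\<close> is a self-adjoint contraction, so is \<open>A\<close>.\<close>
  define A where "A x = x - T (T x)" for x
  define Y where "Y = rec_nat (\<lambda>x::'h. 0) (\<lambda>n f x. complex_of_real (1/2) *\<^sub>C (A x + f (f x)))"
  define y where "y = rec_nat (0::real) (\<lambda>n r. (1 + r\<^sup>2) / 2)"
  have Y0: "Y 0 x = 0" and YS: "Y (Suc n) x = complex_of_real (1/2) *\<^sub>C (A x + Y n (Y n x))" for n x
    by (simp_all add: Y_def)
  have y0: "y 0 = 0" and yS: "y (Suc n) = (1 + (y n)\<^sup>2) / 2" for n
    by (simp_all add: y_def)
  have A: "bounded_clinear A"
  proof -
    have "A = (\<lambda>x. x + (- 1) *\<^sub>C T (T x))"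
      by (simp add: A_def[abs_def] scaleC_minus_one)
    then show ?thesis
      using bounded_clinear_add[OF bounded_clinear_ident
          bounded_clinear_scaleC[OF bounded_clinear_compose[OF T T]], of "- 1"] by (simp only:)
  qed
  have Abound: "norm (A x) \<le> norm x" for x
  proof -
    have "cinner x (T (T x)) = cinner (T x) (T x)"
      by (simp add: sa)
    then have "(norm (A x))\<^sup>2 = (norm x)\<^sup>2 + (norm (T (T x)))\<^sup>2 - 2 * (norm (T x))\<^sup>2"
      by (simp add: A_def norm_diff_sq Re_cinner_self)
    moreover have "(norm (T (T x)))\<^sup>2 \<le> (norm (T x))\<^sup>2"
      by (simp add: contr power_mono)
    ultimately have "(norm (A x))\<^sup>2 \<le> (norm x)\<^sup>2"
      using zero_le_power2[of "norm (T x)"] by linarith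
    then show ?thesis
      by (rule power2_le_imp_le) simp
  qed
  have Ybc: "bounded_clinear (Y n)" for n
  proof (induction n)
    case 0
    then show ?case
      using bounded_clinear_zero by (simp add: Y_def)
  next
    case (Suc n)
    have "bounded_clinear (\<lambda>x. complex_of_real (1/2) *\<^sub>C (A x + Y n (Y n x)))"
      by (rule bounded_clinear_scaleC[OF bounded_clinear_add[OF A
            bounded_clinear_compose[OF Suc Suc]]])
    moreover have "Y (Suc n) = (\<lambda>x. complex_of_real (1/2) *\<^sub>C (A x + Y n (Y n x)))"
      by (rule ext) (rule YS)
    ultimately show ?case
      by (simp only:)
  qed
  \<comment> \<open>Each iterate is a polynomial in \<open>T\<close>, hence commutes with whatever
    \<open>T\<close> commutes with. This passes to the limit and later puts \<open>X\<close> into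
    every von Neumann algebra containing \<open>T\<close>.\<close>
  have Ycomm: "b (Y n x) = Y n (b x)"
    if b: "bounded_clinear b" "\<And>y. b (T y) = T (b y)" for b n x
  proof (induction n arbitrary: x)
    case 0
    then show ?case
      by (simp add: Y0 bounded_clinearD(5)[OF b(1)])
  next
    case (Suc n)
    then show ?case
      by (simp add: YS A_def bounded_clinearD[OF b(1)] b(2))
  qed
  have TY: "T (Y n x) = Y n (T x)" for n x
    by (rule Ycomm[OF T refl])
  have YY: "Y m (Y n x) = Y n (Y m x)" for m n x
    by (rule Ycomm[OF Ybc]) (simp add: TY)
  have y_le: "0 \<le> y n \<and> y n \<le> 1 \<and> y n \<le> y (Suc n)" for n
  proof -
    have "0 \<le> y n \<and> y n \<le> 1"
      by (induction n) (auto simp: y0 yS power_le_one)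
    \<comment> \<open>Half of this square is the increment of the scalar iteration, so
      \<open>y\<close> is increasing.\<close>
    moreover have "0 \<le> (y n - 1)\<^sup>2"
      by simp
    ultimately show ?thesis
      by (simp add: yS power2_diff)
  qed
  have Ybound: "norm (Y n x) \<le> y n * norm x" for n x
  proof (induction n arbitrary: x)
    case (Suc n)
    have "norm (Y n (Y n x)) \<le> y n * (y n * norm x)"
      using Suc[of "Y n x"] mult_left_mono[OF Suc[of x], of "y n"] y_le[of n] by linarith
    then have "norm (A x + Y n (Y n x)) \<le> norm x + y n * (y n * norm x)"
      using Abound[of x] norm_triangle_ineq[of "A x" "Y n (Y n x)"] by linarith
    then show ?case
      by (simp add: YS yS norm_scaleC power2_eq_square algebra_simps)
  qed (simp add: Y0 y0)
  have Ystep: "norm (Y (Suc n) x - Y n x) \<le> (y (Suc n) - y n) * norm x" for n x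
  proof (induction n arbitrary: x)
    case 0
    then show ?case
      using Ybound[of "Suc 0" x] by (simp add: Y0 y0)
  next
    case (Suc n)
    define w where "w = Y (Suc n) x - Y n x"
    have "Y (Suc (Suc n)) x - Y (Suc n) x
        = complex_of_real (1/2) *\<^sub>C (Y (Suc n) (Y (Suc n) x) - Y n (Y n x))"
      using YS[of "Suc n" x] YS[of n x] by (simp add: scaleC_add_right scaleC_diff_right)
    \<comment> \<open>A difference of squares, factored because the iterates commute. The scalar
      iteration satisfies the same identity, so the bound on increments reproduces itself.\<close>
    also have "Y (Suc n) (Y (Suc n) x) - Y n (Y n x) = Y (Suc n) w + Y n w"
      by (simp add: w_def bounded_clinearD[OF Ybc] YY[of n "Suc n"])
    also have "norm (complex_of_real (1/2) *\<^sub>C \<dots>) \<le> (norm (Y (Suc n) w) + norm (Y n w)) / 2"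
      using norm_triangle_ineq[of "Y (Suc n) w" "Y n w"] by (simp add: norm_scaleC)
    also have "\<dots> \<le> (y (Suc n) + y n) / 2 * norm w"
      using Ybound[of "Suc n" w] Ybound[of n w] by (simp add: algebra_simps)
    also have "\<dots> \<le> (y (Suc n) + y n) / 2 * ((y (Suc n) - y n) * norm x)"
      unfolding w_def by (rule mult_left_mono[OF Suc]) (use y_le[of n] y_le[of "Suc n"] in auto)
    also have "\<dots> = ((y (Suc n))\<^sup>2 - (y n)\<^sup>2) / 2 * norm x"
      by (simp add: power2_eq_square field_simps)
    also have "((y (Suc n))\<^sup>2 - (y n)\<^sup>2) / 2 = y (Suc (Suc n)) - y (Suc n)"
    proof -
      have "(r - s) / 2 = (1 + r) / 2 - (1 + s) / 2" for r s :: real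
        by (simp add: field_simps)
      then show ?thesis
        by (simp only: yS[symmetric])
    qed
    finally show ?case .
  qed
  have Ydiff: "norm (Y (n + k) x - Y n x) \<le> (y (n + k) - y n) * norm x" for n k x
  proof (induction k)
    case (Suc k)
    have "norm (Y (n + Suc k) x - Y n x)
        \<le> norm (Y (Suc (n + k)) x - Y (n + k) x) + norm (Y (n + k) x - Y n x)"
      using norm_triangle_ineq[of "Y (Suc (n + k)) x - Y (n + k) x" "Y (n + k) x - Y n x"] by simp
    also have "\<dots> \<le> (y (n + Suc k) - y n) * norm x"
      using Suc Ystep[of "n + k" x] by (simp add: algebra_simps)
    finally show ?case .
  qed simp
  have "convergent y"
    by (rule Bseq_monoseq_convergent)
      (use y_le in \<open>auto intro!: BseqI'[of _ 1] simp: monoseq_Suc\<close>)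
  then have Cy: "Cauchy y"
    by (simp add: convergent_Cauchy)
  have "Cauchy (\<lambda>n. Y n x)" for x
  proof (rule metric_CauchyI)
    fix e :: real
    assume e: "e > 0"
    have e': "e / (norm x + 1) > 0"
      using e by (simp add: add_nonneg_pos)
    obtain M where M: "\<And>m n. m \<ge> M \<Longrightarrow> n \<ge> M \<Longrightarrow> dist (y m) (y n) < e / (norm x + 1)"
      using metric_CauchyD[OF Cy e'] by blast
    have *: "norm (Y m x - Y n x) < e" if mn: "m \<ge> n" "n \<ge> M" for m n
    proof -
      have "norm (Y m x - Y n x) \<le> (y m - y n) * norm x"
        using Ydiff[of n "m - n" x] mn by simp
      also have "\<dots> \<le> dist (y m) (y n) * norm x"
        by (simp add: dist_real_def mult_right_mono)
      also have "\<dots> \<le> dist (y m) (y n) * (norm x + 1)"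
        by (simp add: mult_left_mono)
      also have "\<dots> < e"
        using M[of m n] mn by (simp add: pos_less_divide_eq add_nonneg_pos)
      finally show ?thesis .
    qed
    show "\<exists>M. \<forall>m\<ge>M. \<forall>n\<ge>M. dist (Y m x) (Y n x) < e"
    proof (intro exI allI impI)
      fix m n
      assume "m \<ge> M" "n \<ge> M"
      then show "dist (Y m x) (Y n x) < e"
        using *[of n m] *[of m n] by (cases "n \<le> m") (auto simp: dist_norm norm_minus_commute)
    qed
  qed
  then have "\<exists>z. (\<lambda>n. Y n x) \<longlonglongrightarrow> z" for x
    using Cauchy_convergent convergent_def by blast
  then obtain Z where Z: "\<And>x. (\<lambda>n. Y n x) \<longlonglongrightarrow> Z x"
    by metis
  have Zb: "norm (Z x) \<le> norm x" for x
  proof (rule LIMSEQ_le_const2[OF tendsto_norm[OF Z]])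
    have "y n * norm x \<le> norm x" for n
      using y_le[of n] by (simp add: mult_left_le_one_le)
    then show "\<exists>N. \<forall>n\<ge>N. norm (Y n x) \<le> norm x"
      using Ybound order_trans by blast
  qed
  have Zadd: "Z (x + z) = Z x + Z z" for x z
    by (rule LIMSEQ_unique[OF Z]) (simp add: bounded_clinearD[OF Ybc] tendsto_add Z)
  have Zcomm: "b (Z x) = Z (b x)"
    if b: "bounded_clinear b" "\<And>y. b (T y) = T (b y)" for b x
  proof (rule LIMSEQ_unique)
    show "(\<lambda>n. b (Y n x)) \<longlonglongrightarrow> b (Z x)"
      by (rule bounded_linear.tendsto[OF bounded_clinearD(1)[OF b(1)] Z])
    show "(\<lambda>n. b (Y n x)) \<longlonglongrightarrow> Z (b x)"
      using Z[of "b x"] by (simp add: Ycomm[OF b])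
  qed
  have Zscale: "Z (c *\<^sub>C x) = c *\<^sub>C Z x" for c x
    by (rule Zcomm[symmetric])
      (auto simp: bounded_clinearD[OF T] intro: bounded_clinear_scaleC[OF bounded_clinear_ident])
  \<comment> \<open>Pointwise limits may be composed here because all \<open>Y n\<close> are
    contractions.\<close>
  have "(\<lambda>n. Y n (Y n x)) \<longlonglongrightarrow> Z (Z x)" for x
  proof (rule Lim_transform2)
    show "(\<lambda>n. Y n (Z x)) \<longlonglongrightarrow> Z (Z x)"
      by (rule Z)
    show "(\<lambda>n. Y n (Z x) - Y n (Y n x)) \<longlonglongrightarrow> 0"
    proof (rule Lim_null_comparison)
      show "(\<lambda>n. norm (Y n x - Z x)) \<longlonglongrightarrow> 0"
        using Z[of x] by (simp add: LIM_zero tendsto_norm_zero)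
      show "\<forall>\<^sub>F n in sequentially. norm (Y n (Z x) - Y n (Y n x)) \<le> norm (Y n x - Z x)"
      proof (rule always_eventually, rule allI)
        fix n
        have "norm (Y n (Z x - Y n x)) \<le> y n * norm (Z x - Y n x)"
          by (rule Ybound)
        also have "\<dots> \<le> norm (Z x - Y n x)"
          using y_le[of n] by (simp add: mult_left_le_one_le)
        finally show "norm (Y n (Z x) - Y n (Y n x)) \<le> norm (Y n x - Z x)"
          by (simp add: bounded_clinearD[OF Ybc] norm_minus_commute)
      qed
    qed
  qed
  then have "(\<lambda>n. Y (Suc n) x) \<longlonglongrightarrow> complex_of_real (1/2) *\<^sub>C (A x + Z (Z x))" for x
    unfolding YS by (intro bounded_linear.tendsto[OF bounded_linear_scaleC_right] tendsto_intros)
  then have Zeq: "Z x = complex_of_real (1/2) *\<^sub>C (A x + Z (Z x))" for x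
    using LIMSEQ_unique LIMSEQ_Suc[OF Z] by blast
  define X where "X x = x - Z x" for x
  have Z2: "Z (x - z) = Z x - Z z" for x z
    by (metis Zadd add_diff_cancel diff_add_cancel)
  show thesis
  proof
    show "bounded_clinear X"
    proof (rule bounded_clinearI[of _ 2])
      show "norm (X x) \<le> norm x * 2" for x
        using norm_triangle_ineq4[of x "Z x"] Zb[of x] by (simp add: X_def)
    qed (simp_all add: X_def Zadd Zscale scaleC_diff_right)
    show "X (X x) = T (T x)" for x
    proof -
      have "Z x + Z x = A x + Z (Z x)"
        using Zeq[of x] by (metis scaleR_scaleC scaleR_half_double scaleR_add_right)
      then show ?thesis
        by (simp add: X_def Z2 A_def algebra_simps)
    qed
    show "0 \<le> Re (cinner (X x) x)" for x
    proof -
      have "Re (cinner (Z x) x) \<le> norm (Z x) * norm x"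
        by (meson cinner_Cauchy_Schwarz complex_Re_le_cmod order_trans)
      also have "\<dots> \<le> norm x * norm x"
        by (simp add: Zb mult_right_mono)
      finally show ?thesis
        by (simp add: X_def cinner_diff_left Re_cinner_self power2_eq_square)
    qed
    show "b (X x) = X (b x)" if "bounded_clinear b" "\<And>y. b (T y) = T (b y)" for b x
      using that by (simp add: X_def bounded_clinearD Zcomm)
  qed
qed

section \<open>Von Neumann algebras and minimal projections\<close>

lemma commutant_iff:
  "b \<in> commutant A \<longleftrightarrow> bounded_clinear b \<and> (\<forall>a\<in>A. \<forall>x. a (b x) = b (a x))"
  by (simp add: commutant_def fun_eq_iff)

locale vna =
  fixes R :: "('h::chilbert_space \<Rightarrow> 'h) set"
  assumes vna: "von_neumann_algebra R"
begin

lemma bounded: "a \<in> R \<Longrightarrow> bounded_clinear a"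
  and hadj_mem: "a \<in> R \<Longrightarrow> hadj a \<in> R"
  and bicommutant: "commutant (commutant R) = R"
  using vna by (auto simp: von_neumann_algebra_def)

lemma commute: "a \<in> R \<Longrightarrow> b \<in> commutant R \<Longrightarrow> b (a x) = a (b x)"
  by (simp add: commutant_iff)

lemma bounded_commutant: "b \<in> commutant R \<Longrightarrow> bounded_clinear b"
  by (simp add: commutant_iff)

text \<open>The bicommutant condition in the form that proves membership: commuting with the
  commutant suffices, so operator topologies never have to be introduced.\<close>

lemma memI:
  "bounded_clinear a \<Longrightarrow> (\<And>b x. b \<in> commutant R \<Longrightarrow> b (a x) = a (b x)) \<Longrightarrow> a \<in> R"
  using commutant_iff[of a "commutant R"] bicommutant by auto

lemma ident_mem: "(\<lambda>x. x) \<in> R"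
  by (rule memI[OF bounded_clinear_ident]) simp

lemma zero_mem: "(\<lambda>x. 0) \<in> R"
  by (rule memI[OF bounded_clinear_zero]) (simp add: bounded_clinearD(5)[OF bounded_commutant])

lemma compose_mem:
  assumes "a \<in> R" "b \<in> R"
  shows "(\<lambda>x. a (b x)) \<in> R"
  by (rule memI[OF bounded_clinear_compose[OF bounded[OF assms(1)] bounded[OF assms(2)]]])
    (simp add: commute[OF assms(1)] commute[OF assms(2)])

lemma add_mem:
  assumes "a \<in> R" "b \<in> R"
  shows "(\<lambda>x. a x + b x) \<in> R"
  by (rule memI[OF bounded_clinear_add[OF bounded[OF assms(1)] bounded[OF assms(2)]]])
    (simp add: commute[OF assms(1)] commute[OF assms(2)] bounded_clinearD(3)[OF bounded_commutant])

lemma scaleC_mem: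
  assumes "a \<in> R"
  shows "(\<lambda>x. c *\<^sub>C a x) \<in> R"
  by (rule memI[OF bounded_clinear_scaleC[OF bounded[OF assms]]])
    (simp add: commute[OF assms] bounded_clinearD(2)[OF bounded_commutant])

lemma diff_mem:
  assumes "a \<in> R" "b \<in> R"
  shows "(\<lambda>x. a x - b x) \<in> R"
  using add_mem[OF assms(1) scaleC_mem[OF assms(2), of "- 1"]] by (simp add: scaleC_minus_one)

lemma sum_mem:
  assumes "\<And>i. i \<in> I \<Longrightarrow> a i \<in> R"
  shows "(\<lambda>x. \<Sum>i\<in>I. a i x) \<in> R"
  using assms by (induction I rule: infinite_finite_induct) (simp_all add: zero_mem add_mem)

lemma hadj_commutant: "b \<in> commutant R \<Longrightarrow> hadj b \<in> commutant R"
proof -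
  assume b: "b \<in> commutant R"
  note bb = bounded_commutant[OF b]
  have "a (hadj b x) = hadj b (a x)" if a: "a \<in> R" for a x
  proof (rule cinner_eqI)
    fix z
    have "cinner (a (hadj b x)) z = cinner x (b (hadj a z))"
      by (simp add: cinner_hadj_right[OF bounded[OF a]] cinner_hadj_left[OF bb])
    also have "\<dots> = cinner x (hadj a (b z))"
      by (simp add: commute[OF hadj_mem[OF a] b])
    also have "\<dots> = cinner (hadj b (a x)) z"
      by (simp add: cinner_hadj_right[OF bounded[OF a]] cinner_hadj_left[OF bb])
    finally show "cinner (a (hadj b x)) z = cinner (hadj b (a x)) z" .
  qed
  then show ?thesis
    using bounded_clinear_hadj[OF bb] by (simp add: commutant_iff)
qed

text \<open>The commutant is closed under adjoints, so an invariant subspace reduces it and the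
  projection lies in the bicommutant.\<close>

lemma orth_proj_mem_algebra:
  assumes K: "closed_csubspace K" and inv: "\<And>b x. b \<in> commutant R \<Longrightarrow> x \<in> K \<Longrightarrow> b x \<in> K"
  shows "orth_proj K \<in> R"
proof (rule memI[OF bounded_clinear_orth_proj[OF K]])
  fix b x
  assume b: "b \<in> commutant R"
  show "b (orth_proj K x) = orth_proj K (b x)"
    by (rule orth_proj_commute[OF K, symmetric, where c = "hadj b"])
      (use b inv hadj_commutant in
        \<open>auto simp: bounded_commutant cinner_hadj_right[OF bounded_commutant]\<close>)
qed

lemma orth_proj_mem_center:
  assumes K: "closed_csubspace K" and inv: "\<And>b x. b \<in> commutant R \<Longrightarrow> x \<in> K \<Longrightarrow> b x \<in> K"
    and inv': "\<And>a x. a \<in> R \<Longrightarrow> x \<in> K \<Longrightarrow> a x \<in> K"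
  shows "orth_proj K \<in> projections (center R)"
proof -
  have "a (orth_proj K x) = orth_proj K (a x)" if a: "a \<in> R" for a x
    by (rule orth_proj_commute[OF K, symmetric, where c = "hadj a"])
      (use a inv' hadj_mem in \<open>auto simp: bounded cinner_hadj_right[OF bounded]\<close>)
  then show ?thesis
    using orth_proj_mem_algebra[OF K] inv bounded_clinear_orth_proj[OF K]
    by (simp add: projections_def center_def commutant_iff projection_orth_proj[OF K])
qed

lemma center_projectionD:
  assumes "z \<in> projections (center R)"
  shows "z \<in> R" "z \<in> commutant R" "projection z" "a \<in> R \<Longrightarrow> a (z x) = z (a x)"
    "b \<in> commutant R \<Longrightarrow> b (z x) = z (b x)"
proof -
  show z: "z \<in> R" "z \<in> commutant R" "projection z"
    using assms by (auto simp: projections_def center_def)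
  show "a (z x) = z (a x)" if "a \<in> R"
    using commute[OF that z(2)] by simp
  show "b (z x) = z (b x)" if "b \<in> commutant R"
    using commute[OF z(1) that] .
qed

lemma closed_kernel:
  assumes "bounded_clinear a"
  shows "closed {x. a x = 0}"
  using bounded_linear.continuous_on[OF bounded_clinearD(1)[OF assms] continuous_on_id]
  by (intro closed_Collect_eq) (auto intro: continuous_intros)

lemma closed_fixed:
  assumes "bounded_clinear a"
  shows "closed {x. a x = x}"
  using bounded_linear.continuous_on[OF bounded_clinearD(1)[OF assms] continuous_on_id]
  by (intro closed_Collect_eq) (auto intro: continuous_intros)

end

section \<open>Primeness of the algebra below a central atom\<close>

locale central_atom = vna +
  fixes q
  assumes atom: "is_atom (projections (center R)) proj_le (\<lambda>_. 0) q"
begin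

lemma q_center: "q \<in> projections (center R)" and q_nonzero: "q \<noteq> (\<lambda>_. 0)"
  using atom by (simp_all add: is_atom_def)

lemmas q_mem = center_projectionD(1)[OF q_center]
  and q_commutant = center_projectionD(2)[OF q_center]
  and q_proj = center_projectionD(3)[OF q_center]
  and q_commute = center_projectionD(4)[OF q_center]
  and q_commute' = center_projectionD(5)[OF q_center]

lemmas q_bounded = bounded[OF q_mem]
  and q_idem = projectionD(2)[OF q_proj]

lemma below_atom:
  assumes "e \<in> projections (center R)" "\<And>x. q (e x) = e x" "e x \<noteq> 0"
  shows "e = q"
  using atom assms proj_le_iff[OF q_proj] unfolding is_atom_def by metis

text \<open>The vectors \<open>y\<close> below \<open>q\<close> with \<open>a (r y) = 0\<close> for
  all \<open>r\<close> form a closed subspace invariant under both \<open>R\<close> and its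
  commutant. Its projection is therefore central and below \<open>q\<close>; it contains
  \<open>b x\<close>, so by minimality it is \<open>q\<close> itself.\<close>

lemma prime:
  assumes a: "a \<in> R" and b: "b \<in> R" and qb: "q (b x) = b x" and bx: "b x \<noteq> 0"
    and ab: "\<And>r. r \<in> R \<Longrightarrow> a (r (b x)) = 0"
  shows "a (q y) = 0"
proof -
  define K where "K = {y. q y = y} \<inter> (\<Inter>r\<in>R. {y. a (r y) = 0})"
  have "closed {y. a (r y) = 0}" if "r \<in> R" for r
    by (rule closed_kernel[OF bounded_clinear_compose[OF bounded[OF a] bounded[OF that]]])
  then have "closed K"
    unfolding K_def using closed_fixed[OF q_bounded] by (intro closed_Int closed_INT) auto
  then have K: "closed_csubspace K"
    using a by (auto simp: closed_csubspace_def K_def bounded_clinearD[OF bounded]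
        bounded_clinearD[OF q_bounded])
  have "orth_proj K \<in> projections (center R)"
  proof (rule orth_proj_mem_center[OF K])
    fix c z
    assume c: "c \<in> commutant R" and z: "z \<in> K"
    have "a (r (c z)) = 0" if r: "r \<in> R" for r
    proof -
      have "a (r (c z)) = c (a (r z))"
        by (simp add: commute[OF a c] commute[OF r c])
      also have "\<dots> = 0"
        using z r by (simp add: K_def bounded_clinearD(5)[OF bounded_commutant[OF c]])
      finally show ?thesis .
    qed
    then show "c z \<in> K"
      using z by (simp add: K_def flip: q_commute'[OF c])
  next
    fix c z
    assume c: "c \<in> R" and z: "z \<in> K"
    then have "a (r (c z)) = 0" if r: "r \<in> R" for r
      using compose_mem[OF r c] z by (auto simp: K_def)
    then show "c z \<in> K"
      using z by (simp add: K_def flip: q_commute[OF c])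
  qed
  moreover have "q (orth_proj K y) = orth_proj K y" for y
    using orth_proj_mem[OF K, of y] by (simp add: K_def)
  moreover have bK: "b x \<in> K"
    using qb ab by (simp add: K_def)
  then have "orth_proj K (b x) \<noteq> 0"
    using bx orth_proj_fixes[OF K] by simp
  ultimately have "orth_proj K = q"
    by (rule below_atom)
  then have "q y \<in> K"
    using orth_proj_mem[OF K, of y] by simp
  then show ?thesis
    using ident_mem by (auto simp: K_def)
qed

end

section \<open>The corner of an abelian projection consists of scalars\<close>

locale central_atom_abelian = central_atom +
  fixes p
  assumes abelian: "abelian_projection R p" and p_nonzero: "p \<noteq> (\<lambda>_. 0)" and p_le_q: "proj_le p q"
begin

lemma p_mem: "p \<in> R" and p_proj: "projection p"
  using abelian by (auto simp: abelian_projection_def projections_def)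

lemmas p_bounded = bounded[OF p_mem]
  and p_idem = projectionD(2)[OF p_proj]
  and p_self = projectionD(3)[OF p_proj]

lemma qp: "q (p x) = p x"
  using p_le_q proj_le_iff[OF q_proj] by blast

lemma corner_commute:
  assumes "a \<in> R" "b \<in> R"
  shows "p (a (p (b (p x)))) = p (b (p (a (p x))))"
proof -
  have "((p \<circ> a \<circ> p) \<circ> (p \<circ> b \<circ> p)) x = ((p \<circ> b \<circ> p) \<circ> (p \<circ> a \<circ> p)) x"
    using abelian assms unfolding abelian_projection_def by simp
  then show ?thesis
    by (simp add: p_idem)
qed

text \<open>Commutativity of the corner upgrades \<open>a b = 0\<close> to \<open>a r b = 0\<close>
  for every \<open>r\<close> in \<open>R\<close>, and primeness applies.\<close>

lemma corner_no_zero_divisors: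
  assumes a: "a \<in> R" "\<And>x. p (a x) = a x" "\<And>x. a (p x) = a x"
    and b: "b \<in> R" "\<And>x. p (b x) = b x" "\<And>x. b (p x) = b x"
    and ab: "\<And>x. a (b x) = 0" and "b x \<noteq> 0"
  shows "a y = 0"
proof -
  have "a (q (p y)) = 0"
  proof (rule prime[OF a(1) b(1)])
    show "q (b x) = b x"
      by (metis b(2) qp)
    fix r
    assume r: "r \<in> R"
    have "a (r (b x)) = p (a (p (r (p (b x)))))"
      by (simp add: a b)
    also have "\<dots> = p (r (p (a (p (b x)))))"
      by (rule corner_commute[OF a(1) r])
    also have "\<dots> = 0"
      by (simp add: a b ab bounded_clinearD(5)[OF p_bounded] bounded_clinearD(5)[OF bounded[OF r]])
    finally show "a (r (b x)) = 0" .
  qed fact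
  then show ?thesis
    by (simp add: qp a)
qed

text \<open>With \<open>X\<close> the absolute value of \<open>T\<close>, the product of
  \<open>X - T\<close> and \<open>X + T\<close> vanishes, so in the absence of zero divisors one
  factor does: \<open>T\<close> is plus or minus its absolute value. This replaces the splitting
  into positive and negative parts.\<close>

lemma corner_selfadjoint_sign:
  assumes S: "S \<in> R" "\<And>x. p (S x) = S x" "\<And>x. S (p x) = S x"
    and sa: "\<And>x y. cinner (S x) y = cinner x (S y)"
  shows "(\<forall>x. 0 \<le> Re (cinner (S x) x)) \<or> (\<forall>x. Re (cinner (S x) x) \<le> 0)"
proof -
  obtain k where k: "k > 0" "\<And>x. norm (S x) \<le> norm x * k"
    using bounded_linear.pos_bounded[OF bounded_clinearD(1)[OF bounded[OF S(1)]]] by blast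
  define T where "T x = complex_of_real (1 / k) *\<^sub>C S x" for x
  have Tm: "T \<in> R"
    using scaleC_mem[OF S(1), of "complex_of_real (1 / k)"] by (simp add: T_def[abs_def])
  note Tb = bounded[OF Tm]
  have pT: "p (T x) = T x" and Tp: "T (p x) = T x" for x
    by (simp_all add: T_def bounded_clinearD[OF p_bounded] S)
  have Tsa: "cinner (T x) y = cinner x (T y)" for x y
    by (simp add: T_def cinner_scaleC_left cinner_scaleC_right sa)
  have Tn: "norm (T x) \<le> norm x" for x
    using k(1) k(2)[of x] by (simp add: T_def norm_scaleC norm_divide field_simps)
  obtain X where X: "bounded_clinear X" "\<And>x. X (X x) = T (T x)" "\<And>x. 0 \<le> Re (cinner (X x) x)"
    and Xc: "\<And>b x. bounded_clinear b \<Longrightarrow> (\<And>y. b (T y) = T (b y)) \<Longrightarrow> b (X x) = X (b x)"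
    using exists_abs_operator[OF Tb Tsa Tn] by blast
  have Xm: "X \<in> R"
    by (rule memI[OF X(1)], rule Xc) (simp_all add: bounded_commutant commute[OF Tm])
  have pX: "p (X x) = X (p x)" for x
    by (rule Xc[OF p_bounded]) (simp add: pT Tp)
  have TX: "T (X x) = X (T x)" for x
    by (rule Xc[OF Tb refl])
  \<comment> \<open>\<open>X\<close> is compressed by \<open>p\<close> so that both factors belong
    to the corner; positivity survives.\<close>
  have pos: "0 \<le> Re (cinner (p (X x)) x)" for x
  proof -
    have "cinner (p (X x)) x = cinner (X (p x)) (p x)"
      by (metis p_idem p_self pX)
    then show ?thesis
      using X(3) by simp
  qed
  have ReS: "Re (cinner (S x) x) = k * Re (cinner (T x) x)" for x
    using k(1) by (simp add: T_def cinner_scaleC_left)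
  show ?thesis
  proof (cases "\<forall>x. p (X x) + T x = 0")
    case True
    then have "T x = - p (X x)" for x
      by (metis add_eq_0_iff2 minus_minus)
    then have "Re (cinner (T x) x) \<le> 0" for x
      using pos[of x] by (simp add: cinner_minus_left)
    then show ?thesis
      using k(1) by (simp add: ReS mult_le_0_iff)
  next
    case False
    then obtain x where x: "p (X x) + T x \<noteq> 0"
      by blast
    have "p (X y) - T y = 0" for y
    proof (rule corner_no_zero_divisors[where b = "\<lambda>x. p (X x) + T x" and a = "\<lambda>x. p (X x) - T x"])
      show "(\<lambda>x. p (X x) - T x) \<in> R" "(\<lambda>x. p (X x) + T x) \<in> R"
        by (intro diff_mem add_mem compose_mem[OF p_mem Xm] Tm)+
      show "p (p (X x) - T x) = p (X x) - T x" "p (p (X x) + T x) = p (X x) + T x"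
        "p (X (p x)) - T (p x) = p (X x) - T x" "p (X (p x)) + T (p x) = p (X x) + T x" for x
        by (simp_all add: bounded_clinearD[OF p_bounded] p_idem pT Tp flip: pX)
      show "p (X (p (X x) + T x)) - T (p (X x) + T x) = 0" for x
      proof -
        have "p (X (p (X x) + T x)) = p (X (X x)) + X (T x)"
          by (simp add: bounded_clinearD[OF p_bounded] bounded_clinearD[OF X(1)] pX p_idem pT
              flip: TX)
        moreover have "T (p (X x) + T x) = X (T x) + T (T x)"
          by (simp add: bounded_clinearD[OF Tb] Tp TX)
        ultimately show ?thesis
          by (simp add: X(2) pT)
      qed
    qed (rule x)
    then have "T y = p (X y)" for y
      by simp
    then have "0 \<le> Re (cinner (T x) x)" for x
      using pos[of x] by simp
    then show ?thesis
      using k(1) by (simp add: ReS)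
  qed
qed

text \<open>Subtracting the Rayleigh quotient at one vector \<open>h\<close> makes the quadratic
  form of \<open>S\<close> vanish at \<open>h\<close>. The form has constant sign, so
  \<open>S h = 0\<close>, and a corner element with a nonzero kernel in the range of
  \<open>p\<close> is zero.\<close>

lemma corner_selfadjoint_scalar:
  assumes T: "T \<in> R" "\<And>x. p (T x) = T x" "\<And>x. T (p x) = T x"
    and sa: "\<And>x y. cinner (T x) y = cinner x (T y)"
  shows "\<exists>c. \<forall>x. T x = c *\<^sub>C p x"
proof -
  obtain h where h: "p h = h" "h \<noteq> 0"
    using p_nonzero p_idem by (metis ext)
  define c where "c = cinner (T h) h / cinner h h"
  have cnj_c: "cnj c = c"
    unfolding c_def complex_cnj_divide by (metis cinner_commute sa)
  define S where "S x = T x - c *\<^sub>C p x" for x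
  have Sm: "S \<in> R"
    using diff_mem[OF T(1) scaleC_mem[OF p_mem, of c]] by (simp add: S_def[abs_def])
  note Sb = bounded[OF Sm]
  have pS: "p (S x) = S x" and Sp: "S (p x) = S x" for x
    by (simp_all add: S_def bounded_clinearD[OF p_bounded] T p_idem)
  have Ssa: "cinner (S x) y = cinner x (S y)" for x y
    by (simp add: S_def cinner_simps sa p_self cnj_c)
  have Sh0: "cinner (S h) h = 0"
    using h cinner_eq_zero_iff[of h] by (simp add: S_def cinner_simps c_def)
  have Sh: "S h = 0"
  proof (rule ccontr)
    assume "S h \<noteq> 0"
    define N where "N = (norm (S h))\<^sup>2"
    define d where "d = Re (cinner (S (S h)) (S h))"
    have N: "N > 0"
      using \<open>S h \<noteq> 0\<close> by (simp add: N_def)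
    \<comment> \<open>Perturbing \<open>h\<close> along \<open>S h\<close> has a nonzero linear
      term, so the form would take both signs near \<open>h\<close>.\<close>
    have form: "Re (cinner (S (h - complex_of_real t *\<^sub>C S h)) (h - complex_of_real t *\<^sub>C S h))
        = t * (t * d - 2 * N)" for t
    proof -
      have "cinner (S (S h)) h = cinner (S h) (S h)" "cinner h (S (S h)) = cinner (S h) (S h)"
        by (simp_all add: Ssa)
      then show ?thesis
        by (simp add: bounded_clinearD[OF Sb] cinner_simps Sh0 d_def N_def Re_cinner_self)
          (simp add: algebra_simps)
    qed
    \<comment> \<open>Small enough for \<open>\<bar>t * d\<bar> < N\<close>, so that
      \<open>- 2 * N\<close> dominates for both \<open>t\<close> and \<open>- t\<close>; adding 1
      covers \<open>d = 0\<close>.\<close>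
    define t where "t = N / (\<bar>d\<bar> + 1)"
    have t: "t > 0"
      using N by (simp add: t_def)
    have "t * \<bar>d\<bar> < N * 1"
      using N by (simp add: t_def field_simps)
    then have "\<bar>t * d\<bar> < N"
      using t by (simp add: abs_mult)
    then have "t * d - 2 * N < 0" "(- t) * d - 2 * N < 0"
      using N by auto
    then have "t * (t * d - 2 * N) < 0" "(- t) * ((- t) * d - 2 * N) > 0"
      using t by (simp_all add: mult_pos_neg mult_neg_neg)
    moreover have "t * (t * d - 2 * N) \<ge> 0 \<and> (- t) * ((- t) * d - 2 * N) \<ge> 0 \<or>
        t * (t * d - 2 * N) \<le> 0 \<and> (- t) * ((- t) * d - 2 * N) \<le> 0"
      using corner_selfadjoint_sign[OF Sm pS Sp Ssa] form by metis
    ultimately show False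
      by linarith
  qed
  \<comment> \<open>The projection onto this kernel is in the corner, is nonzero because of
    \<open>h\<close>, and is annihilated by \<open>S\<close>.\<close>
  define K where "K = {x. p x = x} \<inter> {x. S x = 0}"
  have K: "closed_csubspace K"
    unfolding closed_csubspace_def K_def
    using closed_fixed[OF p_bounded] closed_kernel[OF Sb]
    by (auto intro!: closed_Int simp: bounded_clinearD[OF p_bounded] bounded_clinearD[OF Sb])
  have e: "orth_proj K \<in> R"
    by (rule orth_proj_mem_algebra[OF K])
      (auto simp: K_def bounded_clinearD[OF bounded_commutant]
        simp flip: commute[OF p_mem] commute[OF Sm])
  have eK: "p (orth_proj K x) = orth_proj K x" "S (orth_proj K x) = 0" for x
    using orth_proj_mem[OF K, of x] by (auto simp: K_def)
  have "S y = 0" for y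
  proof (rule corner_no_zero_divisors[OF Sm pS Sp e])
    show "orth_proj K (p x) = orth_proj K x" for x
      by (rule cinner_eqI) (simp add: orth_proj_selfadjoint[OF K] p_self eK)
    show "orth_proj K h \<noteq> 0"
      using h Sh orth_proj_fixes[OF K, of h] by (simp add: K_def)
  qed (use eK in auto)
  then show ?thesis
    by (auto simp: S_def intro!: exI[of _ c])
qed

text \<open>The self-adjoint case applied to \<open>b + hadj b\<close> for \<open>b = a\<close> and
  \<open>b = \<i> a\<close> gives scalars \<open>c\<close> and \<open>d\<close>, from which
  \<open>a\<close> is recovered as half of \<open>c - \<i> * d\<close>.\<close>

lemma corner_scalar:
  assumes a: "a \<in> R"
  shows "\<exists>c. \<forall>x. p (a (p x)) = c *\<^sub>C p x"
proof -
  note ab = bounded[OF a]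
  have "\<exists>c. \<forall>x. p (b (p x)) + p (hadj b (p x)) = c *\<^sub>C p x" if b: "b \<in> R" for b
  proof (rule corner_selfadjoint_scalar)
    show "(\<lambda>x. p (b (p x)) + p (hadj b (p x))) \<in> R"
      by (intro add_mem compose_mem[OF p_mem] compose_mem[OF _ p_mem] b hadj_mem)
    show "cinner (p (b (p x)) + p (hadj b (p x))) y = cinner x (p (b (p y)) + p (hadj b (p y)))"
      for x y
      by (simp add: cinner_add_left cinner_add_right p_self cinner_hadj_left[OF bounded[OF b]]
          cinner_hadj_right[OF bounded[OF b]])
  qed (simp_all add: bounded_clinearD[OF p_bounded] p_idem)
  note * = this
  define b where "b x = \<i> *\<^sub>C a x" for x
  have hb: "hadj b = (\<lambda>x. - \<i> *\<^sub>C hadj a x)"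
    by (rule hadj_eqI)
      (simp add: b_def cinner_scaleC_left cinner_scaleC_right cinner_hadj_right[OF ab])
  obtain c where c: "\<And>x. p (a (p x)) + p (hadj a (p x)) = c *\<^sub>C p x"
    using *[OF a] by blast
  obtain d where d: "\<And>x. \<i> *\<^sub>C p (a (p x)) - \<i> *\<^sub>C p (hadj a (p x)) = d *\<^sub>C p x"
  proof -
    have "b \<in> R"
      using scaleC_mem[OF a, of \<i>] by (simp add: b_def[abs_def])
    then obtain d where "\<And>x. p (b (p x)) + p (hadj b (p x)) = d *\<^sub>C p x"
      using * by blast
    then show thesis
      using that unfolding hb by (simp add: b_def scaleC_minus_left bounded_clinearD[OF p_bounded])
  qed
  have "p (a (p x)) = ((c - \<i> * d) / 2) *\<^sub>C p x" for x
  proof -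
    have "(- \<i>) *\<^sub>C (\<i> *\<^sub>C p (a (p x)) - \<i> *\<^sub>C p (hadj a (p x))) = (- \<i>) *\<^sub>C d *\<^sub>C p x"
      by (simp only: d)
    then have "p (a (p x)) - p (hadj a (p x)) = (- \<i> * d) *\<^sub>C p x"
      by (simp add: scaleC_diff_right scaleC_scaleC scaleC_one)
    then have "p (a (p x)) + p (a (p x)) = c *\<^sub>C p x + (- \<i> * d) *\<^sub>C p x"
      using c[of x] by (metis add_diff_cancel_left' diff_add_cancel add.assoc add.commute)
    then have "2 *\<^sub>C p (a (p x)) = (c - \<i> * d) *\<^sub>C p x"
      using scaleC_add_left[of 1 1 "p (a (p x))"] scaleC_add_left[of c "- \<i> * d" "p x"]
      by (simp add: scaleC_one)
    then have "(1 / 2) *\<^sub>C 2 *\<^sub>C p (a (p x)) = (1 / 2) *\<^sub>C (c - \<i> * d) *\<^sub>C p x"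
      by (simp only:)
    then show ?thesis
      by (simp add: scaleC_scaleC scaleC_one)
  qed
  then show ?thesis
    by blast
qed

end

section \<open>Finite frames below a central atom\<close>

text \<open>Convergence of orthogonal series with bounded square sums: \<open>a n\<close> plays the
  role of the accumulated squared norm, which converges by monotonicity.\<close>

lemma Cauchy_of_squared_increments:
  fixes z :: "nat \<Rightarrow> 'h::real_normed_vector" and a :: "nat \<Rightarrow> real"
  assumes inc: "\<And>m n. m \<le> n \<Longrightarrow> (norm (z n - z m))\<^sup>2 \<le> a n - a m" and bdd: "\<And>n. a n \<le> B"
  shows "Cauchy z"
proof -
  have mono: "a m \<le> a n" if "m \<le> n" for m n
    using inc[OF that] zero_le_power2[of "norm (z n - z m)"] by linarith
  then have "incseq a"
    by (simp add: incseq_def)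
  then obtain l where "a \<longlonglongrightarrow> l"
    using incseq_convergent bdd by metis
  then have Ca: "Cauchy a"
    by (rule LIMSEQ_imp_Cauchy)
  show ?thesis
  proof (rule metric_CauchyI)
    fix e :: real
    assume e: "e > 0"
    then obtain M where M: "\<And>m n. m \<ge> M \<Longrightarrow> n \<ge> M \<Longrightarrow> dist (a m) (a n) < e\<^sup>2"
      using metric_CauchyD[OF Ca, of "e\<^sup>2"] by auto
    have *: "norm (z n - z m) < e" if "M \<le> m" "m \<le> n" for m n
    proof -
      have "(norm (z n - z m))\<^sup>2 < e\<^sup>2"
        using inc[of m n] M[of n m] that by (auto simp: dist_real_def)
      then show ?thesis
        using e by (simp add: power_less_imp_less_base)
    qed
    show "\<exists>M. \<forall>m\<ge>M. \<forall>n\<ge>M. dist (z m) (z n) < e"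
    proof (intro exI allI impI)
      fix m n
      assume "m \<ge> M" "n \<ge> M"
      then show "dist (z m) (z n) < e"
        using *[of n m] *[of m n] by (cases "n \<le> m") (auto simp: dist_norm norm_minus_commute)
    qed
  qed
qed

lemma (in vna) limit_mem:
  assumes mem: "\<And>n. a n \<in> R" and lim: "\<And>x. (\<lambda>n. a n x) \<longlonglongrightarrow> b x"
    and bound: "\<And>x. norm (b x) \<le> norm x * K"
  shows "b \<in> R"
proof (rule memI)
  show "bounded_clinear b"
  proof (rule bounded_clinearI[of _ K])
    show "b (x + y) = b x + b y" for x y
      by (rule LIMSEQ_unique[OF lim])
        (simp add: bounded_clinearD[OF bounded[OF mem]] tendsto_add lim)
    show "b (c *\<^sub>C x) = c *\<^sub>C b x" for c x
      by (rule LIMSEQ_unique[OF lim])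
        (simp add: bounded_clinearD[OF bounded[OF mem]]
          bounded_linear.tendsto[OF bounded_linear_scaleC_right lim])
  qed (rule bound)
  fix c x
  assume c: "c \<in> commutant R"
  show "c (b x) = b (c x)"
  proof (rule LIMSEQ_unique)
    show "(\<lambda>n. c (a n x)) \<longlonglongrightarrow> c (b x)"
      by (rule bounded_linear.tendsto[OF bounded_clinearD(1)[OF bounded_commutant[OF c]] lim])
    show "(\<lambda>n. c (a n x)) \<longlonglongrightarrow> b (c x)"
      using lim[of "c x"] by (simp add: commute[OF mem c])
  qed
qed

context central_atom_abelian
begin

text \<open>The left ideal \<open>R p\<close>. If \<open>q R\<close> is pictured as a matrix algebra
  over the scalars \<open>p R p\<close>, its elements are the columns.\<close>

definition column where
  "column u \<longleftrightarrow> u \<in> R \<and> (\<forall>x. u (p x) = u x)"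

definition isometric_column where
  "isometric_column u \<longleftrightarrow> column u \<and> (\<forall>x. hadj u (u x) = p x)"

lemma columnD:
  assumes "column u"
  shows "u \<in> R" "bounded_clinear u" "u (p x) = u x" "q (u x) = u x" "p (hadj u x) = hadj u x"
proof -
  show u: "u \<in> R" "bounded_clinear u" "u (p x) = u x" for x
    using assms bounded by (auto simp: column_def)
  show "q (u x) = u x"
    using q_commute[OF u(1), of "p x"] by (simp add: qp u)
  show "p (hadj u x) = hadj u x"
    by (rule cinner_eqI) (simp add: p_self cinner_hadj_left[OF u(2)] u(3))
qed

lemma column_compose: "a \<in> R \<Longrightarrow> column u \<Longrightarrow> column (\<lambda>x. a (u x))"
  using compose_mem by (auto simp: column_def)

lemma column_diff: "column u \<Longrightarrow> column v \<Longrightarrow> column (\<lambda>x. u x - v x)"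
  using diff_mem by (auto simp: column_def)

lemma column_scaleC: "column u \<Longrightarrow> column (\<lambda>x. c *\<^sub>C u x)"
  using scaleC_mem by (auto simp: column_def)

text \<open>The product lies in the corner of \<open>p\<close>. Columns thus carry a complex valued
  inner product, and Gram-Schmidt becomes available.\<close>

lemma column_scalar:
  assumes u: "column u" and v: "column v"
  shows "\<exists>c. \<forall>x. hadj u (v x) = c *\<^sub>C p x"
  using corner_scalar[OF compose_mem[OF hadj_mem[OF columnD(1)[OF u]] columnD(1)[OF v]]]
  by (simp add: columnD(3)[OF v] columnD(5)[OF u])

text \<open>\<open>hadj w \<circ> w\<close> is a scalar multiple of \<open>p\<close>, so rescaling
  turns \<open>w\<close> into a partial isometry with initial projection \<open>p\<close>.\<close>

lemma column_normalize:
  assumes w: "column w" and wx: "w x \<noteq> 0"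
  shows "\<exists>c. c \<noteq> 0 \<and> isometric_column (\<lambda>x. c *\<^sub>C w x)"
proof -
  obtain c where c: "\<And>x. hadj w (w x) = c *\<^sub>C p x"
    using column_scalar[OF w w] by blast
  have "cinner (w x) (w x) = cinner (c *\<^sub>C p x) x"
    by (simp add: cinner_hadj_left[OF columnD(2)[OF w]] flip: c)
  also have "\<dots> = c * cinner (p x) (p x)"
    by (simp add: cinner_scaleC_left p_self p_idem)
  finally have eq: "complex_of_real ((norm (w x))\<^sup>2) = c * complex_of_real ((norm (p x))\<^sup>2)"
    by (simp add: cinner_self)
  have px: "p x \<noteq> 0"
    using wx columnD(3)[OF w, of x] bounded_clinearD(5)[OF columnD(2)[OF w]] by auto
  \<comment> \<open>The inverse square root of \<open>c\<close>, read off at the vector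
    \<open>x\<close>; this form shows at once that \<open>c\<close> is real and positive.\<close>
  define s where "s = norm (p x) / norm (w x)"
  have s: "complex_of_real s * (complex_of_real s * c) = 1"
  proof -
    have "c = complex_of_real ((norm (w x))\<^sup>2 / (norm (p x))\<^sup>2)"
      using eq px by (simp add: field_simps)
    then show ?thesis
      using px wx by (simp add: s_def field_simps power2_eq_square)
  qed
  have "hadj (\<lambda>x. complex_of_real s *\<^sub>C w x) = (\<lambda>y. complex_of_real s *\<^sub>C hadj w y)"
    by (rule hadj_eqI)
      (simp add: cinner_scaleC_left cinner_scaleC_right cinner_hadj_right[OF columnD(2)[OF w]])
  then have "hadj (\<lambda>x. complex_of_real s *\<^sub>C w x) (complex_of_real s *\<^sub>C w y) = p y" for y
    by (simp add: bounded_clinearD(2)[OF bounded_clinear_hadj[OF columnD(2)[OF w]]] c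
        scaleC_scaleC s scaleC_one)
  moreover have "complex_of_real s \<noteq> 0"
    using s by auto
  ultimately show ?thesis
    using column_scaleC[OF w] unfolding isometric_column_def by blast
qed

lemma isometric_columnD:
  assumes "isometric_column u"
  shows "column u" "hadj u (u x) = p x" "cinner (u x) (u y) = cinner (p x) y"
    "u (hadj u (u x)) = u x"
proof -
  show u: "column u" "hadj u (u x) = p x" for x
    using assms by (auto simp: isometric_column_def)
  show "cinner (u x) (u y) = cinner (p x) y"
    by (simp add: u(2) flip: cinner_hadj_left[OF columnD(2)[OF u(1)]])
  show "u (hadj u (u x)) = u x"
    by (simp add: u columnD(3)[OF u(1)])
qed

lemma orthogonal_column:
  assumes "projection e" "column u" "\<And>x. e (u x) = 0"
  shows "hadj u (e x) = 0"
  by (rule cinner_eqI)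
    (simp add: cinner_hadj_left[OF columnD(2)[OF assms(2)]] projectionD(3)[OF assms(1)] assms(3))

lemma add_column_projection:
  assumes e: "projection e" and u: "isometric_column u" and eu: "\<And>x. e (u x) = 0"
  shows "projection (\<lambda>x. e x + u (hadj u x))"
proof -
  note uD = isometric_columnD[OF u]
  note ub = columnD(2)[OF uD(1)]
  have "bounded_clinear (\<lambda>x. e x + u (hadj u x))"
    by (rule bounded_clinear_add[OF projectionD(1)[OF e]
          bounded_clinear_compose[OF ub bounded_clinear_hadj[OF ub]]])
  then show ?thesis
    by (simp add: projection_iff bounded_clinearD[OF projectionD(1)[OF e]] bounded_clinearD[OF ub]
        bounded_clinearD[OF bounded_clinear_hadj[OF ub]] projectionD(2)[OF e] eu uD(2)
        orthogonal_column[OF e uD(1) eu] columnD(5)[OF uD(1)] cinner_add_left cinner_add_right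
        projectionD(3)[OF e] cinner_hadj_right[OF ub] cinner_hadj_left[OF ub])
qed

text \<open>The sums of \<open>u \<circ> hadj u\<close> over finitely many mutually orthogonal
  isometric columns. The inductive form carries no index set and lets later constructions add one
  column at a time.\<close>

inductive frame_sum where
  zero: "frame_sum (\<lambda>_. 0)"
| step: "frame_sum (\<lambda>x. e x + u (hadj u x))"
    if "frame_sum e" "isometric_column u" "\<And>x. e (u x) = 0"

lemma frame_sumD:
  assumes "frame_sum e"
  shows "e \<in> R" "projection e" "q (e x) = e x"
proof -
  have "e \<in> R \<and> projection e \<and> (\<forall>x. q (e x) = e x)"
    using assms
  proof induction
    case zero
    then show ?case
      by (simp add: zero_mem projection_iff bounded_clinear_zero bounded_clinearD(5)[OF q_bounded])
  next
    case (step e u)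
    note u = isometric_columnD(1)[OF step(2)]
    show ?case
      using step add_mem[OF _ compose_mem[OF columnD(1)[OF u] hadj_mem[OF columnD(1)[OF u]]]]
      by (simp add: add_column_projection bounded_clinearD(3)[OF q_bounded] columnD(4)[OF u])
  qed
  then show "e \<in> R" "projection e" "q (e x) = e x"
    by blast+
qed

text \<open>\<open>q - e\<close> is nonzero, so by primeness some \<open>r\<close> makes
  \<open>(q - e) r p\<close> nonzero. This is a column orthogonal to \<open>e\<close>, and it can be
  normalised.\<close>

lemma frame_sum_extend:
  assumes e: "frame_sum e" and ne: "e \<noteq> q"
  shows "\<exists>u. isometric_column u \<and> (\<forall>x. e (u x) = 0)"
proof -
  note eD = frame_sumD[OF e]
  obtain y where y: "e y \<noteq> q y"
    using ne by blast
  obtain h where h: "p h \<noteq> 0"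
    using p_nonzero by blast
  define a where "a x = q x - e x" for x
  have am: "a \<in> R"
    using diff_mem[OF q_mem eD(1)] by (simp add: a_def[abs_def])
  have eq: "e (q x) = e x" for x
    using q_commute[OF eD(1)] by (simp add: eD)
  have "a (q y) \<noteq> 0"
    using y by (simp add: a_def q_idem eq)
  then obtain r where r: "r \<in> R" "a (r (p h)) \<noteq> 0"
    using prime[OF am p_mem qp h] by blast
  define w where "w x = a (r (p x))" for x
  have w: "column w"
    using compose_mem[OF am compose_mem[OF r(1) p_mem]]
    by (simp add: column_def w_def[abs_def] p_idem)
  obtain c where c: "isometric_column (\<lambda>x. c *\<^sub>C w x)"
    using column_normalize[OF w, of h] r(2) by (auto simp: w_def)
  have "e (w x) = 0" for x
    by (simp add: w_def a_def bounded_clinearD(4)[OF bounded[OF eD(1)]] eq projectionD(2)[OF eD(2)])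
  then have "e (c *\<^sub>C w x) = 0" for x
    by (simp add: bounded_clinearD(2)[OF bounded[OF eD(1)]])
  then show ?thesis
    using c by blast
qed

text \<open>An infinite orthogonal sequence of columns yields the shift
  \<open>1 - \<Sum> u\<^sub>n u\<^sub>n\<^sup>* + \<Sum> u\<^sub>n\<^sub>+\<^sub>1 u\<^sub>n\<^sup>*\<close>, an isometry in the algebra whose range misses that of \<open>u\<^sub>0\<close>.\<close>

lemma frame_sum_complete:
  assumes fin: "finite_algebra R"
  shows "frame_sum q"
proof (rule ccontr)
  assume nq: "\<not> frame_sum q"
  \<comment> \<open>If \<open>q\<close> is never reached, the extension continues forever.
    \<open>E n\<close> is the sum over the first n columns; the clause for \<open>n = 0\<close> pins
    down the start.\<close>
  have "\<exists>E. \<forall>n. (frame_sum (E n) \<and> (n = 0 \<longrightarrow> E n = (\<lambda>_. 0))) \<and> (\<exists>u. isometric_column u \<and> (\<forall>x. E n (u x) = 0) \<and>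
      E (Suc n) = (\<lambda>x. E n x + u (hadj u x)))"
  proof (rule dependent_nat_choice)
    show "\<exists>e. frame_sum e \<and> ((0::nat) = 0 \<longrightarrow> e = (\<lambda>_. 0))"
      using frame_sum.zero by blast
    fix e and n :: nat
    assume "frame_sum e \<and> (n = 0 \<longrightarrow> e = (\<lambda>_. 0))"
    then have e: "frame_sum e"
      by blast
    then obtain u where u: "isometric_column u" "\<And>x. e (u x) = 0"
      using frame_sum_extend nq by metis
    then show "\<exists>e'. (frame_sum e' \<and> (Suc n = 0 \<longrightarrow> e' = (\<lambda>_. 0))) \<and> (\<exists>u. isometric_column u \<and> (\<forall>x. e (u x) = 0) \<and>
        e' = (\<lambda>x. e x + u (hadj u x)))"
      using frame_sum.step[OF e u] by blast
  qed
  then obtain E where fE: "\<And>n. frame_sum (E n)" and E0: "E 0 = (\<lambda>_. 0)"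
    and ex: "\<And>n. \<exists>u. isometric_column u \<and> (\<forall>x. E n (u x) = 0) \<and>
      E (Suc n) = (\<lambda>x. E n x + u (hadj u x))"
    by blast
  from ex obtain u where iu: "\<And>n. isometric_column (u n)" and Eu: "\<And>n x. E n (u n x) = 0"
    and ES: "\<And>n. E (Suc n) = (\<lambda>x. E n x + u n (hadj (u n) x))"
    by metis
  have ES': "E (Suc n) x = E n x + u n (hadj (u n) x)" for n x
    by (simp add: ES)
  note cu = isometric_columnD(1)[OF iu]
  note ub = columnD(2)[OF cu]
  note uhb = bounded_clinear_hadj[OF ub]
  note Em = frame_sumD(1)[OF fE] and Ep = frame_sumD(2)[OF fE]
  note Eb = bounded[OF Em]
  have uE: "hadj (u n) (E n x) = 0" for n x
    by (rule orthogonal_column[OF Ep cu Eu])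
  have Eu1: "E n (u m x) = u m x" if "m < n" for m n x
    using that
  proof (induction n)
    case (Suc n)
    show ?case
    proof (cases "m = n")
      case True
      then show ?thesis
        by (simp add: ES' Eu isometric_columnD(4)[OF iu])
    next
      case False
      then have *: "E n (u m x) = u m x"
        using Suc by simp
      then have "hadj (u n) (u m x) = 0"
        using uE[of n "u m x"] by simp
      then show ?thesis
        by (simp add: ES' * bounded_clinearD(5)[OF ub])
    qed
  qed simp
  have uu1: "hadj (u n) (u m x) = 0" if "m < n" for m n x
    using uE[of n "u m x"] Eu1[OF that] by simp
  have uu2: "cinner (u m x) (u n y) = 0" if "m < n" for m n x y
    using cinner_hadj_left[OF ub, of n "u m x" y] uu1[OF that, of x]
    by (metis cinner_hadj_left cinner_zero_left ub)
  have uu: "cinner (u m x) (u n y) = 0" if "m \<noteq> n" for m n x y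
    using uu2[of m n] uu2[of n m] that by (metis cinner_commute complex_cnj_zero nat_neq_iff)
  have uu0: "hadj (u m) (u n x) = 0" if "m \<noteq> n" for m n x
    by (rule cinner_eqI) (simp add: cinner_hadj_left[OF ub] uu that[symmetric])
  \<comment> \<open>One sequence controls two series: its increment
    \<open>(norm (hadj (u n) x))\<^sup>2\<close> is the squared norm of the n-th term of both the
    sum of projections and the shift.\<close>
  define a where "a x n = (norm (E n x))\<^sup>2" for x n
  have norm_u: "(norm (u m (hadj (u n) x)))\<^sup>2 = (norm (hadj (u n) x))\<^sup>2" for m n x
    by (simp add: isometric_columnD(3)[OF iu] columnD(5)[OF cu] flip: Re_cinner_self)
  have aS: "a x (Suc n) = a x n + (norm (hadj (u n) x))\<^sup>2" for x n
  proof -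
    have "cinner (E n x) (u n (hadj (u n) x)) = 0"
      by (simp add: projectionD(3)[OF Ep] Eu)
    then show ?thesis
      by (simp add: a_def ES' norm_add_sq norm_u)
  qed
  have abound: "a x n \<le> (norm x)\<^sup>2" for x n
    unfolding a_def by (intro power_mono projection_norm_le Ep norm_ge_zero)
  define S where "S n x = (\<Sum>i<n. u (Suc i) (hadj (u i) x))" for n x
  have SS: "S (Suc n) x = S n x + u (Suc n) (hadj (u n) x)" for n x
    by (simp add: S_def)
  have ES_S: "E (Suc n) (S n x) = S n x" for n x
    unfolding S_def bounded_clinearD(7)[OF Eb] by (rule sum.cong) (auto simp: Eu1)
  have orthS: "cinner (S m x) (u (Suc n) y) = 0" if "m \<le> n" for m n x y
    using that unfolding S_def by (simp add: cinner.sum_left uu)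
  have incE: "(norm (E n x - E m x))\<^sup>2 \<le> a x n - a x m" if "m \<le> n" for m n x
    using that
  proof (induction n rule: dec_induct)
    case (step n)
    have "cinner (E n x - E m x) (u n (hadj (u n) x)) = 0"
    proof -
      have "cinner (E m x) (u n y) = 0" for y
      proof -
        have "E n (E m x) = E m x"
          using step(1)
        proof (induction n rule: dec_induct)
          case base
          then show ?case by (simp add: projectionD(2)[OF Ep])
        next
          case (step k)
          have "hadj (u k) (E m x) = hadj (u k) (E k (E m x))"
            using step by simp
          also have "\<dots> = 0"
            by (rule uE)
          finally show ?case
            using step by (simp add: ES' bounded_clinearD(5)[OF ub])
        qed
        then have "cinner (E m x) (u n y) = cinner (E n (E m x)) (u n y)"
          by simp
        also have "\<dots> = 0"
          by (simp add: projectionD(3)[OF Ep] Eu)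
        finally show ?thesis .
      qed
      moreover have "cinner (E n x) (u n y) = 0" for y
        by (simp add: projectionD(3)[OF Ep] Eu)
      ultimately show ?thesis
        by (simp add: cinner_diff_left)
    qed
    then have "(norm ((E n x - E m x) + u n (hadj (u n) x)))\<^sup>2
        = (norm (E n x - E m x))\<^sup>2 + (norm (hadj (u n) x))\<^sup>2"
      by (simp add: norm_add_sq norm_u)
    moreover have "E (Suc n) x - E m x = (E n x - E m x) + u n (hadj (u n) x)"
      by (simp add: ES')
    ultimately have "(norm (E (Suc n) x - E m x))\<^sup>2
        = (norm (E n x - E m x))\<^sup>2 + (norm (hadj (u n) x))\<^sup>2"
      by (simp only:)
    then show ?case
      using step(3) aS[of x n] by linarith
  qed simp
  have incS: "(norm (S n x - S m x))\<^sup>2 \<le> a x n - a x m" if "m \<le> n" for m n x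
    using that
  proof (induction n rule: dec_induct)
    case (step n)
    have "cinner (S n x - S m x) (u (Suc n) (hadj (u n) x)) = 0"
      using orthS step by (simp add: cinner_diff_left)
    then have "(norm ((S n x - S m x) + u (Suc n) (hadj (u n) x)))\<^sup>2
        = (norm (S n x - S m x))\<^sup>2 + (norm (hadj (u n) x))\<^sup>2"
      by (simp add: norm_add_sq norm_u)
    moreover have "S (Suc n) x - S m x = (S n x - S m x) + u (Suc n) (hadj (u n) x)"
      by (simp add: SS)
    ultimately have "(norm (S (Suc n) x - S m x))\<^sup>2
        = (norm (S n x - S m x))\<^sup>2 + (norm (hadj (u n) x))\<^sup>2"
      by (simp only:)
    then show ?case
      using step(3) aS[of x n] by linarith
  qed simp
  \<comment> \<open>The offset is deliberate: columns 0 to n are removed, while only 0 to n - 1 are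
    shifted, into columns 1 to n. The two summands are then orthogonal, and \<open>V n\<close> fails
    to be isometric only by the lost component along column n, which tends to 0.\<close>
  define V where "V n x = (x - E (Suc n) x) + S n x" for n x
  have "\<exists>v. (\<lambda>n. V n x) \<longlonglongrightarrow> v" for x
  proof -
    have "Cauchy (\<lambda>n. E n x)"
      by (rule Cauchy_of_squared_increments[OF incE abound])
    moreover have "Cauchy (\<lambda>n. S n x)"
      by (rule Cauchy_of_squared_increments[OF incS abound])
    ultimately obtain e s where "(\<lambda>n. E n x) \<longlonglongrightarrow> e" "(\<lambda>n. S n x) \<longlonglongrightarrow> s"
      using Cauchy_convergent convergent_def by metis
    then have "(\<lambda>n. V n x) \<longlonglongrightarrow> (x - e) + s"
      unfolding V_def by (intro tendsto_intros LIMSEQ_Suc)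
    then show ?thesis
      by blast
  qed
  then obtain W where W: "\<And>x. (\<lambda>n. V n x) \<longlonglongrightarrow> W x"
    by metis
  have inner_V: "cinner (V n x) (V n y) = cinner x y - cinner (hadj (u n) x) (hadj (u n) y)" for n x y
  proof -
    have cross: "cinner (x - E (Suc n) x) (S n y) = 0" for x y
    proof -
      have "cinner (x - E (Suc n) x) (S n y) = cinner (x - E (Suc n) x) (E (Suc n) (S n y))"
        by (simp add: ES_S)
      also have "\<dots> = 0"
        by (simp add: bounded_clinearD(4)[OF Eb] projectionD(2)[OF Ep]
            flip: projectionD(3)[OF Ep])
      finally show ?thesis .
    qed
    have cross': "cinner (S n y) (x - E (Suc n) x) = 0" for x y
      using cross by (metis cinner_commute complex_cnj_zero)
    have cross'': "cinner (u (Suc n) y) (S n x) = 0" for x y n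
      using orthS[of n n x y] by (metis cinner_commute complex_cnj_zero le_refl)
    have uuS: "cinner (u (Suc n) (hadj (u n) x)) (u (Suc n) (hadj (u n) y))
        = cinner (u n (hadj (u n) x)) y" for n
      by (simp add: isometric_columnD(2)[OF iu] columnD(5)[OF cu] cinner_hadj_right[OF ub])
    have SSn: "cinner (S n x) (S n y) = cinner (E n x) y" for n
    proof (induction n)
      case 0
      then show ?case
        by (simp add: S_def E0)
    next
      case (Suc n)
      then show ?case
        by (simp add: SS ES' cinner_add_left cinner_add_right orthS cross'' uuS)
    qed
    have "cinner (x - E (Suc n) x) (y - E (Suc n) y) = cinner (x - E (Suc n) x) y"
    proof -
      have "cinner (x - E (Suc n) x) (E (Suc n) y) = 0"
        by (simp add: bounded_clinearD(4)[OF Eb] projectionD(2)[OF Ep]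
            flip: projectionD(3)[OF Ep])
      then show ?thesis
        by (simp add: cinner_diff_right)
    qed
    moreover have "cinner (V n x) (V n y)
        = cinner (x - E (Suc n) x) (y - E (Suc n) y) + cinner (E n x) y"
      by (simp add: V_def cinner_add_left cinner_add_right cross cross' SSn)
    ultimately have "cinner (V n x) (V n y) = cinner (x - E (Suc n) x) y + cinner (E n x) y"
      by (simp only:)
    then show ?thesis
      by (simp add: ES' cinner_add_left cinner_diff_left cinner_hadj_right[OF ub])
  qed
  have u_lim: "(\<lambda>n. hadj (u n) x) \<longlonglongrightarrow> 0" for x
  proof -
    have "Cauchy (\<lambda>n. E n x)"
      by (rule Cauchy_of_squared_increments[OF incE abound])
    then obtain e where e: "(\<lambda>n. E n x) \<longlonglongrightarrow> e"
      using Cauchy_convergent convergent_def by metis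
    have "(\<lambda>n. E (Suc n) x - E n x) \<longlonglongrightarrow> e - e"
      by (rule tendsto_diff[OF LIMSEQ_Suc[OF e] e])
    then have "(\<lambda>n. norm (u n (hadj (u n) x))) \<longlonglongrightarrow> 0"
      by (simp add: ES' tendsto_norm_zero)
    moreover have "norm (u n (hadj (u n) x)) = norm (hadj (u n) x)" for n
      by (rule power2_eq_imp_eq[OF norm_u]) simp_all
    ultimately show ?thesis
      by (simp add: tendsto_norm_zero_iff)
  qed
  have WW: "cinner (W x) (W y) = cinner x y" for x y
  proof (rule LIMSEQ_unique)
    show "(\<lambda>n. cinner (V n x) (V n y)) \<longlonglongrightarrow> cinner (W x) (W y)"
      by (rule cinner.tendsto[OF W W])
    have "(\<lambda>n. cinner x y - cinner (hadj (u n) x) (hadj (u n) y))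
        \<longlonglongrightarrow> cinner x y - cinner 0 (0::'a)"
      by (rule tendsto_diff[OF tendsto_const cinner.tendsto[OF u_lim u_lim]])
    then show "(\<lambda>n. cinner (V n x) (V n y)) \<longlonglongrightarrow> cinner x y"
      by (simp add: inner_V)
  qed
  have Wm: "W \<in> R"
  proof (rule limit_mem[OF _ W])
    have "S n \<in> R" for n
      unfolding S_def[abs_def]
      by (rule sum_mem) (rule compose_mem[OF columnD(1)[OF cu] hadj_mem[OF columnD(1)[OF cu]]])
    then show "V n \<in> R" for n
      unfolding V_def[abs_def] using add_mem[OF diff_mem[OF ident_mem Em]] by blast
    show "norm (W x) \<le> norm x * 1" for x
      using WW[of x x] by (simp add: cinner_self flip: of_real_power)
  qed
  note Wb = bounded[OF Wm]
  have hW: "hadj W (W x) = x" for x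
    by (rule cinner_eqI) (simp add: cinner_hadj_left[OF Wb] WW)
  define Q where "Q = (\<lambda>x. W (hadj W x))"
  have "projection Q"
    using bounded_clinear_compose[OF Wb bounded_clinear_hadj[OF Wb]]
    by (simp add: projection_iff Q_def hW cinner_hadj_right[OF Wb] cinner_hadj_left[OF Wb])
  then have "Q \<in> projections R"
    using compose_mem[OF Wm hadj_mem[OF Wm]] by (simp add: projections_def Q_def)
  \<comment> \<open>The partial isometry is \<open>hadj W\<close>: its initial projection is
    \<open>Q\<close> and its final one the identity. Finiteness then makes \<open>W\<close>
    surjective.\<close>
  moreover have "mvn_equiv R Q id"
    unfolding mvn_equiv_def
    by (rule bexI[OF _ hadj_mem[OF Wm]]) (auto simp: hadj_hadj[OF Wb] Q_def hW fun_eq_iff)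
  moreover have "proj_le Q id"
    by (simp add: proj_le_def)
  ultimately have "Q = id"
    using fin unfolding finite_algebra_def finite_projection_def by blast
  then have WQ: "W (hadj W x) = x" for x
    by (metis Q_def id_apply)
  have "hadj (u 0) (W x) = 0" for x
  proof (rule LIMSEQ_unique)
    show "(\<lambda>n. hadj (u 0) (V n x)) \<longlonglongrightarrow> hadj (u 0) (W x)"
      by (rule bounded_linear.tendsto[OF bounded_clinearD(1)[OF uhb] W])
    have "hadj (u 0) (E (Suc n) x) = hadj (u 0) x" for n
      by (rule cinner_eqI) (simp add: cinner_hadj_left[OF ub] projectionD(3)[OF Ep] Eu1)
    moreover have "hadj (u 0) (S n x) = 0" for n
      by (simp add: S_def bounded_clinearD(7)[OF uhb] uu0)
    ultimately show "(\<lambda>n. hadj (u 0) (V n x)) \<longlonglongrightarrow> 0"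
      by (simp add: V_def bounded_clinearD(3,4)[OF uhb])
  qed
  then have "hadj (u 0) x = 0" for x
    by (metis WQ)
  then have "p x = 0" for x
    by (metis iu isometric_columnD(2))
  then show False
    using p_nonzero by blast
qed

end

section \<open>Affiliated operators and derivations below a central atom\<close>

lemma closed_densely_definedD:
  assumes "closed_densely_defined x"
  shows "closed x" "(0, 0) \<in> x" "(\<xi>, \<eta>) \<in> x \<Longrightarrow> (\<xi>', \<eta>') \<in> x \<Longrightarrow> (\<xi> + \<xi>', \<eta> + \<eta>') \<in> x"
    "(\<xi>, \<eta>) \<in> x \<Longrightarrow> (c *\<^sub>C \<xi>, c *\<^sub>C \<eta>) \<in> x"
    "(\<xi>, \<eta>) \<in> x \<Longrightarrow> (\<xi>, \<zeta>) \<in> x \<Longrightarrow> \<eta> = \<zeta>"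
    "closure (Domain x) = UNIV"
  using assms by (auto simp: closed_densely_defined_def linear_operator_def single_valued_def)

lemma orthogonal_closure_UNIV:
  fixes \<xi> :: "'h::chilbert_space"
  assumes "closure S = UNIV" and "\<And>y. y \<in> S \<Longrightarrow> cinner \<xi> y = 0"
  shows "\<xi> = 0"
proof -
  have "closed {y. cinner \<xi> y = 0}"
    by (intro closed_Collect_eq continuous_intros
        bounded_linear.continuous_on[OF cinner.bounded_linear_right] continuous_on_id)
  then have "closure S \<subseteq> {y. cinner \<xi> y = 0}"
    using assms(2) by (intro closure_minimal) auto
  then have "cinner \<xi> \<xi> = 0"
    using assms(1) by auto
  then show ?thesis
    by (simp add: cinner_eq_zero_iff)
qed

context central_atom_abelian
begin

text \<open>Gram-Schmidt: the new column \<open>B u\<close> is made orthogonal to the projection \<open>f\<close> found so far,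
  and either vanishes or can be normalised.\<close>

lemma frame_sum_image_projection:
  assumes "frame_sum e" and B: "B \<in> R"
  shows "\<exists>f b. f \<in> R \<and> projection f \<and> b \<in> R \<and> (\<forall>x. f x = B (b x)) \<and> (\<forall>x. f (B (e x)) = B (e x))"
  using assms(1)
proof induction
  case zero
  show ?case
    by (rule exI[of _ "\<lambda>_. 0"], rule exI[of _ "\<lambda>_. 0"])
      (simp add: zero_mem projection_iff bounded_clinear_zero bounded_clinearD(5)[OF bounded[OF B]])
next
  case (step e u)
  then obtain f b where f: "f \<in> R" "projection f" and b: "b \<in> R"
    and fb: "\<And>x. f x = B (b x)" and fBe: "\<And>x. f (B (e x)) = B (e x)"
    by blast
  note Bb = bounded[OF B] and fbd = bounded[OF f(1)]
  note cu = isometric_columnD(1)[OF step(2)]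
  define w where "w x = B (u x) - f (B (u x))" for x
  have w: "column w"
    unfolding w_def[abs_def]
    by (rule column_diff[OF column_compose[OF B cu] column_compose[OF f(1) column_compose[OF B cu]]])
  show ?case
  proof (cases "\<forall>x. w x = 0")
    case True
    then have "f (B (u x)) = B (u x)" for x
      by (simp add: w_def)
    then have "\<forall>x. f (B (e x + u (hadj u x))) = B (e x + u (hadj u x))"
      by (simp add: bounded_clinearD(3)[OF Bb] bounded_clinearD(3)[OF fbd] fBe)
    then show ?thesis
      using f b fb by blast
  next
    case False
    then obtain c where c: "c \<noteq> 0" and g: "isometric_column (\<lambda>x. c *\<^sub>C w x)"
      using column_normalize[OF w] by blast
    define g where "g x = c *\<^sub>C w x" for x
    have ig: "isometric_column g"
      using g by (simp add: g_def[abs_def])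
    note cg = isometric_columnD(1)[OF ig]
    have fw: "f (w x) = 0" for x
      by (simp add: w_def bounded_clinearD[OF fbd] projectionD(2)[OF f(2)])
    have fg: "f (g x) = 0" for x
      by (simp add: g_def bounded_clinearD[OF fbd] fw)
    have gf: "hadj g (f x) = 0" for x
      by (rule orthogonal_column[OF f(2) cg fg])
    have hg: "hadj g \<in> R"
      by (rule hadj_mem[OF columnD(1)[OF cg]])
    note hgb = bounded[OF hg] and gb = columnD(2)[OF cg]
    have ggw: "g (hadj g (w x)) = w x" for x
    proof -
      have "w x = (1 / c) *\<^sub>C g x"
        using c by (simp add: g_def scaleC_scaleC scaleC_one)
      then show ?thesis
        by (simp add: bounded_clinearD(2)[OF hgb] bounded_clinearD(2)[OF gb]
            isometric_columnD(4)[OF ig])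
    qed
    define f' where "f' x = f x + g (hadj g x)" for x
    \<comment> \<open>Since \<open>f\<close> is \<open>B \<circ> b\<close>, the column
      \<open>w\<close> is \<open>B\<close> applied to \<open>u - b B u\<close>; so the new term
      \<open>g \<circ> hadj g\<close> again factors through \<open>B\<close>.\<close>
    define b' where "b' x = b x + c *\<^sub>C (u (hadj g x) - b (B (u (hadj g x))))" for x
    have f'B: "f' x = B (b' x)" for x
      by (simp add: f'_def b'_def fb g_def w_def bounded_clinearD[OF Bb])
    have "f' (B (e x)) = B (e x)" for x
    proof -
      have "hadj g (B (e x)) = 0"
        using gf[of "B (e x)"] by (simp add: fBe)
      then show ?thesis
        by (simp add: f'_def fBe bounded_clinearD(5)[OF gb])
    qed
    moreover have "f' (B (u x)) = B (u x)" for x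
    proof -
      have Bu: "B (u x) = w x + f (B (u x))"
        by (simp add: w_def)
      have "hadj g (B (u x)) = hadj g (w x)"
        by (subst Bu) (simp add: bounded_clinearD(3)[OF hgb] gf)
      then show ?thesis
        by (simp add: f'_def ggw) (simp add: w_def)
    qed
    moreover have "bounded_clinear f'"
      unfolding f'_def[abs_def]
      by (rule bounded_clinear_add[OF fbd bounded_clinear_compose[OF gb hgb]])
    ultimately have "\<forall>x. f' (B (e x + u (hadj u x))) = B (e x + u (hadj u x))"
      by (simp add: bounded_clinearD[OF Bb] bounded_clinearD(3))
    moreover have "f' \<in> R"
      unfolding f'_def[abs_def] by (rule add_mem[OF f(1) compose_mem[OF columnD(1)[OF cg] hg]])
    moreover have "projection f'"
      unfolding f'_def[abs_def] by (rule add_column_projection[OF f(2) ig fg])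
    moreover have "b' \<in> R"
    proof -
      have ug: "(\<lambda>x. u (hadj g x)) \<in> R"
        by (rule compose_mem[OF columnD(1)[OF cu] hg])
      show ?thesis
        unfolding b'_def[abs_def]
        by (rule add_mem[OF b scaleC_mem[OF diff_mem[OF ug compose_mem[OF b compose_mem[OF B ug]]]]])
    qed
    ultimately show ?thesis
      using f'B by blast
  qed
qed

text \<open>With \<open>Q\<close> the orthogonal projection onto the part of the graph of \<open>x\<close> below \<open>q\<close>, the two
  components \<open>B\<close> and \<open>C\<close> of \<open>Q (\<xi>, 0)\<close> lie in the algebra and \<open>x B = C\<close>; \<open>B\<close> is invertible below
  \<open>q\<close> because it is injective there and \<open>q\<close> is a finite frame sum.\<close>

lemma affiliated_block:
  assumes fin: "finite_algebra R" and x: "closed_densely_defined x" and aff: "affiliated R x"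
  shows "\<exists>t\<in>R. \<forall>\<xi>. (q \<xi>, t \<xi>) \<in> x \<and> q (t \<xi>) = t \<xi> \<and> t (q \<xi>) = t \<xi>"
proof -
  note xD = closed_densely_definedD[OF x]
  have affD: "(b \<xi>, b \<eta>) \<in> x" if "b \<in> commutant R" "(\<xi>, \<eta>) \<in> x" for b \<xi> \<eta>
    using aff that by (simp add: affiliated_def)
  define K where "K = x \<inter> {z. q (fst z) = fst z} \<inter> {z. q (snd z) = snd z}"
  have cq: "continuous_on UNIV q"
    using bounded_linear.continuous_on[OF bounded_clinearD(1)[OF q_bounded] continuous_on_id] .
  have "continuous_on UNIV (\<lambda>z. q (fst z))" "continuous_on UNIV (\<lambda>z. q (snd z))"
    by (intro continuous_on_compose2[OF cq] continuous_intros; simp)+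
  then have "closed K"
    unfolding K_def using xD(1) by (intro closed_Int closed_Collect_eq continuous_intros)
  then have K: "closed_csubspace K"
    unfolding closed_csubspace_def K_def
    by (auto simp: zero_prod_def xD bounded_clinearD[OF q_bounded] scaleC_prod_def intro: xD)
  define Q where "Q = orth_proj K"
  have QK: "Q z \<in> K" for z
    unfolding Q_def by (rule orth_proj_mem[OF K])
  have Qb: "bounded_clinear Q"
    unfolding Q_def by (rule bounded_clinear_orth_proj[OF K])
  \<comment> \<open>In terms of the block of \<open>x\<close> below \<open>q\<close>, these are the
    familiar bounded operators: \<open>B\<close> is the inverse of 1 + |x|^2, and \<open>C\<close>
    is \<open>x\<close> times that inverse.\<close>
  define B where "B \<xi> = fst (Q (q \<xi>, 0))" for \<xi>
  define C where "C \<xi> = snd (Q (q \<xi>, 0))" for \<xi>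
  have BC: "Q (q \<xi>, 0) = (B \<xi>, C \<xi>)" for \<xi>
    by (simp add: B_def C_def)
  have BCx: "(B \<xi>, C \<xi>) \<in> x" and qB: "q (B \<xi>) = B \<xi>" and qC: "q (C \<xi>) = C \<xi>" for \<xi>
    using QK[of "(q \<xi>, 0)"] by (auto simp: K_def BC)
  have addB: "(B (\<xi> + \<eta>), C (\<xi> + \<eta>)) = (B \<xi> + B \<eta>, C \<xi> + C \<eta>)" for \<xi> \<eta>
    using bounded_clinearD(3)[OF Qb, of "(q \<xi>, 0)" "(q \<eta>, 0)"] BC[of \<xi>] BC[of \<eta>] BC[of "\<xi> + \<eta>"]
    by (simp add: bounded_clinearD(3)[OF q_bounded])
  have scaleB: "(B (c *\<^sub>C \<xi>), C (c *\<^sub>C \<xi>)) = (c *\<^sub>C B \<xi>, c *\<^sub>C C \<xi>)" for c \<xi>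
    using bounded_clinearD(2)[OF Qb, of c "(q \<xi>, 0)"] BC[of \<xi>] BC[of "c *\<^sub>C \<xi>"]
    by (simp add: scaleC_prod_def bounded_clinearD(2)[OF q_bounded])
  have nQ: "norm (Q (q \<xi>, 0)) \<le> norm \<xi>" for \<xi>
    using norm_orth_proj_le[OF K, of "(q \<xi>, 0)"] projection_norm_le[OF q_proj, of \<xi>]
    by (simp add: Q_def norm_Pair)
  have normB: "norm (B \<xi>) \<le> norm \<xi> * 1" and normC: "norm (C \<xi>) \<le> norm \<xi> * 1" for \<xi>
    using nQ[of \<xi>] norm_fst_le[of "B \<xi>" "C \<xi>"] norm_snd_le[of "C \<xi>" "B \<xi>"] by (simp_all add: BC)
  \<comment> \<open>Affiliation says that \<open>b\<close> acting on both components preserves the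
    graph, and the same holds for \<open>hadj b\<close>; hence the pair action commutes with
    \<open>Q\<close>, and both components land in the bicommutant.\<close>
  have commBC: "(B (b \<xi>), C (b \<xi>)) = (b (B \<xi>), b (C \<xi>))" if b: "b \<in> commutant R" for b \<xi>
  proof -
    note bb = bounded_commutant[OF b]
    note bh = hadj_commutant[OF b]
    have inv: "map_prod c c ` K \<subseteq> K" if c: "c \<in> commutant R" for c
      using affD[OF c] by (auto simp: K_def) (simp_all flip: q_commute'[OF c])
    obtain k where k: "\<And>x. norm (b x) \<le> norm x * k" "k > 0"
      using bounded_linear.pos_bounded[OF bounded_clinearD(1)[OF bb]] by blast
    have "orth_proj K (map_prod b b (q \<xi>, 0)) = map_prod b b (orth_proj K (q \<xi>, 0))"
    proof (rule orth_proj_commute[OF K, where c = "map_prod (hadj b) (hadj b)"])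
      show "bounded_clinear (map_prod b b)"
      proof (rule bounded_clinearI[of _ "2 * k"])
        fix z :: "'a \<times> 'a"
        have "norm (map_prod b b z) \<le> norm (b (fst z)) + norm (b (snd z))"
          by (cases z) (simp add: norm_Pair_le)
        also have "\<dots> \<le> norm (fst z) * k + norm (snd z) * k"
          by (intro add_mono k)
        also have "\<dots> \<le> norm z * k + norm z * k"
          using k(2) norm_fst_le[of "fst z" "snd z"] norm_snd_le[of "snd z" "fst z"]
          by (intro add_mono mult_right_mono) auto
        finally show "norm (map_prod b b z) \<le> norm z * (2 * k)"
          by (simp add: mult.commute mult.left_commute)
      qed (auto simp: bounded_clinearD[OF bb] scaleC_prod_def)
      show "cinner (map_prod b b z) w = cinner z (map_prod (hadj b) (hadj b) w)" for z w
        by (cases z, cases w) (simp add: cinner_prod_def cinner_hadj_right[OF bb])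
    qed (use inv b bh in blast)+
    then show ?thesis
      by (simp add: BC bounded_clinearD(5)[OF bb] q_commute'[OF b] flip: Q_def)
  qed
  have B: "B \<in> R"
    by (rule memI[OF bounded_clinearI[OF _ _ normB]]) (use addB scaleB commBC in auto)
  have C: "C \<in> R"
    by (rule memI[OF bounded_clinearI[OF _ _ normC]]) (use addB scaleB commBC in auto)
  note Bb = bounded[OF B]
  have Bsa: "cinner (B \<xi>) \<eta> = cinner \<xi> (B \<eta>)" for \<xi> \<eta>
  proof -
    have "cinner (B \<xi>) \<eta> = cinner (Q (q \<xi>, 0)) (q \<eta>, 0)"
      by (simp add: BC cinner_prod_def qB flip: projectionD(3)[OF q_proj])
    also have "\<dots> = cinner (q \<xi>, 0) (Q (q \<eta>, 0))"
      unfolding Q_def by (rule orth_proj_selfadjoint[OF K])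
    also have "\<dots> = cinner \<xi> (B \<eta>)"
      by (simp add: BC cinner_prod_def qB projectionD(3)[OF q_proj])
    finally show ?thesis .
  qed
  \<comment> \<open>If \<open>B \<xi>\<close> is 0, so is its image \<open>C \<xi>\<close>. Then
    \<open>(\<xi>, 0)\<close> is orthogonal to the graph below \<open>q\<close>, and \<xi> is
    orthogonal to the dense domain.\<close>
  have inj: "\<xi> = 0" if "q \<xi> = \<xi>" "B \<xi> = 0" for \<xi>
  proof (rule orthogonal_closure_UNIV[OF xD(6)])
    fix y
    assume "y \<in> Domain x"
    then obtain z where "(y, z) \<in> x"
      by blast
    then have yz: "(q y, q z) \<in> K"
      using affD[OF q_commutant] by (simp add: K_def q_idem)
    have "C \<xi> = 0"
      using BCx[of \<xi>] that(2) xD(2) xD(5) by metis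
    then have "Q (\<xi>, 0) = 0"
      using BC[of \<xi>] that by (simp add: zero_prod_def)
    then have "cinner (\<xi>, 0::'a) (q y, q z) = 0"
      using orth_proj_orth[OF K yz, of "(\<xi>, 0)"] by (simp add: Q_def)
    then show "cinner \<xi> y = 0"
      using that(1) by (simp add: cinner_prod_def) (metis projectionD(3)[OF q_proj])
  qed
  obtain f b where f: "f \<in> R" "projection f" and b: "b \<in> R"
    and fb: "\<And>x. f x = B (b x)" and fBq: "\<And>x. f (B (q x)) = B (q x)"
    using frame_sum_image_projection[OF frame_sum_complete[OF fin] B] by blast
  have fB: "f (B \<xi>) = B \<xi>" for \<xi>
    using fBq[of \<xi>] by (simp add: q_commute[OF B] qB)
  have Bf: "B (f \<xi>) = B \<xi>" for \<xi>
    by (rule cinner_eqI) (simp add: Bsa projectionD(3)[OF f(2)] fB)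
  \<comment> \<open>\<open>f\<close> projects onto the range of \<open>B\<close>. Taking adjoints in
    \<open>f B = B\<close> gives \<open>B f = B\<close>, so \<open>B\<close> kills
    \<open>q - f\<close> and injectivity yields \<open>f = q\<close>. Hence \<open>b\<close> is a
    right inverse of \<open>B\<close> below \<open>q\<close>, and \<open>x\<close> is defined on the
    whole range of \<open>q\<close>.\<close>
  have "q \<xi> = B (b \<xi>)" for \<xi>
  proof -
    have "q (q \<xi> - f \<xi>) = q \<xi> - f \<xi>"
      by (simp add: bounded_clinearD(4)[OF q_bounded] q_idem fb qB)
    moreover have "B (q \<xi> - f \<xi>) = 0"
      by (simp add: bounded_clinearD(4)[OF Bb] Bf q_commute[OF B] qB)
    ultimately have "q \<xi> - f \<xi> = 0"
      by (rule inj)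
    then show ?thesis
      by (simp add: fb)
  qed
  then have qx: "(q \<xi>, C (b \<xi>)) \<in> x" for \<xi>
    using BCx by metis
  define t where "t \<xi> = C (b (q \<xi>))" for \<xi>
  have "t \<in> R"
    unfolding t_def[abs_def] by (rule compose_mem[OF C compose_mem[OF b q_mem]])
  moreover have "(q \<xi>, t \<xi>) \<in> x" for \<xi>
    using qx[of "q \<xi>"] by (simp add: t_def q_idem)
  ultimately show ?thesis
    by (intro bexI[of _ t]) (auto simp: t_def qC q_idem)
qed

text \<open>The induction along a frame sum accumulates \<open>m\<close> so that
  \<open>\<delta> u\<close> restricted to the range of \<open>p\<close> is \<open>m u\<close> for
  every column \<open>u\<close>. The Leibniz rule for \<open>a u\<close> then says that
  \<open>\<delta> a\<close> and the commutator with \<open>m\<close> agree on all columns, and these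
  span the range of \<open>q\<close>.\<close>

lemma block_derivation_inner:
  assumes fin: "finite_algebra R"
    and mem: "\<And>a. a \<in> R \<Longrightarrow> \<delta> a \<in> R"
    and add: "\<And>a b x. a \<in> R \<Longrightarrow> b \<in> R \<Longrightarrow> \<delta> (\<lambda>x. a x + b x) x = \<delta> a x + \<delta> b x"
    and scale: "\<And>c a x. a \<in> R \<Longrightarrow> \<delta> (\<lambda>x. c *\<^sub>C a x) x = c *\<^sub>C \<delta> a x"
    and Leibniz: "\<And>a b x. a \<in> R \<Longrightarrow> b \<in> R \<Longrightarrow> \<delta> (\<lambda>x. a (b x)) x = \<delta> a (b x) + a (\<delta> b x)"
    and q\<delta>: "\<And>a x. a \<in> R \<Longrightarrow> q (\<delta> a x) = \<delta> a x" and \<delta>q: "\<And>a x. a \<in> R \<Longrightarrow> \<delta> a (q x) = \<delta> a x"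
  shows "\<exists>m\<in>R. (\<forall>x. q (m x) = m x \<and> m (q x) = m x) \<and> (\<forall>a\<in>R. \<forall>x. \<delta> a x = m (a x) - a (m x))"
proof -
  have "\<exists>m\<in>R. (\<forall>x. q (m x) = m x) \<and> (\<forall>u. column u \<longrightarrow> (\<forall>x. \<delta> (\<lambda>x. e (u x)) (p x) = m (u x)))"
    if "frame_sum e" for e
    using that
  proof induction
    case zero
    have "\<delta> (\<lambda>x. 0) x = 0" for x
      using scale[OF zero_mem, of 0 x] by simp
    then show ?case
      using zero_mem by (intro bexI[of _ "\<lambda>_. 0"]) (simp_all add: bounded_clinearD(5)[OF q_bounded])
  next
    case (step e v)
    then obtain m where m: "m \<in> R" "\<And>x. q (m x) = m x"
      and meq: "\<And>u x. column u \<Longrightarrow> \<delta> (\<lambda>x. e (u x)) (p x) = m (u x)"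
      by blast
    note cv = isometric_columnD(1)[OF step(2)]
    note v = columnD(1)[OF cv]
    define m' where "m' x = m x + \<delta> v (hadj v x)" for x
    have "m' \<in> R"
      unfolding m'_def[abs_def] by (rule add_mem[OF m(1) compose_mem[OF mem[OF v] hadj_mem[OF v]]])
    moreover have "\<forall>x. q (m' x) = m' x"
      by (simp add: m'_def bounded_clinearD(3)[OF q_bounded] m q\<delta>[OF v])
    moreover have "\<delta> (\<lambda>x. e (u x) + v (hadj v (u x))) (p x) = m' (u x)" if u: "column u" for u x
    proof -
      \<comment> \<open>The decisive use of scalar corners: the component of \<open>u\<close> along
        \<open>v\<close> is a complex multiple of \<open>v\<close>, and \<delta> is complex
        linear.\<close>
      obtain c where c: "\<And>x. hadj v (u x) = c *\<^sub>C p x"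
        using column_scalar[OF cv u] by blast
      have vv: "v (hadj v (u x)) = c *\<^sub>C v x" for x
        by (simp add: c bounded_clinearD(2)[OF bounded[OF v]] columnD(3)[OF cv])
      have "\<delta> (\<lambda>x. e (u x) + v (hadj v (u x))) (p x)
          = \<delta> (\<lambda>x. e (u x)) (p x) + \<delta> (\<lambda>x. c *\<^sub>C v x) (p x)"
        unfolding vv
        by (rule add[OF compose_mem[OF frame_sumD(1)[OF step(1)] columnD(1)[OF u]] scaleC_mem[OF v]])
      also have "\<dots> = m (u x) + \<delta> v (hadj v (u x))"
        by (simp add: meq[OF u] scale[OF v] c bounded_clinearD(2)[OF bounded[OF mem[OF v]]])
      finally show ?thesis
        by (simp add: m'_def)
    qed
    ultimately show ?case
      by blast
  qed
  from this[OF frame_sum_complete[OF fin]] obtain m where m: "m \<in> R" "\<And>x. q (m x) = m x"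
    and meq: "\<And>u x. column u \<Longrightarrow> \<delta> (\<lambda>x. q (u x)) (p x) = m (u x)"
    by blast
  \<comment> \<open>The argument is \<open>p x\<close> because \<open>\<delta> u\<close> need not be
    a column: \<open>u = u p\<close> gives an extra term
    \<open>u \<circ> \<delta> p\<close>.\<close>
  have meq: "\<delta> u (p x) = m (u x)" if u: "column u" for u x
    using meq[OF u, of x] by (simp add: columnD(4)[OF u])
  have col: "\<delta> a (u x) = m (a (u x)) - a (m (u x))" if a: "a \<in> R" and u: "column u" for a u x
  proof -
    have "m (a (u x)) = \<delta> (\<lambda>x. a (u x)) (p x)"
      using meq[OF column_compose[OF a u], of x] by simp
    also have "\<dots> = \<delta> a (u x) + a (m (u x))"
      by (simp add: Leibniz[OF a columnD(1)[OF u]] columnD(3)[OF u] meq[OF u])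
    finally show ?thesis
      by simp
  qed
  have "\<delta> a (e x) = m (a (e x)) - a (m (e x))" if a: "a \<in> R" and "frame_sum e" for a e x
    using that(2)
  proof (induction arbitrary: x)
    case zero
    then show ?case
      by (simp add: bounded_clinearD(5)[OF bounded[OF a]] bounded_clinearD(5)[OF bounded[OF m(1)]]
          bounded_clinearD(5)[OF bounded[OF mem[OF a]]])
  next
    case (step e u)
    then show ?case
      using col[OF a isometric_columnD(1)[OF step(2)]]
      by (simp add: bounded_clinearD(3)[OF bounded[OF a]] bounded_clinearD(3)[OF bounded[OF m(1)]]
          bounded_clinearD(3)[OF bounded[OF mem[OF a]]])
  qed
  from this[OF _ frame_sum_complete[OF fin]]
  have "\<delta> a x = m (q (a x)) - a (m (q x))" if "a \<in> R" for a x
    using that by (metis \<delta>q q_commute)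
  then show ?thesis
    using compose_mem[OF m(1) q_mem] by (intro bexI[of _ "\<lambda>x. m (q x)"]) (auto simp: m q_idem)
qed

end

section \<open>Sums of central atoms\<close>

lemma projection_id: "projection (\<lambda>x. x)"
  by (simp add: projection_iff bounded_clinear_ident)

lemma norm_projection_complement_le:
  assumes "projection e"
  shows "norm (x - e x) \<le> norm x"
proof -
  have "cinner x (e x) = cinner (e x) (e x)"
    using projectionD[OF assms] by metis
  then have "(norm (x - e x))\<^sup>2 = (norm x)\<^sup>2 - (norm (e x))\<^sup>2"
    by (simp add: norm_diff_sq Re_cinner_self)
  then have "(norm (x - e x))\<^sup>2 \<le> (norm x)\<^sup>2"
    by simp
  then show ?thesis
    by (rule power2_le_imp_le) simp
qed

text \<open>The domain is the whole space, so the constant sequence of identities is a witness; its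
  complement 0 is finite.\<close>

lemma (in vna) op_of_measurable:
  assumes T: "T \<in> R"
  shows "op_of T \<in> measurable_ops R"
proof -
  note Tb = bounded[OF T]
  have cT: "continuous_on UNIV T"
    using bounded_linear.continuous_on[OF bounded_clinearD(1)[OF Tb] continuous_on_id] .
  have eq: "op_of T = {z. snd z = T (fst z)}"
    by (auto simp: op_of_def)
  have "closed (op_of T)"
    unfolding eq
    by (intro closed_Collect_eq continuous_intros continuous_on_compose2[OF cT]) simp_all
  moreover have "Domain (op_of T) = UNIV"
    by (auto simp: op_of_def)
  moreover have "linear_operator (op_of T)"
    by (auto simp: linear_operator_def op_of_def single_valued_def bounded_clinearD[OF Tb])
  ultimately have "closed_densely_defined (op_of T)"
    by (simp add: closed_densely_defined_def)
  moreover have "affiliated R (op_of T)"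
    using commute[OF T] by (auto simp: affiliated_def op_of_def)
  moreover have "increases_to_one (\<lambda>k x. x)"
  proof -
    have top: "q = id" if "projection q" "\<forall>k::nat. proj_le (\<lambda>x. x) q" for q :: "'a \<Rightarrow> 'a"
      using proj_le_iff[OF that(1)] that(2) by (simp add: fun_eq_iff)
    show ?thesis
      unfolding increases_to_one_def
    proof (intro conjI allI impI)
      show "projection (\<lambda>x::'a. x)"
        by (rule projection_id)
      show "proj_le (\<lambda>x::'a. x) (\<lambda>x. x)"
        by (simp add: proj_le_def)
    qed (rule top)
  qed
  moreover have "finite_projection R (\<lambda>\<xi>. \<xi> - \<xi>)"
    unfolding finite_projection_def
    using zero_mem by (auto simp: projections_def projection_iff bounded_clinear_zero proj_le_def
        image_subset_iff)
  moreover have "(\<lambda>x. x) \<in> projections R"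
    using projection_id ident_mem by (simp add: projections_def)
  ultimately show ?thesis
    unfolding measurable_ops_def
    using \<open>Domain (op_of T) = UNIV\<close> by (auto intro!: exI[of _ "\<lambda>k x. x"])
qed

locale atomic_vna = vna +
  assumes atomic: "atomic (projections (center R)) proj_le (\<lambda>_. 0)"
begin

definition atoms where
  "atoms = {q. is_atom (projections (center R)) proj_le (\<lambda>_. 0) q}"

lemma atom_locale: "q \<in> atoms \<Longrightarrow> central_atom R q"
  by unfold_locales (simp add: atoms_def)

lemma atomD:
  assumes "q \<in> atoms"
  shows "q \<in> R" "q \<in> commutant R" "projection q" "bounded_clinear q"
    "a \<in> R \<Longrightarrow> a (q x) = q (a x)" "b \<in> commutant R \<Longrightarrow> b (q x) = q (b x)" "q (q x) = q x"
proof -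
  interpret central_atom R q
    by (rule atom_locale[OF assms])
  show "q \<in> R" "q \<in> commutant R" "projection q" "bounded_clinear q"
    "a \<in> R \<Longrightarrow> a (q x) = q (a x)" "b \<in> commutant R \<Longrightarrow> b (q x) = q (b x)" "q (q x) = q x"
    by (fact q_mem q_commutant q_proj q_bounded q_commute q_commute' q_idem)+
qed

text \<open>The product of two central projections is a central projection below both; if nonzero,
  it equals each atom.\<close>

lemma atoms_orthogonal:
  assumes q: "q \<in> atoms" and r: "r \<in> atoms" and "q \<noteq> r"
  shows "q (r x) = 0"
proof (rule ccontr)
  assume nz: "q (r x) \<noteq> 0"
  define e where "e x = q (r x)" for x
  have e': "e x = r (q x)" for x
    using atomD(5)[OF r atomD(1)[OF q]] by (simp add: e_def)
  have "e \<in> R"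
    using compose_mem[OF atomD(1)[OF q] atomD(1)[OF r]] by (simp add: e_def[abs_def])
  moreover have "projection e"
    using bounded[OF \<open>e \<in> R\<close>]
    by (simp add: projection_iff) (metis e' e_def atomD(3,7) q r projectionD(3))
  ultimately have "e \<in> projections (center R)"
    by (simp add: projections_def center_def commutant_iff bounded e_def atomD(5)[OF q]
        atomD(5)[OF r])
  moreover have "q (e x) = e x" "r (e x) = e x" for x
    by (simp add: e_def atomD(7)[OF q]) (simp add: e' atomD(7)[OF r])
  moreover have "e x \<noteq> 0"
    using nz by (simp add: e_def)
  ultimately have "e = q" "e = r"
    using central_atom.below_atom[OF atom_locale[OF q]] central_atom.below_atom[OF atom_locale[OF r]]
    by blast+
  then show False
    using \<open>q \<noteq> r\<close> by simp
qed

text \<open>The common kernel of the atoms has a central projection. By atomicity a nonzero one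
  would majorize an atom, which would vanish on its own range. In this form the atoms sum to
  1.\<close>

lemma atoms_separate:
  assumes "\<And>q. q \<in> atoms \<Longrightarrow> q x = 0"
  shows "x = 0"
proof (rule ccontr)
  assume x: "x \<noteq> 0"
  define K where "K = (\<Inter>q\<in>atoms. {y. q y = 0})"
  have "closed K"
    unfolding K_def using closed_kernel[OF atomD(4)] by blast
  moreover have "q (x + y) = 0" if "q \<in> atoms" "q x = 0" "q y = 0" for q x y
    using bounded_clinearD(3)[OF atomD(4)[OF that(1)]] that by simp
  moreover have "q (c *\<^sub>C x) = 0" if "q \<in> atoms" "q x = 0" for q c x
    using bounded_clinearD(2)[OF atomD(4)[OF that(1)]] that by simp
  moreover have "q 0 = 0" if "q \<in> atoms" for q
    by (rule bounded_clinearD(5)[OF atomD(4)[OF that]])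
  ultimately have K: "closed_csubspace K"
    unfolding closed_csubspace_def K_def by blast
  have e: "orth_proj K \<in> projections (center R)"
    by (rule orth_proj_mem_center[OF K])
      (auto simp: K_def bounded_clinearD(5)[OF bounded] bounded_clinearD(5)[OF bounded_commutant]
        simp flip: atomD(5) atomD(6))
  have "orth_proj K x = x"
    using assms by (intro orth_proj_fixes[OF K]) (simp add: K_def)
  then have "orth_proj K \<noteq> (\<lambda>_. 0)"
    using x by metis
  then obtain q where q: "is_atom (projections (center R)) proj_le (\<lambda>_. 0) q" "proj_le q (orth_proj K)"
    using atomic e unfolding atomic_def by blast
  then have qa: "q \<in> atoms"
    by (simp add: atoms_def)
  have "range q \<subseteq> K"
    using q(2) by (simp add: proj_le_def range_orth_proj[OF K])
  then have "q (q y) = 0" for y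
    using qa by (auto simp: K_def)
  then have "q = (\<lambda>_. 0)"
    by (simp add: atomD(7)[OF qa] fun_eq_iff)
  then show False
    using q(1) by (simp add: is_atom_def)
qed

text \<open>Only finite sums are formed, since there may be uncountably many atoms; limits are
  handled by approximation.\<close>

definition atom_sum where
  "atom_sum F x = (\<Sum>q\<in>F. q x)"

lemma atom_sum_atom:
  assumes "finite F" "F \<subseteq> atoms" "q \<in> atoms"
  shows "q (atom_sum F x) = (if q \<in> F then q x else 0)"
proof -
  have "q (atom_sum F x) = (\<Sum>r\<in>F. q (r x))"
    by (simp add: atom_sum_def bounded_clinearD(7)[OF atomD(4)[OF assms(3)]])
  also have "\<dots> = (\<Sum>r\<in>F. if r = q then q x else 0)"
    using assms by (intro sum.cong) (auto simp: atoms_orthogonal atomD(7))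
  finally show ?thesis
    using assms by simp
qed

lemma atom_sum_mem:
  assumes "F \<subseteq> atoms"
  shows "atom_sum F \<in> R"
  unfolding atom_sum_def[abs_def] using assms atomD(1) by (intro sum_mem) blast

lemma atom_sum_commute:
  assumes "F \<subseteq> atoms" "a \<in> R"
  shows "a (atom_sum F x) = atom_sum F (a x)"
  unfolding atom_sum_def bounded_clinearD(7)[OF bounded[OF assms(2)]]
  using assms atomD(5) by (intro sum.cong) blast+

lemma atom_sum_projection:
  assumes "finite F" "F \<subseteq> atoms"
  shows "projection (atom_sum F)"
proof -
  have "atom_sum F (atom_sum F x) = atom_sum F x" for x
  proof -
    have "atom_sum F (atom_sum F x) = (\<Sum>q\<in>F. q (atom_sum F x))"
      by (rule atom_sum_def)
    also have "\<dots> = (\<Sum>q\<in>F. q x)"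
    proof (rule sum.cong[OF refl])
      fix q
      assume "q \<in> F"
      then show "q (atom_sum F x) = q x"
        using atom_sum_atom[OF assms, of q x] assms(2) by auto
    qed
    finally show ?thesis
      by (simp add: atom_sum_def)
  qed
  moreover have "cinner (atom_sum F x) y = cinner x (atom_sum F y)" for x y
    unfolding atom_sum_def cinner.sum_left cinner.sum_right
    using assms atomD(3) projectionD(3) by (intro sum.cong) blast+
  ultimately show ?thesis
    using bounded[OF atom_sum_mem[OF assms(2)]] by (simp add: projection_iff)
qed

lemma norm_atom_sum:
  assumes "finite F" "F \<subseteq> atoms"
  shows "(norm (atom_sum F x))\<^sup>2 = (\<Sum>q\<in>F. (norm (q x))\<^sup>2)"
proof -
  have "cinner (atom_sum F x) (atom_sum F x) = cinner x (atom_sum F x)"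
    using projectionD[OF atom_sum_projection[OF assms]] by metis
  also have "\<dots> = (\<Sum>q\<in>F. cinner (q x) (q x))"
    unfolding atom_sum_def cinner.sum_right
  proof (rule sum.cong[OF refl])
    fix q
    assume "q \<in> F"
    then have q: "q \<in> atoms"
      using assms by blast
    show "cinner x (q x) = cinner (q x) (q x)"
      by (simp add: projectionD(3)[OF atomD(3)[OF q]] atomD(7)[OF q])
  qed
  finally show ?thesis
    by (simp flip: Re_cinner_self)
qed

text \<open>The vectors fixed by some finite sum form a subspace containing all \<open>q y\<close>;
  a vector orthogonal to it is annihilated by every atom, so it is dense. Two vectors are treated at
  once because the points to be approximated belong to graphs.\<close>

lemma atom_sum_approx:
  assumes e: "e > 0"
  shows "\<exists>F. finite F \<and> F \<subseteq> atoms \<and> norm (x - atom_sum F x) < e \<and> norm (y - atom_sum F y) < e"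
proof -
  define S where "S = {x. \<exists>F. finite F \<and> F \<subseteq> atoms \<and> atom_sum F x = x}"
  have bF: "bounded_clinear (atom_sum F)" if "F \<subseteq> atoms" for F
    by (rule bounded[OF atom_sum_mem[OF that]])
  have larger: "atom_sum G (atom_sum F x) = atom_sum F x"
    if "finite G" "G \<subseteq> atoms" "F \<subseteq> G" for F G x
  proof -
    have "atom_sum G (atom_sum F x) = (\<Sum>q\<in>G. if q \<in> F then q x else 0)"
      unfolding atom_sum_def[of G] using that finite_subset[OF that(3,1)]
      by (intro sum.cong) (auto simp: atom_sum_atom subset_iff)
    also have "\<dots> = atom_sum F x"
      unfolding atom_sum_def using that by (simp add: sum.If_cases Int_absorb1)
    finally show ?thesis .
  qed
  have "closure S = UNIV"
  proof -
    have Sadd: "x + y \<in> S" if xy: "x \<in> S" "y \<in> S" for x y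
    proof -
      obtain F G where F: "finite F" "F \<subseteq> atoms" "atom_sum F x = x"
        and G: "finite G" "G \<subseteq> atoms" "atom_sum G y = y"
        using xy by (auto simp: S_def)
      have "atom_sum (F \<union> G) x = x" "atom_sum (F \<union> G) y = y"
        using larger[of "F \<union> G" F x] larger[of "F \<union> G" G y] F G by simp_all
      then show ?thesis
        using F G bounded_clinearD(3)[OF bF[of "F \<union> G"]]
        by (auto simp: S_def intro!: exI[of _ "F \<union> G"])
    qed
    have Sscale: "c *\<^sub>C x \<in> S" if x: "x \<in> S" for c x
    proof -
      obtain F where F: "finite F" "F \<subseteq> atoms" "atom_sum F x = x"
        using x by (auto simp: S_def)
      then have "atom_sum F (c *\<^sub>C x) = c *\<^sub>C x"
        using bounded_clinearD(2)[OF bF[OF F(2)]] by simp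
      then show ?thesis
        using F by (auto simp: S_def)
    qed
    have S0: "0 \<in> S"
      by (auto simp: S_def atom_sum_def intro!: exI[of _ "{}"])
    have K: "closed_csubspace (closure S)"
      unfolding closed_csubspace_def
    proof (intro conjI ballI allI)
      fix x y
      assume "x \<in> closure S" "y \<in> closure S"
      then obtain a b where "\<And>n. a n \<in> S" "a \<longlonglongrightarrow> x" "\<And>n. b n \<in> S" "b \<longlonglongrightarrow> y"
        unfolding closure_sequential by blast
      then show "x + y \<in> closure S"
        unfolding closure_sequential using Sadd
        by (intro exI[of _ "\<lambda>n. a n + b n"]) (simp add: tendsto_add)
    next
      fix c x
      assume "x \<in> closure S"
      then obtain a where "\<And>n. a n \<in> S" "a \<longlonglongrightarrow> x"
        unfolding closure_sequential by blast
      then show "c *\<^sub>C x \<in> closure S"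
        unfolding closure_sequential using Sscale
        by (intro exI[of _ "\<lambda>n. c *\<^sub>C a n"])
          (simp add: bounded_linear.tendsto[OF bounded_linear_scaleC_right])
    next
      show "0 \<in> closure S"
        using S0 closure_subset by blast
    qed (rule closed_closure)
    have "x \<in> closure S" for x
    proof -
      have "q (x - orth_proj (closure S) x) = 0" if q: "q \<in> atoms" for q
      proof (rule cinner_eqI)
        fix y
        have "atom_sum {q} (q y) = q y"
          by (simp add: atom_sum_def atomD(7)[OF q])
        then have "q y \<in> S"
          using q by (auto simp: S_def intro!: exI[of _ "{q}"])
        then have "q y \<in> closure S"
          using closure_subset by blast
        then show "cinner (q (x - orth_proj (closure S) x)) y = cinner 0 y"
          using orth_proj_orth[OF K] by (simp add: projectionD(3)[OF atomD(3)[OF q]])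
      qed
      then have "x - orth_proj (closure S) x = 0"
        by (rule atoms_separate)
      then show ?thesis
        using orth_proj_mem[OF K, of x] by simp
    qed
    then show ?thesis
      by blast
  qed
  then have close: "\<exists>F. finite F \<and> F \<subseteq> atoms \<and> norm (x - atom_sum F x) < e" for x
  proof -
    assume "closure S = UNIV"
    then have "x \<in> closure S"
      by simp
    then obtain x' where x': "x' \<in> S" "dist x' x < e"
      using e unfolding closure_approachable by blast
    then obtain F where F: "finite F" "F \<subseteq> atoms" "atom_sum F x' = x'"
      by (auto simp: S_def)
    have "x - atom_sum F x = (x - x') - atom_sum F (x - x')"
      by (simp add: bounded_clinearD(4)[OF bF[OF F(2)]] F(3))
    then have "norm (x - atom_sum F x) \<le> norm (x - x')"
      using norm_projection_complement_le[OF atom_sum_projection[OF F(1,2)], of "x - x'"]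
      by (simp only:)
    then show ?thesis
      using F x'(2) by (auto simp: dist_norm norm_minus_commute)
  qed
  obtain F G where F: "finite F" "F \<subseteq> atoms" "norm (x - atom_sum F x) < e"
    and G: "finite G" "G \<subseteq> atoms" "norm (y - atom_sum G y) < e"
    using close[of x] close[of y] by blast
  \<comment> \<open>Enlarging the finite set never worsens the approximation, so the union serves
    both vectors.\<close>
  have mono: "norm (x - atom_sum (F \<union> G) x) \<le> norm (x - atom_sum H x)"
    if "H \<subseteq> F \<union> G" for H x
  proof -
    have FG: "finite (F \<union> G)" "F \<union> G \<subseteq> atoms"
      using F G by auto
    have "x - atom_sum (F \<union> G) x = (x - atom_sum H x) - atom_sum (F \<union> G) (x - atom_sum H x)"
      by (simp add: bounded_clinearD(4)[OF bF[OF FG(2)]] larger[OF FG that])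
    then show ?thesis
      using norm_projection_complement_le[OF atom_sum_projection[OF FG], of "x - atom_sum H x"]
      by (simp only:)
  qed
  have "norm (x - atom_sum (F \<union> G) x) < e" "norm (y - atom_sum (F \<union> G) y) < e"
    using mono[of F x] mono[of G y] F(3) G(3) by simp_all
  moreover have "finite (F \<union> G)" "F \<union> G \<subseteq> atoms"
    using F G by auto
  ultimately show ?thesis
    by blast
qed

end

section \<open>Operators given by blocks\<close>

context atomic_vna
begin

definition block_family where
  "block_family t \<longleftrightarrow> (\<forall>q\<in>atoms. t q \<in> R \<and> (\<forall>x. q (t q x) = t q x \<and> t q (q x) = t q x))"

text \<open>The maximal operator with the given blocks. Square summability of the family
  \<open>t q \<xi>\<close> is implicit in the existence of \<eta>, and closedness is immediate
  because the graph is an intersection of closed conditions.\<close>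

definition block_operator where
  "block_operator t = {(\<xi>, \<eta>). \<forall>q\<in>atoms. q \<eta> = t q \<xi>}"

lemma block_operatorD: "(\<xi>, \<eta>) \<in> block_operator t \<Longrightarrow> q \<in> atoms \<Longrightarrow> q \<eta> = t q \<xi>"
  by (simp add: block_operator_def)

lemma block_operatorI: "(\<And>q. q \<in> atoms \<Longrightarrow> q \<eta> = t q \<xi>) \<Longrightarrow> (\<xi>, \<eta>) \<in> block_operator t"
  by (simp add: block_operator_def)

lemma closed_block_operator:
  assumes t: "\<And>q. q \<in> atoms \<Longrightarrow> t q \<in> R"
  shows "closed (block_operator t)"
proof -
  have c: "continuous_on UNIV a" if "bounded_clinear a" for a :: "'a \<Rightarrow> 'a"
    using bounded_linear.continuous_on[OF bounded_clinearD(1)[OF that] continuous_on_id] .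
  have "closed {z. q (snd z) = t q (fst z)}" if q: "q \<in> atoms" for q
    by (intro closed_Collect_eq continuous_on_compose2[OF c[OF atomD(4)[OF q]]]
        continuous_on_compose2[OF c[OF bounded[OF t[OF q]]]] continuous_intros) simp_all
  then have "closed (\<Inter>q\<in>atoms. {z. q (snd z) = t q (fst z)})"
    by blast
  also have "(\<Inter>q\<in>atoms. {z. q (snd z) = t q (fst z)}) = block_operator t"
    by (auto simp: block_operator_def)
  finally show ?thesis .
qed

lemma block_operator_unique:
  assumes "(\<xi>, \<eta>) \<in> block_operator t" "(\<xi>, \<zeta>) \<in> block_operator t"
  shows "\<eta> = \<zeta>"
proof -
  have "q (\<eta> - \<zeta>) = 0" if q: "q \<in> atoms" for q
    using block_operatorD[OF assms(1) q] block_operatorD[OF assms(2) q]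
    by (simp add: bounded_clinearD(4)[OF atomD(4)[OF q]])
  then have "\<eta> - \<zeta> = 0"
    by (rule atoms_separate)
  then show ?thesis
    by simp
qed

context
  fixes t
  assumes t: "block_family t"
begin

lemma block_familyD:
  assumes "q \<in> atoms"
  shows "t q \<in> R" "bounded_clinear (t q)" "q (t q x) = t q x" "t q (q x) = t q x"
  using t assms bounded by (auto simp: block_family_def)

lemma block_operator_atom_sum:
  assumes F: "finite F" "F \<subseteq> atoms"
  shows "(atom_sum F \<xi>, \<Sum>q\<in>F. t q \<xi>) \<in> block_operator t"
proof (rule block_operatorI)
  fix r
  assume r: "r \<in> atoms"
  have "r (\<Sum>q\<in>F. t q \<xi>) = (\<Sum>q\<in>F. r (t q \<xi>))"
    by (rule bounded_clinearD(7)[OF atomD(4)[OF r]])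
  also have "\<dots> = (\<Sum>q\<in>F. if q = r then t r \<xi> else 0)"
  proof (rule sum.cong[OF refl])
    fix q
    assume "q \<in> F"
    then have q: "q \<in> atoms"
      using F by blast
    show "r (t q \<xi>) = (if q = r then t r \<xi> else 0)"
      using block_familyD(3)[OF q, of \<xi>] atoms_orthogonal[OF r q, of "t q \<xi>"] by (cases "q = r") auto
  qed
  also have "\<dots> = (if r \<in> F then t r \<xi> else 0)"
    using F by simp
  also have "\<dots> = t r (r (atom_sum F \<xi>))"
    using atom_sum_atom[OF F r] block_familyD(4)[OF r] bounded_clinearD(5)[OF block_familyD(2)[OF r]]
    by simp
  finally show "r (\<Sum>q\<in>F. t q \<xi>) = t r (atom_sum F \<xi>)"
    by (simp add: block_familyD(4)[OF r])
qed

text \<open>The finite truncations form a core: cutting \<xi> and \<eta> by the same finite sum of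
  atoms approximates the graph point. Inclusions into strong sums and products, which are closures,
  are reduced to finite sums this way.\<close>

lemma block_operator_closed_superset:
  assumes S: "closed S"
    and sub: "\<And>F. finite F \<Longrightarrow> F \<subseteq> atoms \<Longrightarrow> (atom_sum F \<xi>, \<Sum>q\<in>F. t q \<xi>) \<in> S"
    and mem: "(\<xi>, \<eta>) \<in> block_operator t"
  shows "(\<xi>, \<eta>) \<in> S"
proof -
  have "(\<xi>, \<eta>) \<in> closure S"
    unfolding closure_approachable
  proof (intro allI impI)
    fix e :: real
    assume e: "e > 0"
    obtain F where F: "finite F" "F \<subseteq> atoms" "norm (\<xi> - atom_sum F \<xi>) < e / 2"
        "norm (\<eta> - atom_sum F \<eta>) < e / 2"
      using atom_sum_approx[of "e / 2" \<xi> \<eta>] e by auto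
    have "atom_sum F \<eta> = (\<Sum>q\<in>F. t q \<xi>)"
      unfolding atom_sum_def using F block_operatorD[OF mem] by (intro sum.cong) auto
    then have "(atom_sum F \<xi>, atom_sum F \<eta>) \<in> S"
      using sub[OF F(1,2)] by simp
    moreover have "dist (atom_sum F \<xi>, atom_sum F \<eta>) (\<xi>, \<eta>) < e"
    proof -
      have "dist (atom_sum F \<xi>, atom_sum F \<eta>) (\<xi>, \<eta>) = norm (\<xi> - atom_sum F \<xi>, \<eta> - atom_sum F \<eta>)"
        by (simp add: dist_norm norm_minus_commute norm_Pair)
      also have "\<dots> \<le> norm (\<xi> - atom_sum F \<xi>) + norm (\<eta> - atom_sum F \<eta>)"
        by (rule norm_Pair_le)
      finally show ?thesis
        using F by simp
    qed
    ultimately show "\<exists>y\<in>S. dist y (\<xi>, \<eta>) < e"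
      by blast
  qed
  then show ?thesis
    using S by simp
qed

lemma linear_block_operator: "linear_operator (block_operator t)"
  unfolding linear_operator_def
proof (intro conjI allI impI)
  show "single_valued (block_operator t)"
    unfolding single_valued_def by (intro allI impI) (erule (1) block_operator_unique)
  show "(0, 0) \<in> block_operator t"
    by (rule block_operatorI)
      (simp add: bounded_clinearD(5)[OF atomD(4)] bounded_clinearD(5)[OF block_familyD(2)])
  fix \<xi> \<eta> \<xi>' \<eta>' c
  assume m: "(\<xi>, \<eta>) \<in> block_operator t"
  show "(c *\<^sub>C \<xi>, c *\<^sub>C \<eta>) \<in> block_operator t"
    by (rule block_operatorI) (simp add: block_operatorD[OF m] bounded_clinearD(2)[OF atomD(4)]
        bounded_clinearD(2)[OF block_familyD(2)])
  assume m': "(\<xi>', \<eta>') \<in> block_operator t"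
  show "(\<xi> + \<xi>', \<eta> + \<eta>') \<in> block_operator t"
    by (rule block_operatorI) (simp add: block_operatorD[OF m] block_operatorD[OF m']
        bounded_clinearD(3)[OF atomD(4)] bounded_clinearD(3)[OF block_familyD(2)])
qed

lemma closed_densely_defined_block_operator: "closed_densely_defined (block_operator t)"
proof -
  have "\<xi> \<in> closure (Domain (block_operator t))" for \<xi>
    unfolding closure_approachable
  proof (intro allI impI)
    fix e :: real
    assume "e > 0"
    then obtain F where F: "finite F" "F \<subseteq> atoms" "norm (\<xi> - atom_sum F \<xi>) < e"
      using atom_sum_approx[of e \<xi> \<xi>] by blast
    show "\<exists>y\<in>Domain (block_operator t). dist y \<xi> < e"
      by (rule bexI[OF _ DomainI[OF block_operator_atom_sum[OF F(1,2), of \<xi>]]])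
        (use F(3) in \<open>simp add: dist_norm norm_minus_commute\<close>)
  qed
  then show ?thesis
    using linear_block_operator closed_block_operator[of t] block_familyD(1)
    by (auto simp: closed_densely_defined_def)
qed

lemma affiliated_block_operator: "affiliated R (block_operator t)"
  unfolding affiliated_def
proof (intro ballI allI impI block_operatorI)
  fix b \<xi> \<eta> q
  assume b: "b \<in> commutant R" and m: "(\<xi>, \<eta>) \<in> block_operator t" and q: "q \<in> atoms"
  show "q (b \<eta>) = t q (b \<xi>)"
    using atomD(6)[OF q b, of \<eta>] block_operatorD[OF m q] commute[OF block_familyD(1)[OF q] b, of \<xi>]
    by simp
qed

text \<open>An atom lies in the commutant, so affiliation cuts every graph point of \<open>x\<close>
  down to its blocks; the converse inclusion is closedness together with the core of
  truncations.\<close>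

lemma affiliated_eq_block_operator:
  assumes x: "closed_densely_defined x" and aff: "affiliated R x"
    and tx: "\<And>q \<xi>. q \<in> atoms \<Longrightarrow> (q \<xi>, t q \<xi>) \<in> x"
  shows "x = block_operator t"
proof -
  note xD = closed_densely_definedD[OF x]
  have "(\<xi>, \<eta>) \<in> block_operator t" if m: "(\<xi>, \<eta>) \<in> x" for \<xi> \<eta>
  proof (rule block_operatorI)
    fix q
    assume q: "q \<in> atoms"
    then have "(q \<xi>, q \<eta>) \<in> x"
      using aff m atomD(2) by (simp add: affiliated_def)
    then show "q \<eta> = t q \<xi>"
      using xD(5) tx[OF q] by blast
  qed
  moreover have "(\<xi>, \<eta>) \<in> x" if m: "(\<xi>, \<eta>) \<in> block_operator t" for \<xi> \<eta>
  proof (rule block_operator_closed_superset[OF xD(1) _ m])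
    fix F
    assume "finite F" "F \<subseteq> atoms"
    then show "(atom_sum F \<xi>, \<Sum>q\<in>F. t q \<xi>) \<in> x"
    proof induction
      case empty
      then show ?case
        using xD(2) by (simp add: atom_sum_def)
    next
      case (insert q F)
      then show ?case
        using xD(3)[OF tx[of q \<xi>]] by (simp add: atom_sum_def)
    qed
  qed
  ultimately show ?thesis
    by auto
qed

section \<open>Central cutoffs by block norm and local measurability\<close>

definition small_blocks where
  "small_blocks k = (\<Inter>q\<in>{q\<in>atoms. onorm (t q) > real k}. {\<xi>. q \<xi> = 0})"

lemma closed_csubspace_small_blocks: "closed_csubspace (small_blocks k)"
proof -
  have "closed (small_blocks k)"
    unfolding small_blocks_def using closed_kernel[OF atomD(4)] by blast
  moreover have "q (x + y) = 0" if "q \<in> atoms" "q x = 0" "q y = 0" for q x y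
    using bounded_clinearD(3)[OF atomD(4)[OF that(1)]] that by simp
  moreover have "q (c *\<^sub>C x) = 0" if "q \<in> atoms" "q x = 0" for q c x
    using bounded_clinearD(2)[OF atomD(4)[OF that(1)]] that by simp
  moreover have "q 0 = 0" if "q \<in> atoms" for q
    by (rule bounded_clinearD(5)[OF atomD(4)[OF that]])
  ultimately show ?thesis
    unfolding closed_csubspace_def small_blocks_def by blast
qed

text \<open>The sum of all atoms whose block has norm at most k, obtained without summation as the
  projection onto the common kernel of the remaining atoms.\<close>

definition cutoff where
  "cutoff k = orth_proj (small_blocks k)"

lemma small_blocks_invariant:
  assumes "x \<in> small_blocks k"
  shows "a \<in> R \<Longrightarrow> a x \<in> small_blocks k" "b \<in> commutant R \<Longrightarrow> b x \<in> small_blocks k"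
proof -
  have "q (a x) = 0" if "a \<in> R" "q \<in> atoms" "q x = 0" for q
    using atomD(5)[OF that(2,1), of x] bounded_clinearD(5)[OF bounded[OF that(1)]] that(3) by simp
  then show "a \<in> R \<Longrightarrow> a x \<in> small_blocks k"
    using assms by (auto simp: small_blocks_def)
  have "q (b x) = 0" if "b \<in> commutant R" "q \<in> atoms" "q x = 0" for q
    using atomD(6)[OF that(2,1), of x] bounded_clinearD(5)[OF bounded_commutant[OF that(1)]] that(3)
    by simp
  then show "b \<in> commutant R \<Longrightarrow> b x \<in> small_blocks k"
    using assms by (auto simp: small_blocks_def)
qed

lemma cutoff_center: "cutoff k \<in> projections (center R)"
  unfolding cutoff_def
  by (rule orth_proj_mem_center[OF closed_csubspace_small_blocks])
    (rule small_blocks_invariant; assumption)+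

lemma range_cutoff: "range (cutoff k) = small_blocks k"
  unfolding cutoff_def by (rule range_orth_proj[OF closed_csubspace_small_blocks])

lemma atom_in_small_blocks:
  assumes q: "q \<in> atoms" and k: "onorm (t q) \<le> real k"
  shows "q x \<in> small_blocks k"
  unfolding small_blocks_def using k atoms_orthogonal[OF _ q] by force

text \<open>Each single block is bounded, so every atom lies below some cutoff. A projection above
  all cutoffs therefore dominates all atoms, and its complement is annihilated by them.\<close>

lemma cutoff_increases: "increases_to_one cutoff"
  unfolding increases_to_one_def
proof (intro conjI allI impI)
  show "projection (cutoff k)" for k
    by (rule center_projectionD(3)[OF cutoff_center])
  show "proj_le (cutoff k) (cutoff (Suc k))" for k
    unfolding proj_le_def range_cutoff by (auto simp: small_blocks_def)
  fix e :: "'a \<Rightarrow> 'a"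
  assume e: "projection e" and le: "\<forall>k. proj_le (cutoff k) e"
  have eq: "e (q x) = q x" if q: "q \<in> atoms" for q x
  proof -
    obtain k where "onorm (t q) \<le> real k"
      using real_arch_simple by blast
    then have "q x \<in> range (cutoff k)"
      using atom_in_small_blocks[OF q] by (simp add: range_cutoff)
    then have "q x \<in> range e"
      using le by (auto simp: proj_le_def)
    then show ?thesis
      using projectionD(2)[OF e] by auto
  qed
  have "x - e x = 0" for x
  proof (rule atoms_separate)
    fix q
    assume q: "q \<in> atoms"
    show "q (x - e x) = 0"
    proof (rule cinner_eqI)
      fix y
      have "cinner (q (x - e x)) y = cinner (x - e x) (e (q y))"
        by (simp add: projectionD(3)[OF atomD(3)[OF q]] eq[OF q])
      also have "\<dots> = cinner (e (x - e x)) (q y)"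
        by (simp add: projectionD(3)[OF e])
      also have "e (x - e x) = 0"
        by (simp add: bounded_clinearD(4)[OF projectionD(1)[OF e]] projectionD(2)[OF e])
      finally show "cinner (q (x - e x)) y = cinner 0 y"
        by simp
    qed
  qed
  then show "e = id"
    by (simp add: fun_eq_iff)
qed

text \<open>Blocks are mutually orthogonal, so the bound on each gives the bound on finite
  truncations, and these approximate \<eta>.\<close>

lemma block_operator_bound:
  assumes m: "(\<xi>, \<eta>) \<in> block_operator t" and \<xi>: "\<xi> \<in> small_blocks k"
  shows "norm \<eta> \<le> real k * norm \<xi>"
proof (rule field_le_epsilon)
  fix e :: real
  assume "e > 0"
  then obtain F where F: "finite F" "F \<subseteq> atoms" "norm (\<eta> - atom_sum F \<eta>) < e"
    using atom_sum_approx[of e \<eta> \<eta>] by blast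
  have le: "norm (q \<eta>) \<le> real k * norm (q \<xi>)" if q: "q \<in> atoms" for q
  proof (cases "onorm (t q) > real k")
    case True
    then have "q \<xi> = 0"
      using \<xi> q by (auto simp: small_blocks_def)
    then have "t q \<xi> = 0"
      using block_familyD(4)[OF q, of \<xi>] bounded_clinearD(5)[OF block_familyD(2)[OF q]] by simp
    then show ?thesis
      using block_operatorD[OF m q] by simp
  next
    case False
    have "q \<eta> = t q (q \<xi>)"
      using block_operatorD[OF m q] block_familyD(4)[OF q] by simp
    also have "norm \<dots> \<le> onorm (t q) * norm (q \<xi>)"
      by (rule onorm[OF bounded_clinearD(1)[OF block_familyD(2)[OF q]]])
    also have "\<dots> \<le> real k * norm (q \<xi>)"
      using False by (intro mult_right_mono) auto
    finally show ?thesis .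
  qed
  have "(norm (atom_sum F \<eta>))\<^sup>2 = (\<Sum>q\<in>F. (norm (q \<eta>))\<^sup>2)"
    by (rule norm_atom_sum[OF F(1,2)])
  also have "\<dots> \<le> (\<Sum>q\<in>F. (real k * norm (q \<xi>))\<^sup>2)"
    using le F(2) by (intro sum_mono power_mono) auto
  also have "\<dots> = (real k)\<^sup>2 * (\<Sum>q\<in>F. (norm (q \<xi>))\<^sup>2)"
    by (simp add: power_mult_distrib sum_distrib_left)
  also have "\<dots> = (real k * norm (atom_sum F \<xi>))\<^sup>2"
    by (simp add: norm_atom_sum[OF F(1,2)] power_mult_distrib)
  finally have "norm (atom_sum F \<eta>) \<le> real k * norm (atom_sum F \<xi>)"
    by (rule power2_le_imp_le) simp
  also have "\<dots> \<le> real k * norm \<xi>"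
    by (intro mult_left_mono projection_norm_le atom_sum_projection F) simp
  finally show "norm \<eta> \<le> real k * norm \<xi> + e"
    using F(3) norm_triangle_ineq[of "\<eta> - atom_sum F \<eta>" "atom_sum F \<eta>"] by simp
qed

lemma block_operator_diff:
  assumes "(\<xi>, \<eta>) \<in> block_operator t" "(\<xi>', \<eta>') \<in> block_operator t"
  shows "(\<xi> - \<xi>', \<eta> - \<eta>') \<in> block_operator t"
  by (rule block_operatorI) (simp add: block_operatorD[OF assms(1)] block_operatorD[OF assms(2)]
      bounded_clinearD(4)[OF atomD(4)] bounded_clinearD(4)[OF block_familyD(2)])

text \<open>On truncations of a vector in \<open>small_blocks k\<close> the operator is bounded by
  k, so their images are Cauchy, and closedness supplies the value.\<close>

lemma cutoff_in_domain: "\<exists>\<eta>. (cutoff k \<xi>, \<eta>) \<in> block_operator t"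
proof -
  define \<zeta> where "\<zeta> = cutoff k \<xi>"
  have \<zeta>: "\<zeta> \<in> small_blocks k"
    using range_cutoff by (auto simp: \<zeta>_def)
  have "\<exists>F. finite F \<and> F \<subseteq> atoms \<and> norm (\<zeta> - atom_sum F \<zeta>) < inverse (real (Suc n))" for n
    using atom_sum_approx[of "inverse (real (Suc n))" \<zeta> \<zeta>] by auto
  then obtain F where F: "\<And>n. finite (F n)" "\<And>n. F n \<subseteq> atoms"
    and near: "\<And>n. norm (\<zeta> - atom_sum (F n) \<zeta>) < inverse (real (Suc n))"
    by metis
  define \<eta> where "\<eta> n = (\<Sum>q\<in>F n. t q \<zeta>)" for n
  have mem: "(atom_sum (F n) \<zeta>, \<eta> n) \<in> block_operator t" for n
    unfolding \<eta>_def by (rule block_operator_atom_sum[OF F])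
  have "(\<lambda>n. \<zeta> - atom_sum (F n) \<zeta>) \<longlonglongrightarrow> 0"
    by (rule Lim_null_comparison[OF _ LIMSEQ_inverse_real_of_nat], rule always_eventually, rule allI,
        rule less_imp_le, rule near)
  then have lim: "(\<lambda>n. atom_sum (F n) \<zeta>) \<longlonglongrightarrow> \<zeta>"
    using tendsto_diff[OF tendsto_const[of \<zeta>]] by fastforce
  have inS: "atom_sum (F n) \<zeta> \<in> small_blocks k" for n
    by (rule small_blocks_invariant(1)[OF \<zeta> atom_sum_mem[OF F(2)]])
  have bound: "norm (\<eta> m - \<eta> n) \<le> real k * norm (atom_sum (F m) \<zeta> - atom_sum (F n) \<zeta>)" for m n
    by (rule block_operator_bound[OF block_operator_diff[OF mem mem]
          closed_csubspace_diff[OF closed_csubspace_small_blocks inS inS]])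
  have "Cauchy \<eta>"
  proof (rule metric_CauchyI)
    fix e :: real
    assume e: "e > 0"
    have "Cauchy (\<lambda>n. atom_sum (F n) \<zeta>)"
      using lim by (rule LIMSEQ_imp_Cauchy)
    \<comment> \<open>The denominator is k + 1 because k may be 0.\<close>
    then obtain M where M: "\<And>m n. m \<ge> M \<Longrightarrow> n \<ge> M \<Longrightarrow>
        dist (atom_sum (F m) \<zeta>) (atom_sum (F n) \<zeta>) < e / (real k + 1)"
      using metric_CauchyD[of _ "e / (real k + 1)"] e
      by (metis add_nonneg_pos divide_pos_pos of_nat_0_le_iff zero_less_one)
    have "dist (\<eta> m) (\<eta> n) < e" if "m \<ge> M" "n \<ge> M" for m n
    proof -
      have "dist (\<eta> m) (\<eta> n) \<le> real k * dist (atom_sum (F m) \<zeta>) (atom_sum (F n) \<zeta>)"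
        using bound[of m n] by (simp add: dist_norm)
      also have "\<dots> \<le> (real k + 1) * dist (atom_sum (F m) \<zeta>) (atom_sum (F n) \<zeta>)"
        by (simp add: mult_right_mono)
      also have "\<dots> < e"
        using M[OF that] by (simp add: field_simps)
      finally show ?thesis .
    qed
    then show "\<exists>M. \<forall>m\<ge>M. \<forall>n\<ge>M. dist (\<eta> m) (\<eta> n) < e"
      by blast
  qed
  then obtain l where "\<eta> \<longlonglongrightarrow> l"
    using Cauchy_convergent convergent_def by blast
  then have pair_lim: "(\<lambda>n. (atom_sum (F n) \<zeta>, \<eta> n)) \<longlonglongrightarrow> (\<zeta>, l)"
    by (intro tendsto_Pair lim)
  have "closed (block_operator t)"
    by (rule closed_block_operator) (rule block_familyD(1))
  then have "(\<zeta>, l) \<in> block_operator t"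
    by (rule closed_sequentially[OF _ mem pair_lim])
  then show ?thesis
    unfolding \<zeta>_def by blast
qed

text \<open>The strong product with each cutoff is an everywhere defined bounded operator
  \<open>T\<close> in \<open>R\<close>, which is measurable.\<close>

lemma block_operator_locally_measurable: "block_operator t \<in> locally_measurable_ops R"
proof -
  have "op_of (cutoff k) \<cdot>\<^sub>s block_operator t \<in> measurable_ops R" for k
  proof -
    note zc = center_projectionD[OF cutoff_center[of k]]
    note cdd = closed_densely_definedD[OF closed_densely_defined_block_operator]
    obtain T where T: "\<And>\<xi>. (cutoff k \<xi>, T \<xi>) \<in> block_operator t"
      using cutoff_in_domain[of k] by metis
    have Teq: "T \<xi> = \<eta>" if "(cutoff k \<xi>, \<eta>) \<in> block_operator t" for \<xi> \<eta>
      using block_operator_unique[OF T that] .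
    have Tm: "T \<in> R"
    proof (rule memI)
      note zb = projectionD(1)[OF zc(3)]
      show "bounded_clinear T"
      proof (rule bounded_clinearI[of _ "real k"])
        show "T (x + y) = T x + T y" for x y
          by (rule Teq) (simp add: bounded_clinearD(3)[OF zb] cdd(3)[OF T T])
        show "T (c *\<^sub>C x) = c *\<^sub>C T x" for c x
          by (rule Teq) (simp add: bounded_clinearD(2)[OF zb] cdd(4)[OF T])
        show "norm (T x) \<le> norm x * real k" for x
        proof -
          have "cutoff k x \<in> small_blocks k"
            using range_cutoff by auto
          then have "norm (T x) \<le> real k * norm (cutoff k x)"
            by (rule block_operator_bound[OF T])
          also have "\<dots> \<le> real k * norm x"
            by (intro mult_left_mono projection_norm_le zc(3)) simp
          finally show ?thesis
            by (simp add: mult.commute)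
        qed
      qed
      fix b x
      assume b: "b \<in> commutant R"
      have "(b (cutoff k x), b (T x)) \<in> block_operator t"
        using affiliated_block_operator T b unfolding affiliated_def by blast
      then show "b (T x) = T (b x)"
        using Teq[of "b x" "b (T x)"] zc(5)[OF b] by simp
    qed
    \<comment> \<open>The algebraic product is only the restriction of \<open>T\<close> to the
      domain of the block operator; by density its closure is all of \<open>T\<close>.\<close>
    define W where "W = {(\<xi>, \<zeta>) | \<xi> \<eta> \<zeta>. (\<xi>, \<eta>) \<in> block_operator t \<and> (\<eta>, \<zeta>) \<in> op_of (cutoff k)}"
    have W: "(\<xi>, \<zeta>) \<in> W \<longleftrightarrow> (\<exists>\<eta>. (\<xi>, \<eta>) \<in> block_operator t) \<and> \<zeta> = T \<xi>" for \<xi> \<zeta>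
    proof -
      have "cutoff k \<eta> = T \<xi>" if "(\<xi>, \<eta>) \<in> block_operator t" for \<eta>
      proof -
        have "(cutoff k \<xi>, cutoff k \<eta>) \<in> block_operator t"
          using affiliated_block_operator that zc(2) unfolding affiliated_def by blast
        then show ?thesis
          using Teq by simp
      qed
      then show ?thesis
        by (auto simp: W_def op_of_def) metis
    qed
    have meas: "op_of T \<in> measurable_ops R"
      by (rule op_of_measurable[OF Tm])
    then have "closed (op_of T)"
      by (simp add: measurable_ops_def closed_densely_defined_def)
    then have "closure W \<subseteq> op_of T"
      by (rule closure_minimal[rotated]) (auto simp: W op_of_def)
    moreover have "op_of T \<subseteq> closure W"
    proof
      fix z
      assume "z \<in> op_of T"
      then obtain \<xi> where z: "z = (\<xi>, T \<xi>)"
        by (auto simp: op_of_def)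
      have "\<xi> \<in> closure (Domain (block_operator t))"
        using cdd(6) by simp
      then obtain x where x: "\<And>n. x n \<in> Domain (block_operator t)" "x \<longlonglongrightarrow> \<xi>"
        unfolding closure_sequential by blast
      have "(\<lambda>n. (x n, T (x n))) \<longlonglongrightarrow> (\<xi>, T \<xi>)"
        by (intro tendsto_Pair x bounded_linear.tendsto[OF bounded_clinearD(1)[OF bounded[OF Tm]]])
      moreover have "(x n, T (x n)) \<in> W" for n
        using x(1)[of n] by (auto simp: W)
      ultimately show "z \<in> closure W"
        unfolding closure_sequential z by (intro exI[of _ "\<lambda>n. (x n, T (x n))"]) simp
    qed
    ultimately have "op_of (cutoff k) \<cdot>\<^sub>s block_operator t = op_of T"
      by (simp add: strong_mult_def W_def subset_antisym)
    then show ?thesis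
      using meas by simp
  qed
  then show ?thesis
    unfolding locally_measurable_ops_def
    using closed_densely_defined_block_operator affiliated_block_operator cutoff_center cutoff_increases
    by blast
qed

end

text \<open>One inclusion holds because passing to blocks is continuous and survives all three
  closures. The other holds because finite truncations lie in the domains of both algebraic products
  and form a core of the right-hand side.\<close>

lemma commutator_block_operator:
  assumes m: "block_family m" and a: "a \<in> R"
  shows "(block_operator m \<cdot>\<^sub>s op_of a) -\<^sub>s (op_of a \<cdot>\<^sub>s block_operator m)
    = block_operator (\<lambda>q x. m q (a x) - a (m q x))"
proof -
  note mD = block_familyD[OF m]
  define A where "A = block_operator m \<cdot>\<^sub>s op_of a"
  define B where "B = op_of a \<cdot>\<^sub>s block_operator m"
  have dR: "(\<lambda>x. m q (a x)) \<in> R" "(\<lambda>x. a (m q x)) \<in> R" if "q \<in> atoms" for q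
    using compose_mem[OF mD(1)[OF that] a] compose_mem[OF a mD(1)[OF that]] .
  have bf: "block_family (\<lambda>q x. m q (a x) - a (m q x))"
    unfolding block_family_def
  proof (intro ballI conjI allI)
    fix q x
    assume q: "q \<in> atoms"
    show "(\<lambda>x. m q (a x) - a (m q x)) \<in> R"
      by (rule diff_mem[OF dR[OF q]])
    show "q (m q (a x) - a (m q x)) = m q (a x) - a (m q x)"
      by (simp add: bounded_clinearD(4)[OF atomD(4)[OF q]] mD[OF q] flip: atomD(5)[OF q a])
    show "m q (a (q x)) - a (m q (q x)) = m q (a x) - a (m q x)"
      by (simp add: atomD(5)[OF q a] mD[OF q])
  qed
  have A: "A \<subseteq> block_operator (\<lambda>q x. m q (a x))"
    unfolding A_def strong_mult_def
    by (rule closure_minimal[OF _ closed_block_operator[OF dR(1)]])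
      (auto simp: op_of_def intro!: block_operatorI dest: block_operatorD)
  have B: "B \<subseteq> block_operator (\<lambda>q x. a (m q x))"
    unfolding B_def strong_mult_def
  proof (rule closure_minimal[OF _ closed_block_operator[OF dR(2)]])
    have "q (a \<eta>) = a (m q \<xi>)" if "(\<xi>, \<eta>) \<in> block_operator m" "q \<in> atoms" for q \<xi> \<eta>
      using block_operatorD[OF that] atomD(5)[OF that(2) a] by metis
    then show "{(\<xi>, \<zeta>) |\<xi> \<eta> \<zeta>. (\<xi>, \<eta>) \<in> block_operator m \<and> (\<eta>, \<zeta>) \<in> op_of a}
        \<subseteq> block_operator (\<lambda>q x. a (m q x))"
      by (auto simp: op_of_def intro!: block_operatorI)
  qed auto
  have "A -\<^sub>s B \<subseteq> block_operator (\<lambda>q x. m q (a x) - a (m q x))"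
    unfolding strong_diff_def
  proof (rule closure_minimal[OF _ closed_block_operator[OF block_familyD(1)[OF bf]]])
    have "q (\<eta> - \<zeta>) = m q (a \<xi>) - a (m q \<xi>)"
      if "(\<xi>, \<eta>) \<in> A" "(\<xi>, \<zeta>) \<in> B" "q \<in> atoms" for \<xi> \<eta> \<zeta> q
      using block_operatorD[OF subsetD[OF A that(1)] that(3)]
        block_operatorD[OF subsetD[OF B that(2)] that(3)]
      by (simp add: bounded_clinearD(4)[OF atomD(4)[OF that(3)]])
    then show "{(\<xi>, \<eta> - \<zeta>) |\<xi> \<eta> \<zeta>. (\<xi>, \<eta>) \<in> A \<and> (\<xi>, \<zeta>) \<in> B}
        \<subseteq> block_operator (\<lambda>q x. m q (a x) - a (m q x))"
      by (auto intro!: block_operatorI)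
  qed
  moreover have "block_operator (\<lambda>q x. m q (a x) - a (m q x)) \<subseteq> A -\<^sub>s B"
  proof clarify
    fix \<xi> \<eta>
    assume mem: "(\<xi>, \<eta>) \<in> block_operator (\<lambda>q x. m q (a x) - a (m q x))"
    have "closed (A -\<^sub>s B)"
      by (simp add: strong_diff_def)
    then show "(\<xi>, \<eta>) \<in> A -\<^sub>s B"
    proof (rule block_operator_closed_superset[OF bf _ _ mem])
      fix F
      assume F: "finite F" "F \<subseteq> atoms"
      \<comment> \<open>Centrality of the atoms makes \<open>a\<close> map truncations to
        truncations, hence into the domain.\<close>
      have "(a (atom_sum F \<xi>), \<Sum>q\<in>F. m q (a \<xi>)) \<in> block_operator m"
        using block_operator_atom_sum[OF m F, of "a \<xi>"] by (simp add: atom_sum_commute[OF F(2) a])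
      then have "(atom_sum F \<xi>, \<Sum>q\<in>F. m q (a \<xi>)) \<in> A"
        unfolding A_def strong_mult_def
        by (intro subsetD[OF closure_subset]) (auto simp: op_of_def)
      moreover have "(atom_sum F \<xi>, a (\<Sum>q\<in>F. m q \<xi>)) \<in> B"
        unfolding B_def strong_mult_def using block_operator_atom_sum[OF m F, of \<xi>]
        by (intro subsetD[OF closure_subset]) (auto simp: op_of_def)
      ultimately have "(atom_sum F \<xi>, (\<Sum>q\<in>F. m q (a \<xi>)) - a (\<Sum>q\<in>F. m q \<xi>)) \<in> A -\<^sub>s B"
        unfolding strong_diff_def by (intro subsetD[OF closure_subset]) blast
      then show "(atom_sum F \<xi>, \<Sum>q\<in>F. m q (a \<xi>) - a (m q \<xi>)) \<in> A -\<^sub>s B"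
        by (simp add: sum_subtractf bounded_clinearD(7)[OF bounded[OF a]])
    qed
  qed
  ultimately show ?thesis
    by (simp add: A_def B_def)
qed

end

section \<open>Assembling the implementing operator from its blocks\<close>

theorem theorem2p6:
  fixes R :: "('h::chilbert_space \<Rightarrow> 'h) set"
    and D :: "('h \<Rightarrow> 'h) \<Rightarrow> 'h operator"
  assumes "von_neumann_algebra R"
    and "finite_algebra R"
    and "type_I R"
    and "atomic (projections (center R)) proj_le (\<lambda>_. 0)"
    and "derivation_LS R D"
  shows "inner_LS R D"
proof -
  interpret atomic_vna R
    by unfold_locales (rule assms)+
  have DLS: "D a \<in> locally_measurable_ops R" if "a \<in> R" for a
    using assms(5) that by (simp add: derivation_LS_def)
  have Dcdd: "closed_densely_defined (D a)" and Daff: "affiliated R (D a)" if "a \<in> R" for a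
    using DLS[OF that] by (simp_all add: locally_measurable_ops_def)
  note D_unique = closed_densely_definedD(5)[OF Dcdd]
  have corner: "\<exists>p. central_atom_abelian R q p" if q: "q \<in> atoms" for q
  proof -
    interpret q: central_atom R q
      by (rule atom_locale[OF q])
    obtain p where "abelian_projection R p" "p \<noteq> (\<lambda>_. 0)" "proj_le p q"
      using assms(3) q.q_center q.q_nonzero unfolding type_I_def by blast
    then have "central_atom_abelian R q p"
      by unfold_locales
    then show ?thesis
      by blast
  qed
  have block: "\<exists>t\<in>R. \<forall>\<xi>. (q \<xi>, t \<xi>) \<in> D a \<and> q (t \<xi>) = t \<xi> \<and> t (q \<xi>) = t \<xi>"
    if q: "q \<in> atoms" and a: "a \<in> R" for q a
  proof -
    obtain p where "central_atom_abelian R q p"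
      using corner[OF q] by blast
    then show ?thesis
      by (rule central_atom_abelian.affiliated_block[OF _ assms(2) Dcdd[OF a] Daff[OF a]])
  qed
  \<comment> \<open>The choice is harmless: \<open>D a\<close> is single valued, so its graph
    determines the block. The identities for \<delta> are derived from this uniqueness.\<close>
  define \<delta> where "\<delta> q a =
    (SOME t. t \<in> R \<and> (\<forall>\<xi>. (q \<xi>, t \<xi>) \<in> D a \<and> q (t \<xi>) = t \<xi> \<and> t (q \<xi>) = t \<xi>))" for q a
  have \<delta>: "\<delta> q a \<in> R" and \<delta>D: "(q \<xi>, \<delta> q a \<xi>) \<in> D a"
    and q\<delta>: "q (\<delta> q a \<xi>) = \<delta> q a \<xi>" and \<delta>q: "\<delta> q a (q \<xi>) = \<delta> q a \<xi>"
    if "q \<in> atoms" "a \<in> R" for q a \<xi>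
    using someI_ex[OF block[OF that, unfolded Bex_def]] unfolding \<delta>_def by blast+
  have inner: "\<exists>m\<in>R. (\<forall>x. q (m x) = m x \<and> m (q x) = m x) \<and>
      (\<forall>a\<in>R. \<forall>x. \<delta> q a x = m (a x) - a (m x))" if q: "q \<in> atoms" for q
  proof -
    obtain p where "central_atom_abelian R q p"
      using corner[OF q] by blast
    then interpret p: central_atom_abelian R q p .
    show ?thesis
    proof (rule p.block_derivation_inner[OF assms(2)])
      fix a b x
      assume a: "a \<in> R" and b: "b \<in> R"
      \<comment> \<open>At \<open>q x\<close> all algebraic operations are defined, and the strong
        ones extend them. No closure has to be computed: this point and the block point of
        \<open>D\<close> at the sum share a first component.\<close>
      have "(q x, \<delta> q a x + \<delta> q b x) \<in> D a +\<^sub>s D b"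
        unfolding strong_add_def using \<delta>D[OF q a] \<delta>D[OF q b]
        by (intro subsetD[OF closure_subset]) blast
      also have "D a +\<^sub>s D b = D (\<lambda>\<xi>. a \<xi> + b \<xi>)"
        using assms(5) a b by (simp add: derivation_LS_def)
      finally show "\<delta> q (\<lambda>x. a x + b x) x = \<delta> q a x + \<delta> q b x"
        using D_unique[OF add_mem[OF a b] \<delta>D[OF q add_mem[OF a b]]] by blast
      \<comment> \<open>Here \<open>b (q x)\<close> is \<open>q (b x)\<close> by centrality, a
        vector at which the block of \<open>D a\<close> is known.\<close>
      have "(q x, \<delta> q a (b x)) \<in> D a \<cdot>\<^sub>s op_of b"
        unfolding strong_mult_def using \<delta>D[OF q a, of "b x"] atomD(5)[OF q b, of x]
        by (intro subsetD[OF closure_subset]) (auto simp: op_of_def)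
      moreover have "(q x, a (\<delta> q b x)) \<in> op_of a \<cdot>\<^sub>s D b"
        unfolding strong_mult_def using \<delta>D[OF q b, of x]
        by (intro subsetD[OF closure_subset]) (auto simp: op_of_def)
      ultimately have "(q x, \<delta> q a (b x) + a (\<delta> q b x))
          \<in> (D a \<cdot>\<^sub>s op_of b) +\<^sub>s (op_of a \<cdot>\<^sub>s D b)"
        unfolding strong_add_def by (intro subsetD[OF closure_subset]) blast
      also have "(D a \<cdot>\<^sub>s op_of b) +\<^sub>s (op_of a \<cdot>\<^sub>s D b) = D (a \<circ> b)"
        using assms(5) a b by (simp add: derivation_LS_def)
      also have "a \<circ> b = (\<lambda>x. a (b x))"
        by (simp add: comp_def)
      finally show "\<delta> q (\<lambda>x. a (b x)) x = \<delta> q a (b x) + a (\<delta> q b x)"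
        using D_unique[OF compose_mem[OF a b] \<delta>D[OF q compose_mem[OF a b]]] by blast
    next
      fix c a x
      assume a: "a \<in> R"
      have "(q x, c *\<^sub>C \<delta> q a x) \<in> c *\<^sub>s D a"
        unfolding strong_scale_def using \<delta>D[OF q a]
        by (intro subsetD[OF closure_subset]) blast
      also have "c *\<^sub>s D a = D (\<lambda>\<xi>. c *\<^sub>C a \<xi>)"
        using assms(5) a by (simp add: derivation_LS_def)
      finally show "\<delta> q (\<lambda>x. c *\<^sub>C a x) x = c *\<^sub>C \<delta> q a x"
        using D_unique[OF scaleC_mem[OF a] \<delta>D[OF q scaleC_mem[OF a]]] by blast
    qed (use q \<delta> q\<delta> \<delta>q in auto)
  qed
  define m where "m q = (SOME m. m \<in> R \<and> (\<forall>x. q (m x) = m x \<and> m (q x) = m x) \<and>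
      (\<forall>a\<in>R. \<forall>x. \<delta> q a x = m (a x) - a (m x)))" for q
  have m: "m q \<in> R" and qm: "\<forall>x. q (m q x) = m q x \<and> m q (q x) = m q x"
    and \<delta>m: "\<forall>a\<in>R. \<forall>x. \<delta> q a x = m q (a x) - a (m q x)" if "q \<in> atoms" for q
    using someI_ex[OF inner[OF that, unfolded Bex_def]] unfolding m_def by blast+
  have bm: "block_family m"
    using m qm by (simp add: block_family_def)
  show ?thesis
    unfolding inner_LS_def
  proof (intro bexI ballI)
    show "block_operator m \<in> locally_measurable_ops R"
      by (rule block_operator_locally_measurable[OF bm])
    fix a
    assume a: "a \<in> R"
    \<comment> \<open>Both sides of the claim become block operators, so the commutator identity
      only has to be compared atom by atom.\<close>
    have "D a = block_operator (\<lambda>q. \<delta> q a)"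
    proof (rule affiliated_eq_block_operator[OF _ Dcdd[OF a] Daff[OF a]])
      show "block_family (\<lambda>q. \<delta> q a)"
        using \<delta> q\<delta> \<delta>q a by (simp add: block_family_def)
    qed (rule \<delta>D[OF _ a])
    also have "\<dots> = block_operator (\<lambda>q x. m q (a x) - a (m q x))"
      using \<delta>m a by (simp add: block_operator_def)
    finally show "D a = (block_operator m \<cdot>\<^sub>s op_of a) -\<^sub>s (op_of a \<cdot>\<^sub>s block_operator m)"
      by (simp add: commutator_block_operator[OF bm a])
  qed
qed

end
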